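(* Let $G$ be a finite group and let $\mathscr{C}$ be a set of subgroups of $G$ closed under conjugation. In the rational Burnside ring $\Omega(G)$, the reduced series Lefschetz invariants of $E\mathcal{O}_{\mathscr{C}}$ and $E\mathcal{A}_{\mathscr{C}}$ expand in transitive $G$-sets as $$\widetilde{\Lambda}_{\Sigma}(E\mathcal{O}_{\mathscr{C}})=\sum_{H\in\mathscr{C}}\frac{-\widetilde{\chi}(\mathscr{C}_{>H})}{|G:H|}[G/H]-[G/G],$$ $$\widetilde{\Lambda}_{\Sigma}(E\mathcal{A}_{\mathscr{C}})=\sum_{H\in\mathscr{C}}\frac{-\widetilde{\chi}(\mathscr{C}_{<H})}{|G:C_G(H)|}[G/C_G(H)]-[G/G],$$ and in the primitive idempotents of $\Omega(G)$ as $$\widetilde{\Lambda}_{\Sigma}(E\mathcal{O}_{\mathscr{C}})=\sum_{K\in[G\backslash\mathcal{S}(G)],\ K\notin\mathscr{C}}\widetilde{\chi}(\mathscr{C}_{>K})\,\varepsilon_K,\qquad \widetilde{\Lambda}_{\Sigma}(E\mathcal{A}_{\mathscr{C}})=\sum_{K\in[G\backslash\mathcal{S}(G)],\ C_G(K)\notin\mathscr{C}}\widetilde{\chi}(\mathscr{C}_{<C_G(K)})\,\varepsilon_K.$$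
   Context: $\Omega(G)=\mathbb{Q}\otimes_{\mathbb{Z}}\Omega_{\mathbb{Z}}(G)$, where $\Omega_{\mathbb{Z}}(G)$ is the integral Burnside ring of $G$; $[X]$ is the class of a finite $G$-set $X$. $\mathcal{S}(G)$ is the set of all subgroups of $G$ and $[G\backslash\mathcal{S}(G)]$ a set of representatives of its conjugacy classes. $\varepsilon_K\in\Omega(G)$ is the primitive idempotent corresponding to $K$: the linear extension of $X\mapsto|X^H|$ sends $\varepsilon_K$ to $1$ if $H$ is $G$-conjugate to $K$ and to $0$ otherwise. For any subgroup $H\le G$ (in $\mathscr{C}$ or not), $\mathscr{C}_{>H}$ (resp. $\mathscr{C}_{<H}$) is the poset of members of $\mathscr{C}$ properly containing (resp. properly contained in) $H$. For a finite poset, $\widetilde{\chi}=\chi-1$ is its reduced Euler characteristic, where $\chi$ is the Euler characteristic of the order complex (so $\widetilde{\chi}(\emptyset)=-1$). Series Lefschetz invariant: for a finite category $\mathsf{D}$ with a $G$-action, let $\mathsf{D}_n$ be the finite $G$-set of chains of $n$ composable non-identity morphisms ($\mathsf{D}_0=\mathrm{Obj}(\mathsf{D})$), and $f_{\mathsf{D}}(t)=\sum_{n\ge0}[\mathsf{D}_n]t^n\in\Omega(G)[[t]]\cong\Omega(G)\otimes_{\mathbb{Q}}\mathbb{Q}[[t]]$. Let $\mathbb{Q}[t]_{(t+1)}$ be the ring of rational functions $p/q$ with $(t+1)\nmid q$. $\mathsf{D}$ has series Lefschetz invariant if $f_{\mathsf{D}}\in\Omega(G)\otimes_{\mathbb{Q}}\mathbb{Q}[t]_{(t+1)}$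 (compared inside Laurent series); then $\Lambda_{\Sigma}(\mathsf{D}):=f_{\mathsf{D}}(-1)$ and $\widetilde{\Lambda}_{\Sigma}(\mathsf{D}):=\Lambda_{\Sigma}(\mathsf{D})-[G/G]$. For a finite category $\mathsf{C}$ and a functor $F:\mathsf{C}\to G\text{-sets}$ (finite), the Grothendieck construction $\int_{\mathsf{C}}F$ is the $G$-category with objects $(x,a)$, $x\in\mathrm{Obj}(\mathsf{C})$, $a\in F(x)$; morphisms $(x,a)\to(y,b)$ are the $\varphi:x\to y$ in $\mathsf{C}$ with $F(\varphi)(a)=b$; $g\cdot(x,a)=(x,ga)$, and $g$ sends $\varphi:(x,a)\to(y,b)$ to $\varphi:(x,ga)\to(y,gb)$. The orbit category $\mathcal{O}_{\mathscr{C}}$ has object set $\mathscr{C}$ and morphisms $H\to K$ the $G$-maps $G/H\to G/K$; $E\mathcal{O}_{\mathscr{C}}=\int_{\mathcal{O}_{\mathscr{C}}}\iota$ with $\iota(H)=G/H$, $\iota$ the identity on morphisms. The fusion category $\mathcal{F}_{\mathscr{C}}$ has object set $\mathscr{C}$ and morphisms $L\to K$ the group homomorphisms of the form $x\mapsto gxg^{-1}$ with $g\in G$, $gLg^{-1}\le K$; $E\mathcal{A}_{\mathscr{C}}=\int_{\mathcal{F}_{\mathscr{C}}^{\mathrm{op}}}v$, where $v(K)=G/C_G(K)$ and $v$ sends the morphism $L\to K$, $x\mapsto gxg^{-1}$, to the $G$-map $G/C_G(K)\to G/C_G(L)$ with $C_G(K)\mapsto gC_G(L)$. *)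

theory Defs
  imports
    "HOL-Algebra.Group_Action"
    "HOL-Algebra.Left_Coset"
    "HOL-Algebra.QuotRing"
    "HOL-Algebra.Module"
    "HOL-Library.Poly_Mapping"
    "HOL-Computational_Algebra.Formal_Laurent_Series"
    "HOL-Computational_Algebra.Polynomial_FPS"
begin

section \<open>Subgroups\<close>

definition conj_set :: "('g, 'b) monoid_scheme \<Rightarrow> 'g \<Rightarrow> 'g set \<Rightarrow> 'g set" where
  "conj_set G g H = g <#\<^bsub>G\<^esub> H #>\<^bsub>G\<^esub> inv\<^bsub>G\<^esub> g"

definition conj_closed :: "('g, 'b) monoid_scheme \<Rightarrow> 'g set set \<Rightarrow> bool" where
  "conj_closed G \<C> \<longleftrightarrow> (\<forall>H\<in>\<C>. \<forall>g\<in>carrier G. conj_set G g H \<in> \<C>)"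

definition conjugate_in :: "('g, 'b) monoid_scheme \<Rightarrow> 'g set \<Rightarrow> 'g set \<Rightarrow> bool" where
  "conjugate_in G H K \<longleftrightarrow> (\<exists>g\<in>carrier G. conj_set G g H = K)"

definition conj_class_reps :: "('g, 'b) monoid_scheme \<Rightarrow> 'g set set \<Rightarrow> bool" where
  "conj_class_reps G \<R> \<longleftrightarrow>
     (\<forall>K\<in>\<R>. subgroup K G) \<and> (\<forall>H. subgroup H G \<longrightarrow> (\<exists>!K. K \<in> \<R> \<and> conjugate_in G H K))"

definition centralizer :: "('g, 'b) monoid_scheme \<Rightarrow> 'g set \<Rightarrow> 'g set" where
  "centralizer G K = {g \<in> carrier G. \<forall>x\<in>K. g \<otimes>\<^bsub>G\<^esub> x = x \<otimes>\<^bsub>G\<^esub> g}"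

definition index :: "('g, 'b) monoid_scheme \<Rightarrow> 'g set \<Rightarrow> nat" where
  "index G H = card (lcosets\<^bsub>G\<^esub> H)"

definition strictly_above :: "'g set set \<Rightarrow> 'g set \<Rightarrow> 'g set set" where
  "strictly_above \<C> H = {K \<in> \<C>. H \<subset> K}"

definition strictly_below :: "'g set set \<Rightarrow> 'g set \<Rightarrow> 'g set set" where
  "strictly_below \<C> H = {K \<in> \<C>. K \<subset> H}"


section \<open>Euler characteristic of a finite poset of sets, ordered by inclusion\<close>

definition order_complex :: "'a set set \<Rightarrow> 'a set set set" where
  "order_complex P = {\<sigma> \<in> chains P. finite \<sigma> \<and> \<sigma> \<noteq> {}}"

text \<open>A simplex \<open>\<sigma>\<close> has dimension \<open>card \<sigma> - 1\<close>.\<close>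

definition euler_char :: "'a set set \<Rightarrow> int" where
  "euler_char P = (\<Sum>\<sigma>\<in>order_complex P. (- 1) ^ (card \<sigma> - 1))"

definition reduced_euler_char :: "'a set set \<Rightarrow> int" where
  "reduced_euler_char P = euler_char P - 1"


section \<open>Finite \<open>G\<close>-sets\<close>

type_synonym ('g, 'x) gset = "'x set \<times> ('g \<Rightarrow> 'x \<Rightarrow> 'x)"

definition finite_gset :: "('g, 'b) monoid_scheme \<Rightarrow> ('g, 'x) gset \<Rightarrow> bool" where
  "finite_gset G X \<longleftrightarrow> finite (fst X) \<and> group_action G (fst X) (snd X)"

definition gmaps ::
  "('g, 'b) monoid_scheme \<Rightarrow> ('g, 'x) gset \<Rightarrow> ('g, 'y) gset \<Rightarrow> ('x \<Rightarrow> 'y) set" where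
  "gmaps G X Y =
     {f \<in> fst X \<rightarrow>\<^sub>E fst Y. \<forall>g\<in>carrier G. \<forall>x\<in>fst X. f (snd X g x) = snd Y g (f x)}"

definition gset_iso ::
  "('g, 'b) monoid_scheme \<Rightarrow> ('g, 'x) gset \<Rightarrow> ('g, 'y) gset \<Rightarrow> bool" where
  "gset_iso G X Y \<longleftrightarrow> (\<exists>f\<in>gmaps G X Y. bij_betw f (fst X) (fst Y))"

definition fixed_points :: "('g, 'x) gset \<Rightarrow> 'g set \<Rightarrow> 'x set" where
  "fixed_points X H = {x \<in> fst X. \<forall>h\<in>H. snd X h x = x}"

definition coset_gset :: "('g, 'b) monoid_scheme \<Rightarrow> 'g set \<Rightarrow> ('g, 'g set) gset" where
  "coset_gset G H = (lcosets\<^bsub>G\<^esub> H, \<lambda>g. \<lambda>X\<in>lcosets\<^bsub>G\<^esub> H. g <#\<^bsub>G\<^esub> X)"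

definition gset_sum :: "('g, 'x) gset \<Rightarrow> ('g, 'y) gset \<Rightarrow> ('g, 'x + 'y) gset" where
  "gset_sum X Y = (fst X <+> fst Y, \<lambda>g. restrict (map_sum (snd X g) (snd Y g)) (fst X <+> fst Y))"

definition gset_prod :: "('g, 'x) gset \<Rightarrow> ('g, 'y) gset \<Rightarrow> ('g, 'x \<times> 'y) gset" where
  "gset_prod X Y = (fst X \<times> fst Y, \<lambda>g. restrict (map_prod (snd X g) (snd Y g)) (fst X \<times> fst Y))"

text \<open>Every finite \<open>G\<close>-set, over whatever type, is isomorphic to one whose underlying set
  consists of natural numbers, so isomorphism classes are taken among the latter.\<close>

type_synonym 'g iso_class = "('g, nat) gset set"

definition iso_class :: "('g, 'b) monoid_scheme \<Rightarrow> ('g, 'x) gset \<Rightarrow> 'g iso_class" where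
  "iso_class G X = {Y. finite_gset G Y \<and> gset_iso G X Y}"

text \<open>The semiring of isomorphism classes; the \<open>ring\<close> record serves as signature only.\<close>

definition gset_semiring :: "('g, 'b) monoid_scheme \<Rightarrow> 'g iso_class ring" where
  "gset_semiring G =
     \<lparr>carrier = {iso_class G X | X :: ('g, nat) gset. finite_gset G X},
      monoid.mult = (\<lambda>A B. \<Union>X\<in>A. \<Union>Y\<in>B. iso_class G (gset_prod X Y)),
      one = iso_class G ({0 :: nat}, \<lambda>g. \<lambda>x\<in>{0}. x),
      zero = iso_class G ({} :: nat set, \<lambda>g. \<lambda>x\<in>{}. x),
      add = (\<lambda>A B. \<Union>X\<in>A. \<Union>Y\<in>B. iso_class G (gset_sum X Y))\<rparr>"


section \<open>Extension of scalars and the Burnside ring\<close>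

text \<open>For a commutative (semi)ring \<open>R\<close> the algebra \<open>k \<otimes> R\<close> is constructed as the free \<open>k\<close>-module
  on the elements of \<open>R\<close>, multiplied as a monoid algebra, modulo \<open>[a + b] - [a] - [b]\<close>; the pure
  tensor \<open>c \<otimes> r\<close> is the class of \<open>c [r]\<close>.  For a semiring \<open>R\<close> and \<open>k = \<int>\<close> this is the Grothendieck
  ring of \<open>R\<close>; for a ring \<open>R\<close> and \<open>k = \<rat>\<close> it is the tensor product over \<open>\<int>\<close>.\<close>

definition formal_algebra :: "('r, 'm) ring_scheme \<Rightarrow> ('r \<Rightarrow>\<^sub>0 'k::comm_ring_1) ring" where
  "formal_algebra R =
     \<lparr>carrier = {f. Poly_Mapping.keys f \<subseteq> carrier R},
      monoid.mult = (\<lambda>f g. \<Sum>a\<in>Poly_Mapping.keys f. \<Sum>b\<in>Poly_Mapping.keys g.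
                Poly_Mapping.single (a \<otimes>\<^bsub>R\<^esub> b) (Poly_Mapping.lookup f a * Poly_Mapping.lookup g b)),
      one = Poly_Mapping.single \<one>\<^bsub>R\<^esub> 1,
      zero = 0,
      add = (+)\<rparr>"

definition additivity_ideal :: "('r, 'm) ring_scheme \<Rightarrow> ('r \<Rightarrow>\<^sub>0 'k::comm_ring_1) set" where
  "additivity_ideal R =
     Idl\<^bsub>formal_algebra R\<^esub>
       {Poly_Mapping.single (a \<oplus>\<^bsub>R\<^esub> b) 1 - Poly_Mapping.single a 1 - Poly_Mapping.single b 1
        | a b. a \<in> carrier R \<and> b \<in> carrier R}"

definition tensor :: "('r, 'm) ring_scheme \<Rightarrow> 'k \<Rightarrow> 'r \<Rightarrow> ('r \<Rightarrow>\<^sub>0 'k::comm_ring_1) set" where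
  "tensor R c r = additivity_ideal R +>\<^bsub>formal_algebra R\<^esub> Poly_Mapping.single r c"

definition extend_scalars ::
  "('r, 'm) ring_scheme \<Rightarrow> ('k::comm_ring_1, ('r \<Rightarrow>\<^sub>0 'k) set) module" where
  "extend_scalars R =
     (let Q = formal_algebra R Quot additivity_ideal R
      in \<lparr>carrier = carrier Q, monoid.mult = monoid.mult Q, one = one Q, zero = zero Q, add = add Q,
          module.smult = (\<lambda>c x. tensor R c \<one>\<^bsub>R\<^esub> \<otimes>\<^bsub>Q\<^esub> x)\<rparr>)"

type_synonym 'g int_burnside = "('g iso_class \<Rightarrow>\<^sub>0 int) set"
type_synonym 'g burnside = "('g int_burnside \<Rightarrow>\<^sub>0 rat) set"

definition Burnside_int :: "('g, 'b) monoid_scheme \<Rightarrow> (int, 'g int_burnside) module" where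
  "Burnside_int G = extend_scalars (gset_semiring G)"

definition Burnside :: "('g, 'b) monoid_scheme \<Rightarrow> (rat, 'g burnside) module" (\<open>\<Omega>\<close>) where
  "\<Omega> G = extend_scalars (Burnside_int G)"

definition gclass :: "('g, 'b) monoid_scheme \<Rightarrow> ('g, 'x) gset \<Rightarrow> 'g burnside" where
  "gclass G X = tensor (Burnside_int G) 1 (tensor (gset_semiring G) 1 (iso_class G X))"


section \<open>Marks and primitive idempotents\<close>

definition burnside_linear :: "('g, 'b) monoid_scheme \<Rightarrow> ('g burnside \<Rightarrow> rat) \<Rightarrow> bool" where
  "burnside_linear G m \<longleftrightarrow>
     (\<forall>x\<in>carrier (\<Omega> G). \<forall>y\<in>carrier (\<Omega> G). m (x \<oplus>\<^bsub>\<Omega> G\<^esub> y) = m x + m y) \<and>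
     (\<forall>c. \<forall>x\<in>carrier (\<Omega> G). m (c \<odot>\<^bsub>\<Omega> G\<^esub> x) = c * m x)"

definition mark :: "('g, 'b) monoid_scheme \<Rightarrow> 'g set \<Rightarrow> 'g burnside \<Rightarrow> rat" where
  "mark G H = (THE m. m \<in> extensional (carrier (\<Omega> G)) \<and> burnside_linear G m \<and>
     (\<forall>X :: ('g, nat) gset. finite_gset G X \<longrightarrow> m (gclass G X) = of_nat (card (fixed_points X H))))"

definition primitive_idempotent :: "('r, 'm) ring_scheme \<Rightarrow> 'r \<Rightarrow> bool" where
  "primitive_idempotent R e \<longleftrightarrow>
     e \<in> carrier R \<and> e \<otimes>\<^bsub>R\<^esub> e = e \<and> e \<noteq> \<zero>\<^bsub>R\<^esub> \<and>
     (\<forall>a\<in>carrier R. \<forall>b\<in>carrier R.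
        a \<otimes>\<^bsub>R\<^esub> a = a \<and> b \<otimes>\<^bsub>R\<^esub> b = b \<and> a \<otimes>\<^bsub>R\<^esub> b = \<zero>\<^bsub>R\<^esub> \<and> b \<otimes>\<^bsub>R\<^esub> a = \<zero>\<^bsub>R\<^esub> \<and> e = a \<oplus>\<^bsub>R\<^esub> b
        \<longrightarrow> a = \<zero>\<^bsub>R\<^esub> \<or> b = \<zero>\<^bsub>R\<^esub>)"

definition burnside_idem :: "('g, 'b) monoid_scheme \<Rightarrow> 'g set \<Rightarrow> 'g burnside" where
  "burnside_idem G K = (THE e. primitive_idempotent (\<Omega> G) e \<and>
     (\<forall>H. subgroup H G \<longrightarrow> mark G H e = (if conjugate_in G H K then 1 else 0)))"


section \<open>Finite categories with a group action\<close>

record ('o, 'm) cat =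
  Obj :: "'o set"
  Arr :: "'m set"
  Dom :: "'m \<Rightarrow> 'o"
  Cod :: "'m \<Rightarrow> 'o"
  Id :: "'o \<Rightarrow> 'm"
  Comp :: "'m \<Rightarrow> 'm \<Rightarrow> 'm"  \<comment> \<open>\<open>Comp C m n\<close> is \<open>m\<close> after \<open>n\<close>\<close>

record ('g, 'o, 'm) gcat = "('o, 'm) cat" +
  obj_act :: "'g \<Rightarrow> 'o \<Rightarrow> 'o"
  arr_act :: "'g \<Rightarrow> 'm \<Rightarrow> 'm"

definition finite_category :: "('o, 'm, 'z) cat_scheme \<Rightarrow> bool" where
  "finite_category C \<longleftrightarrow>
     finite (Obj C) \<and> finite (Arr C) \<and>
     (\<forall>m\<in>Arr C. Dom C m \<in> Obj C \<and> Cod C m \<in> Obj C) \<and>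
     (\<forall>x\<in>Obj C. Id C x \<in> Arr C \<and> Dom C (Id C x) = x \<and> Cod C (Id C x) = x) \<and>
     (\<forall>m\<in>Arr C. \<forall>n\<in>Arr C. Dom C m = Cod C n \<longrightarrow>
        Comp C m n \<in> Arr C \<and> Dom C (Comp C m n) = Dom C n \<and> Cod C (Comp C m n) = Cod C m) \<and>
     (\<forall>m\<in>Arr C. Comp C m (Id C (Dom C m)) = m \<and> Comp C (Id C (Cod C m)) m = m) \<and>
     (\<forall>k\<in>Arr C. \<forall>m\<in>Arr C. \<forall>n\<in>Arr C. Dom C k = Cod C m \<and> Dom C m = Cod C n \<longrightarrow>
        Comp C (Comp C k m) n = Comp C k (Comp C m n))"

definition finite_gcategory :: "('g, 'b) monoid_scheme \<Rightarrow> ('g, 'o, 'm, 'z) gcat_scheme \<Rightarrow> bool" where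
  "finite_gcategory G D \<longleftrightarrow>
     finite_category D \<and>
     group_action G (Obj D) (obj_act D) \<and> group_action G (Arr D) (arr_act D) \<and>
     (\<forall>g\<in>carrier G. \<forall>m\<in>Arr D. Dom D (arr_act D g m) = obj_act D g (Dom D m) \<and>
        Cod D (arr_act D g m) = obj_act D g (Cod D m)) \<and>
     (\<forall>g\<in>carrier G. \<forall>x\<in>Obj D. arr_act D g (Id D x) = Id D (obj_act D g x)) \<and>
     (\<forall>g\<in>carrier G. \<forall>m\<in>Arr D. \<forall>n\<in>Arr D. Dom D m = Cod D n \<longrightarrow>
        arr_act D g (Comp D m n) = Comp D (arr_act D g m) (arr_act D g n))"

definition opposite :: "('o, 'm) cat \<Rightarrow> ('o, 'm) cat" where
  "opposite C = \<lparr>Obj = Obj C, Arr = Arr C, Dom = Cod C, Cod = Dom C, Id = Id C,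
     Comp = (\<lambda>m n. Comp C n m)\<rparr>"

definition gset_functor :: "('g, 'b) monoid_scheme \<Rightarrow> ('o, 'm) cat \<Rightarrow>
    ('o \<Rightarrow> ('g, 'x) gset) \<Rightarrow> ('m \<Rightarrow> 'x \<Rightarrow> 'x) \<Rightarrow> bool" where
  "gset_functor G C F Fm \<longleftrightarrow>
     (\<forall>x\<in>Obj C. finite_gset G (F x)) \<and>
     (\<forall>m\<in>Arr C. Fm m \<in> gmaps G (F (Dom C m)) (F (Cod C m))) \<and>
     (\<forall>x\<in>Obj C. Fm (Id C x) = (\<lambda>a\<in>fst (F x). a)) \<and>
     (\<forall>m\<in>Arr C. \<forall>n\<in>Arr C. Dom C m = Cod C n \<longrightarrow>
        Fm (Comp C m n) = compose (fst (F (Dom C n))) (Fm m) (Fm n))"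

text \<open>A morphism \<open>\<phi> : (x, a) \<rightarrow> (y, b)\<close> is recorded together with its source and target.\<close>

definition grothendieck :: "('o, 'm) cat \<Rightarrow> ('o \<Rightarrow> ('g, 'x) gset) \<Rightarrow> ('m \<Rightarrow> 'x \<Rightarrow> 'x) \<Rightarrow>
    ('g, 'o \<times> 'x, ('o \<times> 'x) \<times> 'm \<times> ('o \<times> 'x)) gcat" where
  "grothendieck C F Fm =
     (let Ob = Sigma (Obj C) (\<lambda>x. fst (F x));
          Ar = {((x, a), \<phi>, (y, b)) | x a \<phi> y b.
                  (x, a) \<in> Ob \<and> (y, b) \<in> Ob \<and> \<phi> \<in> Arr C \<and> Dom C \<phi> = x \<and> Cod C \<phi> = y \<and> Fm \<phi> a = b}
      in \<lparr>Obj = Ob,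
          Arr = Ar,
          Dom = (\<lambda>(s, \<phi>, t). s),
          Cod = (\<lambda>(s, \<phi>, t). t),
          Id = (\<lambda>(x, a). ((x, a), Id C x, (x, a))),
          Comp = (\<lambda>(s', \<psi>, t') (s, \<phi>, t). (s, Comp C \<psi> \<phi>, t')),
          obj_act = (\<lambda>g. \<lambda>(x, a)\<in>Ob. (x, snd (F x) g a)),
          arr_act = (\<lambda>g. \<lambda>((x, a), \<phi>, (y, b))\<in>Ar.
                       ((x, snd (F x) g a), \<phi>, (y, snd (F y) g b)))\<rparr>)"


section \<open>The series Lefschetz invariant\<close>

fun nonid_path :: "('o, 'm, 'z) cat_scheme \<Rightarrow> 'o \<Rightarrow> 'm list \<Rightarrow> bool" where
  "nonid_path D x [] \<longleftrightarrow> x \<in> Obj D"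
| "nonid_path D x (m # ms) \<longleftrightarrow>
     m \<in> Arr D \<and> Dom D m = x \<and> m \<noteq> Id D x \<and> nonid_path D (Cod D m) ms"

text \<open>A chain is recorded with its initial object, so that chains of length \<open>0\<close> are objects.\<close>

definition chain_gset :: "('g, 'o, 'm, 'z) gcat_scheme \<Rightarrow> nat \<Rightarrow> ('g, 'o \<times> 'm list) gset" where
  "chain_gset D n =
     (let Ch = {(x, ms). nonid_path D x ms \<and> length ms = n}
      in (Ch, \<lambda>g. \<lambda>(x, ms)\<in>Ch. (obj_act D g x, map (arr_act D g) ms)))"

text \<open>The coefficients of \<open>f\<^sub>D(t)\<close>, viewed as a Laurent series over \<open>\<Omega> G\<close>.\<close>

definition chain_series ::
  "('g, 'b) monoid_scheme \<Rightarrow> ('g, 'o, 'm, 'z) gcat_scheme \<Rightarrow> int \<Rightarrow> 'g burnside" where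
  "chain_series G D n = (if n < 0 then \<zero>\<^bsub>\<Omega> G\<^esub> else gclass G (chain_gset D (nat n)))"

definition laurent_of_ratfun :: "rat poly \<Rightarrow> rat poly \<Rightarrow> rat fls" where
  "laurent_of_ratfun p q = fps_to_fls (fps_of_poly p) / fps_to_fls (fps_of_poly q)"

text \<open>\<open>f\<^sub>D = (\<Sum>i<k. w i \<otimes> (p i / q i))\<close> is an element of \<open>\<Omega>(G) \<otimes> \<rat>[t]\<^bsub>(t + 1)\<^esub>\<close> and \<open>y\<close> is its value at \<open>- 1\<close>.\<close>

definition series_Lefschetz_value ::
  "('g, 'b) monoid_scheme \<Rightarrow> ('g, 'o, 'm, 'z) gcat_scheme \<Rightarrow> 'g burnside \<Rightarrow> bool" where
  "series_Lefschetz_value G D y \<longleftrightarrow>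
     (\<exists>(k :: nat) w p q.
        (\<forall>i<k. w i \<in> carrier (\<Omega> G) \<and> \<not> [:1, 1:] dvd q i) \<and>
        (\<forall>n. chain_series G D n =
           (\<Oplus>\<^bsub>\<Omega> G\<^esub>i\<in>{..<k}. fls_nth (laurent_of_ratfun (p i) (q i)) n \<odot>\<^bsub>\<Omega> G\<^esub> w i)) \<and>
        y = (\<Oplus>\<^bsub>\<Omega> G\<^esub>i\<in>{..<k}. (poly (p i) (- 1) / poly (q i) (- 1)) \<odot>\<^bsub>\<Omega> G\<^esub> w i))"

definition has_series_Lefschetz ::
  "('g, 'b) monoid_scheme \<Rightarrow> ('g, 'o, 'm, 'z) gcat_scheme \<Rightarrow> bool" where
  "has_series_Lefschetz G D \<longleftrightarrow> (\<exists>y. series_Lefschetz_value G D y)"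

definition series_Lefschetz ::
  "('g, 'b) monoid_scheme \<Rightarrow> ('g, 'o, 'm, 'z) gcat_scheme \<Rightarrow> 'g burnside" where
  "series_Lefschetz G D = (THE y. series_Lefschetz_value G D y)"

definition reduced_series_Lefschetz ::
  "('g, 'b) monoid_scheme \<Rightarrow> ('g, 'o, 'm, 'z) gcat_scheme \<Rightarrow> 'g burnside" where
  "reduced_series_Lefschetz G D =
     series_Lefschetz G D \<ominus>\<^bsub>\<Omega> G\<^esub> gclass G (coset_gset G (carrier G))"


section \<open>Orbit and fusion categories\<close>

text \<open>In both categories a morphism is recorded as (source, underlying map, target).\<close>

definition orbit_category :: "('g, 'b) monoid_scheme \<Rightarrow> 'g set set \<Rightarrow>
    ('g set, 'g set \<times> ('g set \<Rightarrow> 'g set) \<times> 'g set) cat" where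
  "orbit_category G \<C> =
     \<lparr>Obj = \<C>,
      Arr = {(H, f, K). H \<in> \<C> \<and> K \<in> \<C> \<and> f \<in> gmaps G (coset_gset G H) (coset_gset G K)},
      Dom = (\<lambda>(H, f, K). H),
      Cod = (\<lambda>(H, f, K). K),
      Id = (\<lambda>H. (H, \<lambda>X\<in>lcosets\<^bsub>G\<^esub> H. X, H)),
      Comp = (\<lambda>(H', f', K') (H, f, K). (H, compose (lcosets\<^bsub>G\<^esub> H) f' f, K'))\<rparr>"

definition EO :: "('g, 'b) monoid_scheme \<Rightarrow> 'g set set \<Rightarrow>
    ('g, 'g set \<times> 'g set,
     ('g set \<times> 'g set) \<times> ('g set \<times> ('g set \<Rightarrow> 'g set) \<times> 'g set) \<times> ('g set \<times> 'g set)) gcat" where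
  "EO G \<C> = grothendieck (orbit_category G \<C>) (coset_gset G) (\<lambda>(H, f, K). f)"

definition conj_map :: "('g, 'b) monoid_scheme \<Rightarrow> 'g \<Rightarrow> 'g set \<Rightarrow> 'g \<Rightarrow> 'g" where
  "conj_map G g L = (\<lambda>x\<in>L. g \<otimes>\<^bsub>G\<^esub> x \<otimes>\<^bsub>G\<^esub> inv\<^bsub>G\<^esub> g)"

definition fusion_category :: "('g, 'b) monoid_scheme \<Rightarrow> 'g set set \<Rightarrow>
    ('g set, 'g set \<times> ('g \<Rightarrow> 'g) \<times> 'g set) cat" where
  "fusion_category G \<C> =
     \<lparr>Obj = \<C>,
      Arr = {(L, f, K). L \<in> \<C> \<and> K \<in> \<C> \<and>
               (\<exists>g\<in>carrier G. conj_set G g L \<subseteq> K \<and> f = conj_map G g L)},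
      Dom = (\<lambda>(L, f, K). L),
      Cod = (\<lambda>(L, f, K). K),
      Id = (\<lambda>L. (L, \<lambda>x\<in>L. x, L)),
      Comp = (\<lambda>(L', f', K') (L, f, K). (L, compose L f' f, K'))\<rparr>"

text \<open>The image under \<open>v\<close> of the morphism \<open>f : L \<rightarrow> K\<close>; it does not depend on the choice of the
  element \<open>g\<close> inducing \<open>f\<close>.\<close>

definition centralizer_coset_map :: "('g, 'b) monoid_scheme \<Rightarrow>
    'g set \<times> ('g \<Rightarrow> 'g) \<times> 'g set \<Rightarrow> 'g set \<Rightarrow> 'g set" where
  "centralizer_coset_map G = (\<lambda>(L, f, K).
     THE h. h \<in> gmaps G (coset_gset G (centralizer G K)) (coset_gset G (centralizer G L)) \<and>
       (\<forall>g\<in>carrier G. conj_set G g L \<subseteq> K \<and> f = conj_map G g L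
          \<longrightarrow> h (centralizer G K) = g <#\<^bsub>G\<^esub> centralizer G L))"

definition EA :: "('g, 'b) monoid_scheme \<Rightarrow> 'g set set \<Rightarrow>
    ('g, 'g set \<times> 'g set,
     ('g set \<times> 'g set) \<times> ('g set \<times> ('g \<Rightarrow> 'g) \<times> 'g set) \<times> ('g set \<times> 'g set)) gcat" where
  "EA G \<C> = grothendieck (opposite (fusion_category G \<C>))
     (\<lambda>K. coset_gset G (centralizer G K)) (centralizer_coset_map G)"


section \<open>\<open>EO\<close> and \<open>EA\<close> are finite \<open>G\<close>-categories\<close>

lemma group_actionI:
  fixes G (structure)
  assumes "group G"
    and cl: "\<And>g x. g \<in> carrier G \<Longrightarrow> x \<in> E \<Longrightarrow> \<phi> g x \<in> E"
    and ext: "\<And>g. g \<in> carrier G \<Longrightarrow> \<phi> g \<in> extensional E"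
    and one: "\<And>x. x \<in> E \<Longrightarrow> \<phi> \<one>\<^bsub>G\<^esub> x = x"
    and mul: "\<And>g h x. g \<in> carrier G \<Longrightarrow> h \<in> carrier G \<Longrightarrow> x \<in> E \<Longrightarrow> \<phi> (g \<otimes>\<^bsub>G\<^esub> h) x = \<phi> g (\<phi> h x)"
  shows "group_action G E \<phi>"
proof -
  interpret group G by fact
  have bij: "\<phi> g \<in> Bij E" if g: "g \<in> carrier G" for g
  proof -
    have "bij_betw (\<phi> g) E E"
      by (rule bij_betwI[where g = "\<phi> (inv g)"]) (use g in \<open>auto simp: cl one mul[symmetric]\<close>)
    thus ?thesis by (simp add: Bij_def ext g)
  qed
  have "\<phi> \<in> hom G (BijGroup E)"
  proof (rule homI)
    fix g h assume gh: "g \<in> carrier G" "h \<in> carrier G"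
    have "\<phi> (g \<otimes> h) = compose E (\<phi> g) (\<phi> h)"
      by (rule extensionalityI[where A = E]) (use gh in \<open>auto simp: ext mul compose_eq\<close>)
    thus "\<phi> (g \<otimes> h) = \<phi> g \<otimes>\<^bsub>BijGroup E\<^esub> \<phi> h" by (simp add: BijGroup_def bij gh)
  qed (simp add: BijGroup_def bij)
  thus ?thesis
    unfolding group_action_def group_hom_def group_hom_axioms_def
    by (simp add: group_BijGroup is_group)
qed

lemma grothendieck_finite_gcategory:
  assumes G: "group G" and C: "finite_category C" and F: "gset_functor G C F Fm"
  shows "finite_gcategory G (grothendieck C F Fm)"
proof -
  define Ob where "Ob = Sigma (Obj C) (\<lambda>x. fst (F x))"
  define Ar where "Ar = {((x, a), \<phi>, (y, b)) | x a \<phi> y b.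
     (x, a) \<in> Ob \<and> (y, b) \<in> Ob \<and> \<phi> \<in> Arr C \<and> Dom C \<phi> = x \<and> Cod C \<phi> = y \<and> Fm \<phi> a = b}"
  have D: "Obj (grothendieck C F Fm) = Ob" "Arr (grothendieck C F Fm) = Ar"
    "Dom (grothendieck C F Fm) = (\<lambda>(s, \<phi>, t). s)" "Cod (grothendieck C F Fm) = (\<lambda>(s, \<phi>, t). t)"
    "Id (grothendieck C F Fm) = (\<lambda>(x, a). ((x, a), Id C x, (x, a)))"
    "Comp (grothendieck C F Fm) = (\<lambda>(s', \<psi>, t') (s, \<phi>, t). (s, Comp C \<psi> \<phi>, t'))"
    "obj_act (grothendieck C F Fm) = (\<lambda>g. \<lambda>(x, a)\<in>Ob. (x, snd (F x) g a))"
    "arr_act (grothendieck C F Fm) = (\<lambda>g. \<lambda>((x, a), \<phi>, (y, b))\<in>Ar.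
                       ((x, snd (F x) g a), \<phi>, (y, snd (F y) g b)))"
    by (auto simp: grothendieck_def Let_def Ob_def Ar_def)
  have act: "group_action G (fst (F x)) (snd (F x))" "finite (fst (F x))" if "x \<in> Obj C" for x
    using F that by (auto simp: gset_functor_def finite_gset_def)
  have acl: "snd (F x) g a \<in> fst (F x)" if "x \<in> Obj C" "g \<in> carrier G" "a \<in> fst (F x)" for x g a
    using group_action.element_image[OF act(1)] that by blast
  have aone: "snd (F x) \<one>\<^bsub>G\<^esub> a = a" if "x \<in> Obj C" "a \<in> fst (F x)" for x a
    using group_action.id_eq_one[OF act(1)] that by (metis restrict_apply')
  have amul: "snd (F x) (g \<otimes>\<^bsub>G\<^esub> h) a = snd (F x) g (snd (F x) h a)"
    if "x \<in> Obj C" "g \<in> carrier G" "h \<in> carrier G" "a \<in> fst (F x)" for x g h a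
    using group_action.composition_rule[OF act(1)] that by blast
  have Fm: "Fm m (snd (F (Dom C m)) g a) = snd (F (Cod C m)) g (Fm m a)"
      "Fm m a \<in> fst (F (Cod C m))"
    if "m \<in> Arr C" "a \<in> fst (F (Dom C m))" "g \<in> carrier G" for m a g
    using F that by (auto simp: gset_functor_def gmaps_def)
  have Fid: "Fm (Id C x) a = a" if "x \<in> Obj C" "a \<in> fst (F x)" for x a
    using F that by (auto simp: gset_functor_def)
  have Fcomp: "Fm (Comp C m n) a = Fm m (Fm n a)"
    if "m \<in> Arr C" "n \<in> Arr C" "Dom C m = Cod C n" "a \<in> fst (F (Dom C n))" for m n a
    using F that by (auto simp: gset_functor_def compose_eq)
  have finO: "finite Ob" unfolding Ob_def using C act by (auto simp: finite_category_def)
  have "Ar \<subseteq> Ob \<times> Arr C \<times> Ob" by (auto simp: Ar_def)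
  hence finA: "finite Ar" using finO C by (auto simp: finite_category_def intro: finite_subset)
  have Cat: "finite_category (grothendieck C F Fm)"
    unfolding finite_category_def D
    using finO finA C by (auto simp: Ar_def Ob_def finite_category_def Fid Fcomp)
  have gO: "group_action G Ob (\<lambda>g. \<lambda>(x, a)\<in>Ob. (x, snd (F x) g a))"
  proof (rule group_actionI[OF G])
  qed (auto simp: Ob_def acl aone amul)
  have Arcl: "((x, snd (F x) g a), \<phi>, (y, snd (F y) g b)) \<in> Ar"
    if "((x, a), \<phi>, (y, b)) \<in> Ar" "g \<in> carrier G" for x a \<phi> y b g
    using that Fm acl by (auto simp: Ar_def Ob_def)
  have ArO: "x \<in> Obj C" "y \<in> Obj C" "a \<in> fst (F x)" "b \<in> fst (F y)"
    if "((x, a), \<phi>, (y, b)) \<in> Ar" for x a \<phi> y b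
    using that by (auto simp: Ar_def Ob_def)
  have gA: "group_action G Ar (\<lambda>g. \<lambda>((x, a), \<phi>, (y, b))\<in>Ar.
                       ((x, snd (F x) g a), \<phi>, (y, snd (F y) g b)))"
    by (rule group_actionI[OF G]) (use Arcl in \<open>auto simp: aone ArO amul group.is_monoid[OF G] monoid.m_closed\<close>)
  have ArOb: "fst m \<in> Ob \<and> snd (snd m) \<in> Ob" if "m \<in> Ar" for m using that by (auto simp: Ar_def)
  have IdAr: "((x, a), Id C x, (x, a)) \<in> Ar" if "(x, a) \<in> Ob" for x a
    using that C by (auto simp: Ar_def Ob_def finite_category_def Fid)
  have CompAr: "((x, a), Comp C \<psi> \<phi>, (z, c)) \<in> Ar"
    if "((x, a), \<phi>, (y, b)) \<in> Ar" "((y, b), \<psi>, (z, c)) \<in> Ar" for x a \<psi> \<phi> z c y b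
    using that C by (auto simp: Ar_def Ob_def finite_category_def Fcomp)
  show ?thesis
    unfolding finite_gcategory_def D
  proof (intro conjI gO gA Cat ballI impI)
    fix g x assume "g \<in> carrier G" "x \<in> Ob"
    thus "(\<lambda>((x, a), \<phi>, y, b)\<in>Ar. ((x, snd (F x) g a), \<phi>, y, snd (F y) g b))
            (case x of (x, a) \<Rightarrow> ((x, a), Id C x, x, a)) =
           (case (\<lambda>(x, a)\<in>Ob. (x, snd (F x) g a)) x of (x, a) \<Rightarrow> ((x, a), Id C x, x, a))"
      by (auto simp: IdAr split: prod.splits)
  next
    fix g m n assume "g \<in> carrier G" "m \<in> Ar" "n \<in> Ar" "(case m of (s, \<phi>, t) \<Rightarrow> s) = (case n of (s, \<phi>, t) \<Rightarrow> t)"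
    thus "(\<lambda>((x, a), \<phi>, y, b)\<in>Ar. ((x, snd (F x) g a), \<phi>, y, snd (F y) g b))
            ((case m of (s', \<psi>, t') \<Rightarrow> \<lambda>(s, \<phi>, t). (s, Comp C \<psi> \<phi>, t')) n) =
           (case (\<lambda>((x, a), \<phi>, y, b)\<in>Ar. ((x, snd (F x) g a), \<phi>, y, snd (F y) g b)) m of
             (s', \<psi>, t') \<Rightarrow> \<lambda>(s, \<phi>, t). (s, Comp C \<psi> \<phi>, t'))
            ((\<lambda>((x, a), \<phi>, y, b)\<in>Ar. ((x, snd (F x) g a), \<phi>, y, snd (F y) g b)) n)"
      using CompAr by (cases m; cases n) (auto split: prod.splits)
  qed (auto dest: ArOb)
qed


lemma gmaps_compose:
  assumes "group G" "f \<in> gmaps G X Y" "f' \<in> gmaps G Y Z" "group_action G (fst X) (snd X)"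
  shows "compose (fst X) f' f \<in> gmaps G X Z"
  using assms group_action.element_image[OF assms(4)]
  by (fastforce simp: gmaps_def compose_def PiE_iff)

lemma gmaps_id:
  assumes "group_action G (fst X) (snd X)"
  shows "(\<lambda>x\<in>fst X. x) \<in> gmaps G X X"
  using group_action.element_image[OF assms] by (fastforce simp: gmaps_def)

lemma gmaps_app:
  assumes "f \<in> gmaps G X Y"
  shows "x \<in> fst X \<Longrightarrow> f x \<in> fst Y" "g \<in> carrier G \<Longrightarrow> x \<in> fst X \<Longrightarrow> f (snd X g x) = snd Y g (f x)"
  using assms by (auto simp: gmaps_def)

lemma finite_gmaps:
  assumes "finite (fst X)" "finite (fst Y)"
  shows "finite (gmaps G X Y)"
  unfolding gmaps_def by (rule finite_subset[OF _ finite_PiE[of "fst X" "\<lambda>_. fst Y"]]) (use assms in auto)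

lemma (in group) coset_gset_finite_gset:
  assumes "finite (carrier G)" "subgroup H G"
  shows "finite_gset G (coset_gset G H)"
proof -
  have "H \<subseteq> carrier G" using assms(2) by (rule subgroup.subset)
  have X: "X \<subseteq> carrier G" if "X \<in> lcosets H" for X
    using subgroup.lcosets_carrier[OF assms(2) is_group that] .
  have "finite (lcosets H)"
    using assms(1) by (auto simp: LCOSETS_def)
  moreover have "group_action G (lcosets H) (\<lambda>g. \<lambda>X\<in>lcosets H. g <# X)"
  proof (rule group_actionI[OF is_group])
    show cl: "(\<lambda>X\<in>lcosets H. g <# X) X \<in> lcosets H" if "g \<in> carrier G" "X \<in> lcosets H" for g X
      using that \<open>H \<subseteq> carrier G\<close> by (auto simp: LCOSETS_def lcos_m_assoc)
    show "(\<lambda>X\<in>lcosets H. (g \<otimes> h) <# X) X = (\<lambda>X\<in>lcosets H. g <# X) ((\<lambda>X\<in>lcosets H. h <# X) X)"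
      if "g \<in> carrier G" "h \<in> carrier G" "X \<in> lcosets H" for g h X
      using cl[OF that(2,3)] that X by (auto simp: lcos_m_assoc)
  qed (use X in \<open>auto simp: lcos_mult_one\<close>)
  ultimately show ?thesis by (simp add: finite_gset_def coset_gset_def)
qed

lemma fst_coset_gset [simp]: "fst (coset_gset G H) = lcosets\<^bsub>G\<^esub> H"
  by (simp add: coset_gset_def)

lemma (in group) orbit_category_finite:
  assumes "finite (carrier G)" "\<forall>H\<in>\<C>. subgroup H G"
  shows "finite_category (orbit_category G \<C>)"
proof -
  note a = coset_gset_finite_gset[OF assms(1), unfolded finite_gset_def]
  have "\<C> \<subseteq> Pow (carrier G)" using assms(2) subgroup.subset by blast
  hence fC: "finite \<C>" using assms(1) by (simp add: finite_subset)
  have "{(H, f, K). H \<in> \<C> \<and> K \<in> \<C> \<and> f \<in> gmaps G (coset_gset G H) (coset_gset G K)} \<subseteq>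
     \<C> \<times> (\<Union>H\<in>\<C>. \<Union>K\<in>\<C>. gmaps G (coset_gset G H) (coset_gset G K)) \<times> \<C>" by auto
  hence fA: "finite {(H, f, K). H \<in> \<C> \<and> K \<in> \<C> \<and> f \<in> gmaps G (coset_gset G H) (coset_gset G K)}"
    by (rule finite_subset) (intro finite_cartesian_product finite_UN_I fC finite_gmaps,
      use a assms(2) in auto)
  have c: "compose (lcosets H) f' f \<in> gmaps G (coset_gset G H) (coset_gset G K)"
    if "f \<in> gmaps G (coset_gset G H) (coset_gset G L)" "f' \<in> gmaps G (coset_gset G L) (coset_gset G K)"
      "H \<in> \<C>" for f f' H K L
    using gmaps_compose[OF is_group that(1,2)] a that(3) assms(2) by auto
  have i: "(\<lambda>X\<in>lcosets H. X) \<in> gmaps G (coset_gset G H) (coset_gset G H)" if "H \<in> \<C>" for H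
    using gmaps_id[of G "coset_gset G H"] a that assms(2) by auto
  have P: "f \<in> lcosets H \<rightarrow>\<^sub>E lcosets K" if "f \<in> gmaps G (coset_gset G H) (coset_gset G K)" for f H K
    using that by (auto simp: gmaps_def)
  have u: "compose (lcosets H) f (\<lambda>X\<in>lcosets H. X) = f" "compose (lcosets H) (\<lambda>X\<in>lcosets K. X) f = f"
    if "f \<in> gmaps G (coset_gset G H) (coset_gset G K)" for f H K
    using P[OF that] compose_Id[of f "lcosets H" "lcosets K"] Id_compose[of f "lcosets H" "lcosets K"]
    by (auto simp: PiE_iff)
  have as: "compose (lcosets H) (compose (lcosets K) h f) e = compose (lcosets H) h (compose (lcosets H) f e)"
    if "e \<in> gmaps G (coset_gset G H) (coset_gset G K)" for e f h H K
    using P[OF that] by (intro compose_assoc[symmetric]) auto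
  have "finite (Arr (orbit_category G \<C>))" "finite (Obj (orbit_category G \<C>))"
    using fA fC by (simp_all add: orbit_category_def)
  then show ?thesis unfolding finite_category_def
    by (intro conjI; (assumption)?) (auto simp: orbit_category_def i c u intro: as)
qed

lemma (in group) orbit_functor:
  assumes "finite (carrier G)" "\<forall>H\<in>\<C>. subgroup H G"
  shows "gset_functor G (orbit_category G \<C>) (coset_gset G) (\<lambda>(H, f, K). f)"
  unfolding gset_functor_def orbit_category_def
  using coset_gset_finite_gset[OF assms(1)] assms(2) by auto

lemma (in group) EO_finite_gcategory:
  assumes "finite (carrier G)" "\<forall>H\<in>\<C>. subgroup H G"
  shows "finite_gcategory G (EO G \<C>)"
  unfolding EO_def
  by (intro grothendieck_finite_gcategory is_group orbit_category_finite orbit_functor assms)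

lemma conj_set_eq: "conj_set G g L = (\<lambda>x. g \<otimes>\<^bsub>G\<^esub> x \<otimes>\<^bsub>G\<^esub> inv\<^bsub>G\<^esub> g) ` L"
  by (auto simp: conj_set_def l_coset_def r_coset_def)

lemma (in group) conj_map_one:
  assumes "L \<subseteq> carrier G" shows "conj_map G \<one> L = (\<lambda>x\<in>L. x)" "conj_set G \<one> L = L"
  using assms by (force simp: conj_map_def conj_set_eq fun_eq_iff subset_iff)+

lemma (in group) conj_map_mult:
  assumes "L \<subseteq> carrier G" "g \<in> carrier G" "h \<in> carrier G" "conj_set G g L \<subseteq> K"
  shows "compose L (conj_map G h K) (conj_map G g L) = conj_map G (h \<otimes> g) L"
  using assms by (force simp: conj_map_def conj_set_eq compose_def fun_eq_iff m_assoc inv_mult_group)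

lemma (in group) conj_set_mult:
  assumes "L \<subseteq> carrier G" "g \<in> carrier G" "h \<in> carrier G"
  shows "conj_set G (h \<otimes> g) L = conj_set G h (conj_set G g L)"
  using assms by (force simp: conj_set_eq image_image m_assoc inv_mult_group subset_iff intro!: image_cong)

lemma (in group) fusion_category_finite:
  assumes "finite (carrier G)" "\<forall>H\<in>\<C>. subgroup H G"
  shows "finite_category (fusion_category G \<C>)"
proof -
  let ?A = "{(L, f, K). L \<in> \<C> \<and> K \<in> \<C> \<and>
               (\<exists>g\<in>carrier G. conj_set G g L \<subseteq> K \<and> f = conj_map G g L)}"
  have sub: "L \<subseteq> carrier G" if "L \<in> \<C>" for L using assms(2) subgroup.subset that by blast
  hence "\<C> \<subseteq> Pow (carrier G)" by blast
  hence fC: "finite \<C>" using assms(1) by (simp add: finite_subset)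
  have "?A \<subseteq> \<C> \<times> (\<Union>L\<in>\<C>. (\<lambda>g. conj_map G g L) ` carrier G) \<times> \<C>" by auto
  hence fA: "finite ?A" by (rule finite_subset) (use fC assms(1) in auto)
  have i: "\<exists>g\<in>carrier G. conj_set G g L \<subseteq> L \<and> (\<lambda>x\<in>L. x) = conj_map G g L" if "L \<in> \<C>" for L
    using conj_map_one[OF sub[OF that]] by (intro bexI[of _ \<one>]) auto
  have c: "\<exists>k\<in>carrier G. conj_set G k L \<subseteq> M \<and>
      compose L (conj_map G h K) (conj_map G g L) = conj_map G k L"
    if "L \<in> \<C>" "g \<in> carrier G" "h \<in> carrier G" "conj_set G g L \<subseteq> K" "conj_set G h K \<subseteq> M" for L K M g h
    using that conj_map_mult[OF sub[OF that(1)] that(2,3,4)] conj_set_mult[OF sub[OF that(1)] that(2,3)]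
    by (intro bexI[of _ "h \<otimes> g"]) (auto simp: conj_set_eq)
  have P: "conj_map G g L \<in> L \<rightarrow>\<^sub>E K" if "conj_set G g L \<subseteq> K" for g L K
    using that by (auto simp: conj_map_def conj_set_eq)
  have u: "compose L (conj_map G g L) (\<lambda>X\<in>L. X) = conj_map G g L"
    "compose L (\<lambda>X\<in>K. X) (conj_map G g L) = conj_map G g L"
    if "conj_set G g L \<subseteq> K" for g L K
    using P[OF that] compose_Id[of "conj_map G g L" L K] Id_compose[of "conj_map G g L" L K]
    by (auto simp: PiE_iff)
  have as: "compose H (compose K h f) (conj_map G g H) = compose H h (compose H f (conj_map G g H))"
    if "conj_set G g H \<subseteq> K" for f h g H K
    using P[OF that] by (intro compose_assoc[symmetric]) auto
  have "Arr (fusion_category G \<C>) = ?A" "Obj (fusion_category G \<C>) = \<C>"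
    by (simp_all add: fusion_category_def)
  with fA fC have "finite (Arr (fusion_category G \<C>))" "finite (Obj (fusion_category G \<C>))"
    by simp_all
  then show ?thesis unfolding finite_category_def
    by (intro conjI; (assumption)?) (auto simp: fusion_category_def i u intro: as c)
qed

lemma opposite_finite: "finite_category C \<Longrightarrow> finite_category (opposite C)"
  by (auto simp: finite_category_def opposite_def)

lemma (in group) subgroup_centralizer:
  assumes "K \<subseteq> carrier G" shows "subgroup (centralizer G K) G"
proof (rule subgroupI)
  fix a assume a: "a \<in> centralizer G K"
  have "inv a \<otimes> x = x \<otimes> inv a" if x: "x \<in> K" for x
  proof -
    have [simp]: "a \<in> carrier G" "x \<in> carrier G" "a \<otimes> x = x \<otimes> a"
      using a x assms by (auto simp: centralizer_def)
    have "inv a \<otimes> x = inv a \<otimes> (x \<otimes> a) \<otimes> inv a" by (simp add: m_assoc)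
    also have "\<dots> = inv a \<otimes> (a \<otimes> x) \<otimes> inv a" by simp
    also have "\<dots> = x \<otimes> inv a" by (simp add: m_assoc[symmetric] del: \<open>a \<otimes> x = x \<otimes> a\<close>)
    finally show ?thesis .
  qed
  thus "inv a \<in> centralizer G K" using a by (auto simp: centralizer_def)
next
  fix a b assume "a \<in> centralizer G K" "b \<in> centralizer G K"
  thus "a \<otimes> b \<in> centralizer G K" using assms by (auto simp: centralizer_def) (metis m_assoc subsetD)
qed (use assms in \<open>auto simp: centralizer_def intro!: exI[of _ \<one>]\<close>)

lemma (in group) conj_map_cong_centralizer:
  assumes "L \<subseteq> carrier G" "g \<in> carrier G" "g' \<in> carrier G" "conj_map G g L = conj_map G g' L"
  shows "inv g \<otimes> g' \<in> centralizer G L"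
proof -
  have "inv g \<otimes> g' \<otimes> x = x \<otimes> (inv g \<otimes> g')" if x: "x \<in> L" for x
  proof -
    have [simp]: "x \<in> carrier G" using x assms by auto
    have e: "g \<otimes> x \<otimes> inv g = g' \<otimes> x \<otimes> inv g'"
      using fun_cong[OF assms(4), of x] x by (simp add: conj_map_def)
    have "inv g \<otimes> g' \<otimes> x = inv g \<otimes> (g' \<otimes> x \<otimes> inv g') \<otimes> g'" using assms by (simp add: m_assoc)
    also have "\<dots> = inv g \<otimes> (g \<otimes> x \<otimes> inv g) \<otimes> g'" by (simp add: e)
    also have "\<dots> = x \<otimes> (inv g \<otimes> g')" using assms by (simp add: m_assoc) (simp add: m_assoc[symmetric])
    finally show ?thesis .
  qed
  thus ?thesis using assms by (simp add: centralizer_def)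
qed

lemma (in group) conj_centralizer:
  assumes "L \<subseteq> carrier G" "g \<in> carrier G" "conj_set G g L \<subseteq> K" "c \<in> centralizer G K"
  shows "inv g \<otimes> (c \<otimes> g) \<in> centralizer G L"
proof -
  have c: "c \<in> carrier G" using assms by (simp add: centralizer_def)
  have "inv g \<otimes> (c \<otimes> g) \<otimes> x = x \<otimes> (inv g \<otimes> (c \<otimes> g))" if x: "x \<in> L" for x
  proof -
    have [simp]: "x \<in> carrier G" using x assms by auto
    have "g \<otimes> x \<otimes> inv g \<in> K" using assms x by (auto simp: conj_set_eq)
    hence e: "c \<otimes> (g \<otimes> x \<otimes> inv g) = (g \<otimes> x \<otimes> inv g) \<otimes> c" using assms by (auto simp: centralizer_def)
    have "inv g \<otimes> (c \<otimes> g) \<otimes> x = inv g \<otimes> (c \<otimes> (g \<otimes> x \<otimes> inv g)) \<otimes> g" using assms c by (simp add: m_assoc)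
    also have "\<dots> = inv g \<otimes> ((g \<otimes> x \<otimes> inv g) \<otimes> c) \<otimes> g" by (simp add: e)
    also have "\<dots> = x \<otimes> (inv g \<otimes> (c \<otimes> g))" using assms c by (simp add: m_assoc) (simp add: m_assoc[symmetric])
    finally show ?thesis .
  qed
  thus ?thesis using assms c by (simp add: centralizer_def)
qed

lemma (in group) lcos_eq_iff:
  assumes "subgroup H G" "a \<in> carrier G" "b \<in> carrier G" "inv a \<otimes> b \<in> H"
  shows "a <# H = b <# H"
proof -
  have "b \<in> a <# H" using assms by (simp add: subgroup.lcos_module_rev is_group)
  thus ?thesis using assms by (metis l_repr_independence)
qed

lemma (in group) centralizer_coset_map_spec:
  assumes L: "L \<subseteq> carrier G" and K: "K \<subseteq> carrier G" and g: "g \<in> carrier G" and gLK: "conj_set G g L \<subseteq> K"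
    and x: "x \<in> carrier G"
  defines "h \<equiv> centralizer_coset_map G (L, conj_map G g L, K)"
  shows "h \<in> gmaps G (coset_gset G (centralizer G K)) (coset_gset G (centralizer G L))"
    and "h (x <# centralizer G K) = (x \<otimes> g) <# centralizer G L"
proof -
  let ?CK = "centralizer G K" and ?CL = "centralizer G L"
  have sK: "subgroup ?CK G" and sL: "subgroup ?CL G" using L K subgroup_centralizer by auto
  have cK: "?CK \<subseteq> carrier G" and cL: "?CL \<subseteq> carrier G" by (auto simp: centralizer_def)
  define P where "P h \<longleftrightarrow> h \<in> gmaps G (coset_gset G ?CK) (coset_gset G ?CL) \<and>
       (\<forall>g'\<in>carrier G. conj_set G g' L \<subseteq> K \<and> conj_map G g L = conj_map G g' L \<longrightarrow> h ?CK = g' <# ?CL)" for h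
  have hval: "h' (x <# ?CK) = (x \<otimes> g) <# ?CL" if "P h'" "x \<in> carrier G" for h' x
  proof -
    have CK: "?CK \<in> lcosets ?CK" unfolding LCOSETS_def using lcos_mult_one[OF cK] one_closed by blast
    have "h' ?CK = g <# ?CL" using that g gLK unfolding P_def by blast
    moreover have "h' (snd (coset_gset G ?CK) x ?CK) = snd (coset_gset G ?CL) x (h' ?CK)"
      using that CK unfolding P_def by (intro gmaps_app(2)) auto
    moreover have "g <# ?CL \<in> lcosets ?CL" using g by (auto simp: LCOSETS_def)
    ultimately show ?thesis using CK that g cL by (simp add: coset_gset_def lcos_m_assoc)
  qed
  define h0 where "h0 = (\<lambda>X\<in>lcosets ?CK. X <#> (g <# ?CL))"
  have h0: "h0 (x <# ?CK) = (x \<otimes> g) <# ?CL" if x: "x \<in> carrier G" for x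
  proof -
    have "(x <# ?CK) <#> (g <# ?CL) = (\<Union>c\<in>?CK. (x \<otimes> c \<otimes> g) <# ?CL)"
      using x g cK cL by (auto simp: l_coset_def set_mult_def m_assoc subset_iff)
    also have "\<dots> = (\<Union>c\<in>?CK. (x \<otimes> g) <# ?CL)"
    proof (rule SUP_cong[OF refl])
      fix c assume c: "c \<in> ?CK"
      hence cc: "c \<in> carrier G" using cK by blast
      have "inv (x \<otimes> g) \<otimes> (x \<otimes> c \<otimes> g) = inv g \<otimes> (c \<otimes> g)"
        using x g cc by (simp add: inv_mult_group m_assoc) (simp add: m_assoc[symmetric])
      hence "(x \<otimes> g) <# ?CL = (x \<otimes> c \<otimes> g) <# ?CL"
        using conj_centralizer[OF L g gLK c] x g cc sL by (intro lcos_eq_iff) auto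
      thus "(x \<otimes> c \<otimes> g) <# ?CL = (x \<otimes> g) <# ?CL" by simp
    qed
    also have "\<dots> = (x \<otimes> g) <# ?CL" using subgroup.one_closed[OF sK] by auto
    finally show ?thesis using x by (auto simp: h0_def LCOSETS_def)
  qed
  have "h0 \<in> gmaps G (coset_gset G ?CK) (coset_gset G ?CL)"
  proof -
    have "h0 \<in> lcosets ?CK \<rightarrow>\<^sub>E lcosets ?CL"
    proof (rule PiE_I)
      fix X assume "X \<in> lcosets ?CK"
      then obtain x where "x \<in> carrier G" "X = x <# ?CK" by (auto simp: LCOSETS_def)
      then show "h0 X \<in> lcosets ?CL" using h0 g by (auto simp: LCOSETS_def)
    qed (simp add: h0_def)
    moreover have "h0 (snd (coset_gset G ?CK) y X) = snd (coset_gset G ?CL) y (h0 X)"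
      if y: "y \<in> carrier G" and X: "X \<in> lcosets ?CK" for y X
    proof -
      obtain x where x: "x \<in> carrier G" "X = x <# ?CK" using X by (auto simp: LCOSETS_def)
      have "snd (coset_gset G ?CK) y X = (y \<otimes> x) <# ?CK"
        using X y x cK by (simp add: coset_gset_def lcos_m_assoc)
      moreover have "(x \<otimes> g) <# ?CL \<in> lcosets ?CL" using x g by (auto simp: LCOSETS_def)
      ultimately show ?thesis using x y h0 g cL by (simp add: coset_gset_def lcos_m_assoc m_assoc)
    qed
    ultimately show ?thesis by (auto simp: gmaps_def)
  qed
  moreover have "h0 ?CK = g' <# ?CL"
    if g': "g' \<in> carrier G" "conj_map G g L = conj_map G g' L" for g'
  proof -
    have "h0 ?CK = g <# ?CL" using h0[OF one_closed] g lcos_mult_one[OF cK] by simp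
    also have "\<dots> = g' <# ?CL"
      using conj_map_cong_centralizer[OF L g g'] g g' sL by (intro lcos_eq_iff) auto
    finally show ?thesis .
  qed
  ultimately have P0: "P h0" by (auto simp: P_def)
  have "P h"
    unfolding h_def centralizer_coset_map_def prod.case P_def[symmetric]
  proof (rule theI[of P, OF P0])
    fix h' assume h': "P h'"
    show "h' = h0"
    proof (rule extensionalityI[where A = "lcosets ?CK"])
      show "h' \<in> extensional (lcosets ?CK)" "h0 \<in> extensional (lcosets ?CK)"
        using h' P0 by (auto simp: P_def gmaps_def PiE_iff)
      show "h' X = h0 X" if "X \<in> lcosets ?CK" for X
        using that hval[OF h'] h0 by (auto simp: LCOSETS_def)
    qed
  qed
  thus "h \<in> gmaps G (coset_gset G (centralizer G K)) (coset_gset G (centralizer G L))"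
    "h (x <# centralizer G K) = (x \<otimes> g) <# centralizer G L"
    using hval x by (auto simp: P_def)
qed

lemma (in group) fusion_functor:
  assumes fin: "finite (carrier G)" and \<C>: "\<forall>H\<in>\<C>. subgroup H G"
  shows "gset_functor G (opposite (fusion_category G \<C>)) (\<lambda>K. coset_gset G (centralizer G K))
    (centralizer_coset_map G)"
proof -
  let ?F = "\<lambda>K. coset_gset G (centralizer G K)" and ?v = "centralizer_coset_map G"
  have sub: "L \<subseteq> carrier G" if "L \<in> \<C>" for L using \<C> subgroup.subset that by blast
  have F: "finite_gset G (?F K)" if "K \<in> \<C>" for K
    using coset_gset_finite_gset[OF fin subgroup_centralizer[OF sub[OF that]]] .
  have ext: "h = h'" if "h \<in> extensional (lcosets (centralizer G K))" "h' \<in> extensional (lcosets (centralizer G K))"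
     "\<And>x. x \<in> carrier G \<Longrightarrow> h (x <# centralizer G K) = h' (x <# centralizer G K)" for h h' :: "'a set \<Rightarrow> 'a set" and K
    by (rule extensionalityI[OF that(1,2)]) (use that(3) in \<open>auto simp: LCOSETS_def\<close>)
  have gext: "h \<in> extensional (fst X)" if "h \<in> gmaps G X Y" for h and X :: "('a, 'a set) gset" and Y :: "('a, 'a set) gset"
    using that by (auto simp: gmaps_def PiE_iff)
  have id: "?v (L, \<lambda>x\<in>L. x, L) = (\<lambda>X\<in>lcosets (centralizer G L). X)" if "L \<in> \<C>" for L
  proof (rule ext)
    note s = centralizer_coset_map_spec[OF sub[OF that] sub[OF that] one_closed,
        unfolded conj_map_one[OF sub[OF that]], OF order_refl]
    show "?v (L, \<lambda>x\<in>L. x, L) \<in> extensional (lcosets (centralizer G L))"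
      using gext[OF s(1)] by auto
    fix x assume x: "x \<in> carrier G"
    thus "?v (L, \<lambda>x\<in>L. x, L) (x <# centralizer G L) =
       (\<lambda>X\<in>lcosets (centralizer G L). X) (x <# centralizer G L)"
      using s(2)[OF x] by (auto simp: LCOSETS_def)
  qed auto
  have comp: "?v (L, compose L (conj_map G h K) (conj_map G g L), M) =
      compose (lcosets (centralizer G M)) (?v (L, conj_map G g L, K)) (?v (K, conj_map G h K, M))"
    if "L \<in> \<C>" "K \<in> \<C>" "M \<in> \<C>" and gh: "g \<in> carrier G" "h \<in> carrier G"
      and c: "conj_set G g L \<subseteq> K" "conj_set G h K \<subseteq> M" for L K M g h
  proof (rule ext)
    note LKM = sub[OF that(1)] sub[OF that(2)] sub[OF that(3)]
    have c2: "conj_set G (h \<otimes> g) L \<subseteq> M"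
      unfolding conj_set_mult[OF LKM(1) gh] using c by (auto simp: conj_set_eq)
    note s1 = centralizer_coset_map_spec[OF LKM(1,2) gh(1) c(1)]
    note s2 = centralizer_coset_map_spec[OF LKM(2,3) gh(2) c(2)]
    note s3 = centralizer_coset_map_spec[OF LKM(1,3) m_closed[OF gh(2,1)] c2]
    note e = conj_map_mult[OF LKM(1) gh c(1)]
    show "?v (L, compose L (conj_map G h K) (conj_map G g L), M) \<in> extensional (lcosets (centralizer G M))"
      unfolding e using gext[OF s3(1)] by auto
    fix x assume x: "x \<in> carrier G"
    hence "x <# centralizer G M \<in> lcosets (centralizer G M)" by (auto simp: LCOSETS_def)
    thus "?v (L, compose L (conj_map G h K) (conj_map G g L), M) (x <# centralizer G M) =
      compose (lcosets (centralizer G M)) (?v (L, conj_map G g L, K)) (?v (K, conj_map G h K, M)) (x <# centralizer G M)"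
      unfolding e using x gh s1(2) s2(2) s3(2) by (simp add: compose_eq m_assoc)
  qed (simp add: compose_extensional)
  show ?thesis
    unfolding gset_functor_def opposite_def fusion_category_def
    using F id comp sub centralizer_coset_map_spec(1)[OF _ _ _ _ one_closed] by auto
qed

lemma (in group) EA_finite_gcategory:
  assumes "finite (carrier G)" "\<forall>H\<in>\<C>. subgroup H G"
  shows "finite_gcategory G (EA G \<C>)"
  unfolding EA_def
  by (intro grothendieck_finite_gcategory is_group opposite_finite fusion_category_finite fusion_functor assms)

end

theory Submission
  imports Defs
begin

text \<open>The ring \<open>\<Omega> G\<close> is spanned by the transitive \<open>G\<close>-sets, and the table of marks is triangular with
  respect to the order of the subgroups, so an element is determined by its marks; this gives the
  primitive idempotents and turns every identity in \<open>\<Omega> G\<close> into one about numbers of fixed points.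

  Both \<open>EO\<close> and \<open>EA\<close> are preorders: sending an object \<open>(H, x S)\<close>, with \<open>S\<close> equal to \<open>H\<close> or to its
  centralizer, to \<open>x H x\<^sup>-\<^sup>1\<close> is an equivalence with \<open>\<C>\<close> or its opposite, with exactly \<open>|G : S|\<close>
  objects over each subgroup.  The generating function \<open>u\<^sub>P\<close> of the chains starting over \<open>P\<close>
  therefore satisfies \<open>u\<^sub>P = 1 + t ((m\<^sub>P - 1) u\<^sub>P + (\<Sum>Q>P. m\<^sub>Q u\<^sub>Q))\<close>.  At \<open>t = - 1\<close> this says
  that \<open>m\<^sub>P u\<^sub>P(- 1)\<close> is the weighting \<open>k\<^sub>P\<close> with \<open>(\<Sum>Q\<ge>P. k\<^sub>Q) = 1\<close>, namely minus the reduced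
  Euler characteristic of the part above \<open>P\<close>.  Counting the chains fixed by \<open>K\<close> by the first
  component of the initial object gives the expansion in transitive \<open>G\<close>-sets, and counting them by
  its image in \<open>\<C>\<close> gives the marks, hence the expansion in idempotents.\<close>


subsection \<open>Extension of scalars\<close>

text \<open>\<open>mark\<close>, \<open>burnside_idem\<close> and \<open>series_Lefschetz\<close>
  are definite descriptions over a twofold quotient of free modules, so existence and uniqueness
  must be settled before anything is computed. Marks exist because counting fixed points is a
  homomorphism of semirings and extends along both scalar extensions; they are unique because
  classes of G-sets span. Idempotents and Lefschetz values are unique because marks separate
  elements and because a Laurent series determines the rational function it comes from. One locale
  with parameters \<open>r\<close>, \<open>S\<close>, \<open>T\<close> treats both categories: for
  \<open>EO\<close> inclusion and twice the identity, for \<open>EA\<close> reversed inclusion and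
  twice the centralizer. The common core is an adjunction: \<open>K\<close> lies in
  \<open>S Q\<close> iff \<open>Q\<close> is at or above \<open>T K\<close> for \<open>r\<close>.
  For \<open>EA\<close> this is the symmetry of commuting elementwise. It places the objects fixed
  by \<open>K\<close> over the up-set of \<open>T K\<close>, where the weighting sums to 1 if
  \<open>T K\<close> is in the family; hence only the other \<open>K\<close> survive in the
  idempotent formulas. Solving the recurrence divides by \<open>1 - (m_P - 1) t\<close>, which is
  \<open>m_P > 0\<close> at -1, so no pole arises there.\<close>

definition free_lift :: "('r \<Rightarrow> 'k \<Rightarrow> 'c) \<Rightarrow> ('r \<Rightarrow>\<^sub>0 'k::comm_ring_1) \<Rightarrow> 'c::comm_monoid_add" where
  "free_lift \<phi> f = (\<Sum>a\<in>Poly_Mapping.keys f. \<phi> a (Poly_Mapping.lookup f a))"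

lemma free_lift_single:
  assumes "\<And>a. \<phi> a 0 = 0"
  shows "free_lift \<phi> (Poly_Mapping.single a c) = \<phi> a c"
  by (cases "c = 0") (simp_all add: free_lift_def assms)

text \<open>Only additivity in the coefficient is used, so the lift serves both the product of the
  free algebra, with values in the algebra itself, and the linear functionals behind the marks, with
  values in the scalars.\<close>

lemma free_lift_add:
  assumes "\<And>a. \<phi> a 0 = 0" "\<And>a c d. \<phi> a (c + d) = \<phi> a c + \<phi> a d"
  shows "free_lift \<phi> (f + g) = free_lift \<phi> f + free_lift \<phi> g"
  unfolding free_lift_def
  using setsum_keys_plus_distrib[of \<phi> f g, OF assms] by simp

lemma free_lift_fun_add:
  "free_lift (\<lambda>a c. \<phi> a c + \<psi> a c) f = free_lift \<phi> f + free_lift \<psi> f"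
  by (simp add: free_lift_def sum.distrib)

lemma poly_mapping_sum_singles:
  fixes f :: "'r \<Rightarrow>\<^sub>0 'k::comm_monoid_add"
  shows "f = (\<Sum>a\<in>Poly_Mapping.keys f. Poly_Mapping.single a (Poly_Mapping.lookup f a))"
  by (rule poly_mapping_eqI) (simp add: lookup_sum lookup_single when_def in_keys_iff)

lemma free_poly_mapping_induct [consumes 1, case_names zero single add]:
  fixes f :: "'r \<Rightarrow>\<^sub>0 'k::comm_monoid_add"
  assumes "Poly_Mapping.keys f \<subseteq> A" "P 0"
    and "\<And>a c. a \<in> A \<Longrightarrow> P (Poly_Mapping.single a c)"
    and "\<And>f g. Poly_Mapping.keys f \<subseteq> A \<Longrightarrow> Poly_Mapping.keys g \<subseteq> A \<Longrightarrow> P f \<Longrightarrow> P g \<Longrightarrow> P (f + g)"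
  shows "P f"
proof -
  have "P (\<Sum>a\<in>K. Poly_Mapping.single a (Poly_Mapping.lookup f a)) \<and>
     Poly_Mapping.keys (\<Sum>a\<in>K. Poly_Mapping.single a (Poly_Mapping.lookup f a)) \<subseteq> A"
    if "finite K" "K \<subseteq> A" for K
    using that
  proof (induction K rule: finite_induct)
    case (insert a K)
    let ?s = "Poly_Mapping.single a (Poly_Mapping.lookup f a)"
    have "Poly_Mapping.keys ?s \<subseteq> A" using insert by auto
    with insert assms(3,4) keys_add[of ?s "\<Sum>a\<in>K. Poly_Mapping.single a (Poly_Mapping.lookup f a)"]
    show ?case by auto
  qed (use assms in simp)
  from this[of "Poly_Mapping.keys f"] show ?thesis
    using assms(1) poly_mapping_sum_singles[of f] by simp
qed

text \<open>Used twice: with \<open>k = int\<close> on the semiring of isomorphism classes, and with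
  \<open>k = rat\<close> on the resulting integral Burnside ring. The multiplicative monoid of
  \<open>R\<close> makes the free module a ring; the addition of \<open>R\<close> enters through the
  relations, which are divided out as an ideal.\<close>

locale scalar_extension = comm_monoid R for R :: "('r, 'm) ring_scheme" (structure) +
  fixes k :: "'k::comm_ring_1 itself"
  assumes add_closed: "\<lbrakk>a \<in> carrier R; b \<in> carrier R\<rbrakk> \<Longrightarrow> a \<oplus> b \<in> carrier R"
begin

definition FA :: "('r \<Rightarrow>\<^sub>0 'k) ring" where "FA = formal_algebra R"
definition AI :: "('r \<Rightarrow>\<^sub>0 'k) set" where "AI = additivity_ideal R"
definition ES :: "('k, ('r \<Rightarrow>\<^sub>0 'k) set) module" where "ES = extend_scalars R"
definition cls :: "('r \<Rightarrow>\<^sub>0 'k) \<Rightarrow> ('r \<Rightarrow>\<^sub>0 'k) set" where "cls f = AI +>\<^bsub>FA\<^esub> f"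

lemma FA_simps:
  "carrier FA = {f. Poly_Mapping.keys f \<subseteq> carrier R}"
  "\<zero>\<^bsub>FA\<^esub> = 0" "f \<oplus>\<^bsub>FA\<^esub> g = f + g" "\<one>\<^bsub>FA\<^esub> = Poly_Mapping.single \<one> 1"
  by (simp_all add: FA_def formal_algebra_def)

text \<open>Writing the double sum as a nested lift reduces bilinearity to additivity of
  \<open>free_lift\<close>; the other ring laws are then checked on
  \<open>Poly_Mapping.single\<close> elements.\<close>

lemma FA_mult:
  "f \<otimes>\<^bsub>FA\<^esub> g = free_lift (\<lambda>a c. free_lift (\<lambda>b d. Poly_Mapping.single (a \<otimes> b) (c * d)) g) f"
  by (simp add: FA_def formal_algebra_def free_lift_def)

lemma FA_mult_single:
  "Poly_Mapping.single a c \<otimes>\<^bsub>FA\<^esub> Poly_Mapping.single b d = Poly_Mapping.single (a \<otimes> b) (c * d)"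
  by (simp add: FA_mult free_lift_single)

lemma FA_mult_add:
  "(f + f') \<otimes>\<^bsub>FA\<^esub> g = f \<otimes>\<^bsub>FA\<^esub> g + f' \<otimes>\<^bsub>FA\<^esub> g"
  "f \<otimes>\<^bsub>FA\<^esub> (g + g') = f \<otimes>\<^bsub>FA\<^esub> g + f \<otimes>\<^bsub>FA\<^esub> g'"
proof -
  have *: "free_lift (\<lambda>b d. 0) g = (0 :: 'r \<Rightarrow>\<^sub>0 'k)" for g :: "'r \<Rightarrow>\<^sub>0 'k"
    by (simp add: free_lift_def)
  show "(f + f') \<otimes>\<^bsub>FA\<^esub> g = f \<otimes>\<^bsub>FA\<^esub> g + f' \<otimes>\<^bsub>FA\<^esub> g"
    unfolding FA_mult
    by (rule free_lift_add) (simp_all add: * single_add distrib_right free_lift_fun_add)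
  show "f \<otimes>\<^bsub>FA\<^esub> (g + g') = f \<otimes>\<^bsub>FA\<^esub> g + f \<otimes>\<^bsub>FA\<^esub> g'"
    unfolding FA_mult
    by (subst free_lift_add) (simp_all add: single_add distrib_left free_lift_fun_add)
qed

lemma FA_mult_zero [simp]: "0 \<otimes>\<^bsub>FA\<^esub> g = 0" "f \<otimes>\<^bsub>FA\<^esub> 0 = 0"
  by (simp_all add: FA_mult free_lift_def)

lemma FA_add_keys: "\<lbrakk>f \<in> carrier FA; g \<in> carrier FA\<rbrakk> \<Longrightarrow> f + g \<in> carrier FA"
  using keys_add[of f g] by (auto simp: FA_simps)

lemma FA_uminus: "f \<in> carrier FA \<Longrightarrow> - f \<in> carrier FA"
proof -
  have "Poly_Mapping.keys (- f) = Poly_Mapping.keys f" by (auto simp: in_keys_iff)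
  thus "f \<in> carrier FA \<Longrightarrow> - f \<in> carrier FA" by (simp add: FA_simps)
qed

lemma FA_single [simp]: "a \<in> carrier R \<Longrightarrow> Poly_Mapping.single a c \<in> carrier FA"
  by (simp add: FA_simps)

lemma FA_induct [consumes 1, case_names zero single add]:
  assumes "f \<in> carrier FA" "P 0" "\<And>a c. a \<in> carrier R \<Longrightarrow> P (Poly_Mapping.single a c)"
    "\<And>f g. f \<in> carrier FA \<Longrightarrow> g \<in> carrier FA \<Longrightarrow> P f \<Longrightarrow> P g \<Longrightarrow> P (f + g)"
  shows "P f"
  using assms(1)[unfolded FA_simps mem_Collect_eq]
  by (induction f rule: free_poly_mapping_induct) (use assms(2-) in \<open>auto simp: FA_simps\<close>)

lemma FA_mult_closed: "\<lbrakk>f \<in> carrier FA; g \<in> carrier FA\<rbrakk> \<Longrightarrow> f \<otimes>\<^bsub>FA\<^esub> g \<in> carrier FA"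
proof (induction f rule: FA_induct)
  case (single a c)
  from single(2) single(1) show ?case
    by (induction g rule: FA_induct) (auto simp: FA_mult_single FA_mult_add FA_add_keys, simp add: FA_simps)
qed (auto simp: FA_mult_add FA_add_keys, simp add: FA_simps)

lemma FA_mult_comm: "\<lbrakk>f \<in> carrier FA; g \<in> carrier FA\<rbrakk> \<Longrightarrow> f \<otimes>\<^bsub>FA\<^esub> g = g \<otimes>\<^bsub>FA\<^esub> f"
proof (induction f rule: FA_induct)
  case (single a c)
  from single(2) single(1) show ?case
    by (induction g rule: FA_induct) (auto simp: FA_mult_single FA_mult_add m_comm mult.commute)
qed (auto simp: FA_mult_add)

lemma FA_mult_assoc:
  "\<lbrakk>f \<in> carrier FA; g \<in> carrier FA; h \<in> carrier FA\<rbrakk> \<Longrightarrow> f \<otimes>\<^bsub>FA\<^esub> g \<otimes>\<^bsub>FA\<^esub> h = f \<otimes>\<^bsub>FA\<^esub> (g \<otimes>\<^bsub>FA\<^esub> h)"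
proof (induction f rule: FA_induct)
  case (single a c)
  from single(2) single(1,3) show ?case
  proof (induction g rule: FA_induct)
    case (single b d)
    from single(3) single(1,2) show ?case
      by (induction h rule: FA_induct) (auto simp: FA_mult_single FA_mult_add m_assoc mult.assoc)
  qed (auto simp: FA_mult_add)
qed (auto simp: FA_mult_add)

lemma FA_cring: "cring FA"
proof (rule cringI)
  show "abelian_group FA"
  proof (rule abelian_groupI)
    fix f assume f: "f \<in> carrier FA"
    show "\<exists>g\<in>carrier FA. g \<oplus>\<^bsub>FA\<^esub> f = \<zero>\<^bsub>FA\<^esub>"
      by (rule bexI[OF _ FA_uminus[OF f]]) (simp add: FA_simps)
  qed (auto simp: FA_simps(2,3) FA_add_keys add_ac, simp add: FA_simps)
  show "comm_monoid FA"
  proof (rule comm_monoidI)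
    fix f assume f: "f \<in> carrier FA"
    thus "\<one>\<^bsub>FA\<^esub> \<otimes>\<^bsub>FA\<^esub> f = f"
      by (induction f rule: FA_induct) (auto simp: FA_simps(4) FA_mult_single FA_mult_add)
  qed (simp_all add: FA_mult_closed FA_mult_assoc FA_simps(4), rule FA_mult_comm)
qed (auto simp: FA_simps(3) FA_mult_add)

sublocale FA: cring FA by (rule FA_cring)

lemma FA_minus: "\<lbrakk>f \<in> carrier FA; g \<in> carrier FA\<rbrakk> \<Longrightarrow> f - g = f \<ominus>\<^bsub>FA\<^esub> g"
proof -
  assume f: "f \<in> carrier FA" and g: "g \<in> carrier FA"
  have "- g \<in> carrier FA" using g by (rule FA_uminus)
  moreover have "- g \<oplus>\<^bsub>FA\<^esub> g = \<zero>\<^bsub>FA\<^esub>" by (simp add: FA_simps)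
  ultimately have "\<ominus>\<^bsub>FA\<^esub> g = - g" by (intro FA.minus_equality g)
  hence "f \<ominus>\<^bsub>FA\<^esub> g = f \<oplus>\<^bsub>FA\<^esub> (- g)" by (simp only: a_minus_def)
  thus ?thesis by (simp add: FA_simps(3))
qed

definition AI_gens :: "('r \<Rightarrow>\<^sub>0 'k) set" where
  "AI_gens = {Poly_Mapping.single (a \<oplus> b) 1 - Poly_Mapping.single a 1 - Poly_Mapping.single b 1
        | a b. a \<in> carrier R \<and> b \<in> carrier R}"

lemma FA_diff: "\<lbrakk>f \<in> carrier FA; g \<in> carrier FA\<rbrakk> \<Longrightarrow> f - g \<in> carrier FA"
  using FA_add_keys[of f "- g"] FA_uminus by simp

lemma AI_gens: "AI_gens \<subseteq> carrier FA"
  by (auto simp: AI_gens_def FA_diff add_closed)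

lemma AI_eq: "AI = Idl\<^bsub>FA\<^esub> AI_gens"
  by (simp add: AI_def additivity_ideal_def AI_gens_def FA_def)

sublocale AI: ideal AI FA
  unfolding AI_eq by (rule FA.genideal_ideal[OF AI_gens])

section \<open>The quotient ring and its scalar action\<close>

lemma ES_simps:
  "carrier ES = carrier (FA Quot AI)" "\<zero>\<^bsub>ES\<^esub> = \<zero>\<^bsub>FA Quot AI\<^esub>" "\<one>\<^bsub>ES\<^esub> = \<one>\<^bsub>FA Quot AI\<^esub>"
  "x \<oplus>\<^bsub>ES\<^esub> y = x \<oplus>\<^bsub>FA Quot AI\<^esub> y" "x \<otimes>\<^bsub>ES\<^esub> y = x \<otimes>\<^bsub>FA Quot AI\<^esub> y"
  "c \<odot>\<^bsub>ES\<^esub> x = tensor R c \<one> \<otimes>\<^bsub>ES\<^esub> x"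
  by (simp_all add: ES_def extend_scalars_def Let_def FA_def AI_def)

lemma ES_cring: "cring ES"
proof -
  interpret Q: cring "FA Quot AI" by (rule AI.quotient_is_cring[OF FA_cring])
  show ?thesis
  proof (rule cringI)
    show "abelian_group ES"
    proof (rule abelian_groupI)
      fix x assume "x \<in> carrier ES"
      thus "\<exists>y\<in>carrier ES. y \<oplus>\<^bsub>ES\<^esub> x = \<zero>\<^bsub>ES\<^esub>"
        unfolding ES_simps(1-5) using Q.l_neg Q.a_inv_closed by blast
    qed (simp_all add: ES_simps(1-5) Q.a_assoc, simp add: Q.a_comm)
    show "comm_monoid ES"
      by (rule comm_monoidI) (simp_all add: ES_simps(1-5) Q.m_assoc, rule Q.m_comm)
  qed (auto simp: ES_simps(1-5) Q.l_distr)
qed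

sublocale ES: cring ES by (rule ES_cring)

lemma ES_carrierE:
  assumes "x \<in> carrier ES" obtains f where "f \<in> carrier FA" "x = cls f"
  using assms by (auto simp: ES_simps FactRing_def A_RCOSETS_def' cls_def)

lemma cls_hom:
  "f \<in> carrier FA \<Longrightarrow> cls f \<in> carrier ES"
  "\<lbrakk>f \<in> carrier FA; g \<in> carrier FA\<rbrakk> \<Longrightarrow> cls (f + g) = cls f \<oplus>\<^bsub>ES\<^esub> cls g"
  "\<lbrakk>f \<in> carrier FA; g \<in> carrier FA\<rbrakk> \<Longrightarrow> cls (f \<otimes>\<^bsub>FA\<^esub> g) = cls f \<otimes>\<^bsub>ES\<^esub> cls g"
  "cls (Poly_Mapping.single \<one> 1) = \<one>\<^bsub>ES\<^esub>"
  "cls 0 = \<zero>\<^bsub>ES\<^esub>"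
proof -
  note h = AI.rcos_ring_hom[folded cls_def]
  show "f \<in> carrier FA \<Longrightarrow> cls f \<in> carrier ES"
    using ring_hom_closed[OF h] by (simp add: ES_simps cls_def)
  show "\<lbrakk>f \<in> carrier FA; g \<in> carrier FA\<rbrakk> \<Longrightarrow> cls (f + g) = cls f \<oplus>\<^bsub>ES\<^esub> cls g"
    using ring_hom_add[OF h] by (simp add: ES_simps cls_def FA_simps)
  show "\<lbrakk>f \<in> carrier FA; g \<in> carrier FA\<rbrakk> \<Longrightarrow> cls (f \<otimes>\<^bsub>FA\<^esub> g) = cls f \<otimes>\<^bsub>ES\<^esub> cls g"
    using ring_hom_mult[OF h] by (simp add: ES_simps cls_def)
  show "cls (Poly_Mapping.single \<one> 1) = \<one>\<^bsub>ES\<^esub>"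
    using ring_hom_one[OF h] by (simp add: ES_simps cls_def FA_simps)
  show "cls 0 = \<zero>\<^bsub>ES\<^esub>"
    using ring_hom_zero[OF h FA.ring_axioms AI.quotient_is_ring] by (simp add: ES_simps cls_def FA_simps)
qed

lemma tensor_cls: "tensor R c r = cls (Poly_Mapping.single r c)"
  by (simp add: tensor_def cls_def AI_def FA_def)

lemma tensor_closed [simp]: "r \<in> carrier R \<Longrightarrow> tensor R c r \<in> carrier ES"
  by (simp add: tensor_cls cls_hom)

lemma tensor_add_scalar:
  "r \<in> carrier R \<Longrightarrow> tensor R (c + d) r = tensor R c r \<oplus>\<^bsub>ES\<^esub> tensor R d r"
  by (simp add: tensor_cls single_add cls_hom)

lemma tensor_zero_scalar: "tensor R 0 r = \<zero>\<^bsub>ES\<^esub>"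
  by (simp add: tensor_cls cls_hom)

lemma tensor_mult:
  "\<lbrakk>r \<in> carrier R; s \<in> carrier R\<rbrakk> \<Longrightarrow> tensor R c r \<otimes>\<^bsub>ES\<^esub> tensor R d s = tensor R (c * d) (r \<otimes> s)"
  by (simp add: tensor_cls FA_mult_single flip: cls_hom(3))

text \<open>The difference of the two sides is the class of a generator of \<open>AI\<close>. The
  scalar is 1 because the generators have coefficient 1.\<close>

lemma tensor_add_1:
  assumes "r \<in> carrier R" "s \<in> carrier R"
  shows "tensor R (1::'k) (r \<oplus> s) = tensor R 1 r \<oplus>\<^bsub>ES\<^esub> tensor R 1 s"
proof -
  let ?e = "\<lambda>r. Poly_Mapping.single r (1::'k)"
  let ?d = "?e (r \<oplus> s) - ?e r - ?e s"
  have "?d \<in> AI_gens" using assms by (auto simp: AI_gens_def)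
  hence d: "?d \<in> AI" unfolding AI_eq using FA.genideal_self[OF AI_gens] by blast
  hence "cls ?d = AI" unfolding cls_def
    by (simp add: AI.a_rcos_const)
  also have "\<dots> = \<zero>\<^bsub>ES\<^esub>" by (simp add: ES_simps FactRing_def)
  finally have "cls ?d = \<zero>\<^bsub>ES\<^esub>" .
  have dc: "?d \<in> carrier FA" using d AI.a_subset by blast
  have "cls (?e (r \<oplus> s)) = cls (?d + (?e r + ?e s))" by simp
  also have "\<dots> = cls ?d \<oplus>\<^bsub>ES\<^esub> (cls (?e r) \<oplus>\<^bsub>ES\<^esub> cls (?e s))"
    using assms dc by (subst cls_hom(2)) (auto simp: cls_hom FA_add_keys)
  finally show ?thesis using \<open>cls ?d = \<zero>\<^bsub>ES\<^esub>\<close> assms by (simp add: tensor_cls cls_hom)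
qed

lemma tensor_one: "tensor R 1 \<one> = \<one>\<^bsub>ES\<^esub>"
  by (simp add: tensor_cls cls_hom)

lemma smult_tensor: "r \<in> carrier R \<Longrightarrow> c \<odot>\<^bsub>ES\<^esub> tensor R d r = tensor R (c * d) r"
  by (simp add: ES_simps(6) tensor_mult)

lemma smult_closed: "x \<in> carrier ES \<Longrightarrow> c \<odot>\<^bsub>ES\<^esub> x \<in> carrier ES"
  by (simp add: ES_simps(6))

text \<open>The scalar action is multiplication by the class of \<open>c\<close> tensor 1, so the
  module laws are ring laws of \<open>ES\<close>.\<close>

lemma smult_distr:
  "x \<in> carrier ES \<Longrightarrow> (c + d) \<odot>\<^bsub>ES\<^esub> x = c \<odot>\<^bsub>ES\<^esub> x \<oplus>\<^bsub>ES\<^esub> d \<odot>\<^bsub>ES\<^esub> x"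
  "\<lbrakk>x \<in> carrier ES; y \<in> carrier ES\<rbrakk> \<Longrightarrow> c \<odot>\<^bsub>ES\<^esub> (x \<oplus>\<^bsub>ES\<^esub> y) = c \<odot>\<^bsub>ES\<^esub> x \<oplus>\<^bsub>ES\<^esub> c \<odot>\<^bsub>ES\<^esub> y"
  "x \<in> carrier ES \<Longrightarrow> (c * d) \<odot>\<^bsub>ES\<^esub> x = c \<odot>\<^bsub>ES\<^esub> (d \<odot>\<^bsub>ES\<^esub> x)"
  "x \<in> carrier ES \<Longrightarrow> 1 \<odot>\<^bsub>ES\<^esub> x = x"
  "x \<in> carrier ES \<Longrightarrow> 0 \<odot>\<^bsub>ES\<^esub> x = \<zero>\<^bsub>ES\<^esub>"
  by (simp_all add: ES_simps(6) tensor_add_scalar tensor_mult tensor_one tensor_zero_scalar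
      ES.l_distr ES.r_distr flip: ES.m_assoc)

lemma ES_induct [consumes 1, case_names smult_tensor add]:
  assumes "x \<in> carrier ES"
    and "\<And>r c. r \<in> carrier R \<Longrightarrow> P (c \<odot>\<^bsub>ES\<^esub> tensor R 1 r)"
    and "\<And>x y. x \<in> carrier ES \<Longrightarrow> y \<in> carrier ES \<Longrightarrow> P x \<Longrightarrow> P y \<Longrightarrow> P (x \<oplus>\<^bsub>ES\<^esub> y)"
  shows "P x"
proof -
  obtain f where f: "f \<in> carrier FA" "x = cls f" using assms(1) by (rule ES_carrierE)
  from f(1) have "P (cls f)"
  proof (induction rule: FA_induct)
    case zero
    have "P (0 \<odot>\<^bsub>ES\<^esub> tensor R 1 \<one>)" by (rule assms(2)) simp
    thus ?case by (simp add: smult_distr cls_hom)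
  next
    case (single a c)
    thus ?case using assms(2)[of a c] by (simp add: smult_tensor) (simp add: tensor_cls)
  qed (auto simp: cls_hom assms(3))
  thus ?thesis using f by simp
qed

text \<open>Independent of the representative \<open>f\<close> when \<open>h\<close> is a semiring homomorphism: then the kernel of
  its linear extension is an ideal that contains the additivity relations.\<close>

definition ext_hom :: "('r \<Rightarrow> 'k) \<Rightarrow> ('r \<Rightarrow>\<^sub>0 'k) set \<Rightarrow> 'k" where
  "ext_hom h x = (THE v. \<exists>f\<in>carrier FA. x = cls f \<and> v = free_lift (\<lambda>a c. c * h a) f)"

context
  fixes h :: "'r \<Rightarrow> 'k"
  assumes h_add: "\<And>a b. \<lbrakk>a \<in> carrier R; b \<in> carrier R\<rbrakk> \<Longrightarrow> h (a \<oplus> b) = h a + h b"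
    and h_mult: "\<And>a b. \<lbrakk>a \<in> carrier R; b \<in> carrier R\<rbrakk> \<Longrightarrow> h (a \<otimes> b) = h a * h b"
    and h_one: "h \<one> = 1"
begin

private abbreviation "L \<equiv> free_lift (\<lambda>a c. c * h a)"

private lemma L_add: "L (f + g) = L f + L g"
  by (rule free_lift_add) (simp_all add: distrib_right)

private lemma L_single: "L (Poly_Mapping.single a c) = c * h a"
  by (rule free_lift_single) simp

private lemma L_zero: "L 0 = 0"
  by (simp add: free_lift_def)

private lemma L_diff: "L (f - g) = L f - L g"
  using L_add[of "f - g" g] by simp

private lemma L_mult: "\<lbrakk>f \<in> carrier FA; g \<in> carrier FA\<rbrakk> \<Longrightarrow> L (f \<otimes>\<^bsub>FA\<^esub> g) = L f * L g"
proof (induction f rule: FA_induct)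
  case (single a c)
  from single(2) single(1) show ?case
    by (induction g rule: FA_induct)
      (auto simp: FA_mult_single FA_mult_add L_single L_add L_zero h_mult algebra_simps)
qed (auto simp: FA_mult_add L_add L_zero distrib_right)

private lemma L_AI: "f \<in> AI \<Longrightarrow> L f = 0"
proof -
  define I where "I = {f \<in> carrier FA. L f = 0}"
  have mi: "\<ominus>\<^bsub>FA\<^esub> f = - f" if "f \<in> carrier FA" for f
    using FA_minus[of "\<zero>\<^bsub>FA\<^esub>" f] that by (simp add: a_minus_def) (simp add: FA_simps)
  have "ideal I FA"
  proof (rule idealI[OF FA.ring_axioms])
    show "subgroup I (add_monoid FA)"
    proof (rule FA.add.subgroupI)
      have "0 \<in> I" by (simp add: I_def L_zero FA_simps)
      thus "I \<noteq> {}" by blast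
      fix f assume "f \<in> I"
      hence f: "f \<in> carrier FA" "L f = 0" by (auto simp: I_def)
      have "L (- f) = 0" using L_diff[of 0 f] f L_zero by simp
      thus "\<ominus>\<^bsub>FA\<^esub> f \<in> I" using f FA.a_inv_closed[OF f(1)] by (simp add: I_def mi)
    qed (auto simp: I_def FA_add_keys L_add FA_simps(3))
  qed (auto simp: I_def L_mult)
  moreover have "AI_gens \<subseteq> I"
    using AI_gens by (auto simp: I_def AI_gens_def L_diff L_single h_add)
  ultimately have "AI \<subseteq> I" unfolding AI_eq by (rule FA.genideal_minimal)
  thus "f \<in> AI \<Longrightarrow> L f = 0" by (auto simp: I_def)
qed

private lemma ext_hom_cls:
  assumes "f \<in> carrier FA" shows "ext_hom h (cls f) = L f"
  unfolding ext_hom_def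
proof (rule the_equality)
  fix v assume "\<exists>g\<in>carrier FA. cls f = cls g \<and> v = L g"
  then obtain g where g: "g \<in> carrier FA" "cls f = cls g" "v = L g" by blast
  have "f \<in> AI +>\<^bsub>FA\<^esub> g" using AI.a_rcos_self[OF assms(1)] g(2) by (simp add: cls_def)
  then obtain i where "i \<in> AI" "f = i + g" by (auto simp: a_r_coset_def' FA_simps)
  thus "v = L f" using g(3) L_add L_AI by simp
qed (use assms in auto)

lemma ext_hom_tensor: "a \<in> carrier R \<Longrightarrow> ext_hom h (tensor R c a) = c * h a"
  by (simp add: tensor_cls ext_hom_cls L_single)

lemma ext_hom_add:
  assumes "x \<in> carrier ES" "y \<in> carrier ES"
  shows "ext_hom h (x \<oplus>\<^bsub>ES\<^esub> y) = ext_hom h x + ext_hom h y"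
proof -
  obtain f where f: "f \<in> carrier FA" "x = cls f" using assms(1) by (rule ES_carrierE)
  obtain g where g: "g \<in> carrier FA" "y = cls g" using assms(2) by (rule ES_carrierE)
  show ?thesis using f g by (simp add: ext_hom_cls L_add FA_add_keys flip: cls_hom(2))
qed

lemma ext_hom_mult:
  assumes "x \<in> carrier ES" "y \<in> carrier ES"
  shows "ext_hom h (x \<otimes>\<^bsub>ES\<^esub> y) = ext_hom h x * ext_hom h y"
proof -
  obtain f where f: "f \<in> carrier FA" "x = cls f" using assms(1) by (rule ES_carrierE)
  obtain g where g: "g \<in> carrier FA" "y = cls g" using assms(2) by (rule ES_carrierE)
  show ?thesis using f g by (simp add: ext_hom_cls L_mult FA_mult_closed flip: cls_hom(3))
qed

lemma ext_hom_one: "ext_hom h \<one>\<^bsub>ES\<^esub> = 1"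
  using ext_hom_tensor[of \<one> 1] by (simp add: tensor_one h_one)

lemma ext_hom_smult: "x \<in> carrier ES \<Longrightarrow> ext_hom h (c \<odot>\<^bsub>ES\<^esub> x) = c * ext_hom h x"
  by (simp add: ES_simps(6) ext_hom_mult ext_hom_tensor h_one)

end

end

subsection \<open>Finite \<open>G\<close>-sets\<close>

context group
begin

lemma finite_gsetD:
  assumes "finite_gset G X"
  shows "finite (fst X)"
    and "\<lbrakk>g \<in> carrier G; x \<in> fst X\<rbrakk> \<Longrightarrow> snd X g x \<in> fst X"
    and "x \<in> fst X \<Longrightarrow> snd X \<one> x = x"
    and "\<lbrakk>g \<in> carrier G; h \<in> carrier G; x \<in> fst X\<rbrakk> \<Longrightarrow> snd X (g \<otimes> h) x = snd X g (snd X h x)"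
    and "\<lbrakk>g \<in> carrier G; x \<in> fst X\<rbrakk> \<Longrightarrow> snd X (inv g) (snd X g x) = x"
    and "\<lbrakk>g \<in> carrier G; x \<in> fst X\<rbrakk> \<Longrightarrow> snd X g (snd X (inv g) x) = x"
proof -
  interpret group_action G "fst X" "snd X" using assms by (simp add: finite_gset_def)
  show "finite (fst X)" using assms by (simp add: finite_gset_def)
  show cl: "\<And>g x. \<lbrakk>g \<in> carrier G; x \<in> fst X\<rbrakk> \<Longrightarrow> snd X g x \<in> fst X"
    using element_image by blast
  show one: "\<And>x. x \<in> fst X \<Longrightarrow> snd X \<one> x = x"
    using id_eq_one by (metis restrict_apply')
  show mul: "\<And>g h x. \<lbrakk>g \<in> carrier G; h \<in> carrier G; x \<in> fst X\<rbrakk> \<Longrightarrow> snd X (g \<otimes> h) x = snd X g (snd X h x)"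
    using composition_rule by blast
  show "\<lbrakk>g \<in> carrier G; x \<in> fst X\<rbrakk> \<Longrightarrow> snd X (inv g) (snd X g x) = x"
    using mul[of "inv g" g x] one by simp
  show "\<lbrakk>g \<in> carrier G; x \<in> fst X\<rbrakk> \<Longrightarrow> snd X g (snd X (inv g) x) = x"
    using mul[of g "inv g" x] one by simp
qed

lemma finite_gsetI:
  assumes "finite (fst X)"
    "\<And>g x. g \<in> carrier G \<Longrightarrow> x \<in> fst X \<Longrightarrow> snd X g x \<in> fst X"
    "\<And>g. g \<in> carrier G \<Longrightarrow> snd X g \<in> extensional (fst X)"
    "\<And>x. x \<in> fst X \<Longrightarrow> snd X \<one> x = x"
    "\<And>g h x. g \<in> carrier G \<Longrightarrow> h \<in> carrier G \<Longrightarrow> x \<in> fst X \<Longrightarrow> snd X (g \<otimes> h) x = snd X g (snd X h x)"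
  shows "finite_gset G X"
  unfolding finite_gset_def using assms by (intro conjI group_actionI is_group) auto

lemma gset_isoI:
  assumes "finite_gset G X" "bij_betw f (fst X) (fst Y)"
    "\<And>g x. g \<in> carrier G \<Longrightarrow> x \<in> fst X \<Longrightarrow> f (snd X g x) = snd Y g (f x)"
  shows "gset_iso G X Y"
  unfolding gset_iso_def
proof (rule bexI[of _ "restrict f (fst X)"])
  show "bij_betw (restrict f (fst X)) (fst X) (fst Y)" using assms(2) by (simp cong: bij_betw_cong)
  show "restrict f (fst X) \<in> gmaps G X Y"
    using assms bij_betwE[OF assms(2)] finite_gsetD(2)[OF assms(1)] by (auto simp: gmaps_def)
qed

lemma gset_isoE:
  assumes "gset_iso G X Y"
  obtains f where "bij_betw f (fst X) (fst Y)"
    "\<And>g x. g \<in> carrier G \<Longrightarrow> x \<in> fst X \<Longrightarrow> f (snd X g x) = snd Y g (f x)"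
  using assms by (auto simp: gset_iso_def gmaps_def)

lemma gset_iso_sym:
  assumes "gset_iso G X Y" "finite_gset G X" "finite_gset G Y"
  shows "gset_iso G Y X"
proof -
  obtain f where f: "bij_betw f (fst X) (fst Y)"
    "\<And>g x. g \<in> carrier G \<Longrightarrow> x \<in> fst X \<Longrightarrow> f (snd X g x) = snd Y g (f x)"
    using assms(1) by (rule gset_isoE) auto
  let ?h = "inv_into (fst X) f"
  have h: "?h y \<in> fst X" "f (?h y) = y" if "y \<in> fst Y" for y
    using that f(1) by (auto simp: bij_betw_def f_inv_into_f inv_into_into)
  show ?thesis
  proof (rule gset_isoI[of _ ?h])
    fix g y assume g: "g \<in> carrier G" "y \<in> fst Y"
    have "snd Y g y = f (snd X g (?h y))" using f(2) g h by simp
    thus "?h (snd Y g y) = snd X g (?h y)"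
      using f(1) g h finite_gsetD(2)[OF assms(2)] by (simp add: bij_betw_def)
  qed (use assms f bij_betw_inv_into in auto)
qed

lemma gset_iso_trans:
  assumes "gset_iso G X Y" "gset_iso G Y Z" "finite_gset G X"
  shows "gset_iso G X Z"
proof -
  obtain f where f: "bij_betw f (fst X) (fst Y)"
    "\<And>g x. g \<in> carrier G \<Longrightarrow> x \<in> fst X \<Longrightarrow> f (snd X g x) = snd Y g (f x)"
    using assms(1) by (rule gset_isoE) auto
  obtain h where h: "bij_betw h (fst Y) (fst Z)"
    "\<And>g x. g \<in> carrier G \<Longrightarrow> x \<in> fst Y \<Longrightarrow> h (snd Y g x) = snd Z g (h x)"
    using assms(2) by (rule gset_isoE) auto
  show ?thesis
    by (rule gset_isoI[of _ "h \<circ> f"])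
      (use assms f h bij_betw_trans[OF f(1) h(1)] bij_betwE[OF f(1)] in auto)
qed

lemma finite_gset_transport:
  assumes X: "finite_gset G X" and f: "bij_betw f (fst X) Y"
  defines "Z \<equiv> (Y, \<lambda>g. \<lambda>y\<in>Y. f (snd X g (inv_into (fst X) f y)))"
  shows "finite_gset G Z" "gset_iso G X Z"
proof -
  let ?h = "inv_into (fst X) f"
  note X' = finite_gsetD[OF X]
  have h: "?h y \<in> fst X" "f (?h y) = y" if "y \<in> Y" for y
    using that f by (auto simp: bij_betw_def f_inv_into_f inv_into_into)
  have fh: "f x \<in> Y" "?h (f x) = x" if "x \<in> fst X" for x
    using that f by (auto simp: bij_betw_def)
  show "finite_gset G Z"
    using bij_betw_finite[OF f] X' by (intro finite_gsetI) (auto simp: Z_def fh h)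
  show "gset_iso G X Z"
    using f by (intro gset_isoI[OF X, of f]) (auto simp: Z_def fh)
qed

text \<open>\<open>iso_class\<close> collects only G-sets on natural numbers. This copy keeps the
  class of a G-set over another type, such as cosets or chains, from being empty.\<close>

lemma gset_nat_copy:
  assumes "finite_gset G X"
  obtains Y :: "('a, nat) gset" where "finite_gset G Y" "gset_iso G X Y"
proof -
  obtain h where "bij_betw h (fst X) {0..<card (fst X)}"
    using ex_bij_betw_finite_nat[OF finite_gsetD(1)[OF assms]] by blast
  from finite_gset_transport[OF assms this] show thesis by (rule that)
qed

lemma iso_class_cong:
  assumes "gset_iso G X Y" "finite_gset G X" "finite_gset G Y"
  shows "iso_class G X = iso_class G Y"
  unfolding iso_class_def
proof (intro Collect_cong conj_cong refl iffI)
  fix Z :: "('a, nat) gset"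
  show "gset_iso G Y Z" if "gset_iso G X Z"
    using gset_iso_trans[OF gset_iso_sym[OF assms] that assms(3)] .
  show "gset_iso G X Z" if "gset_iso G Y Z"
    using gset_iso_trans[OF assms(1) that assms(2)] .
qed

lemma iso_class_memD:
  assumes "X' \<in> iso_class G X" "finite_gset G X"
  shows "finite_gset G X'" "gset_iso G X X'" "gset_iso G X' X" "iso_class G X' = iso_class G X"
proof -
  show *: "finite_gset G X'" "gset_iso G X X'" using assms by (simp_all add: iso_class_def)
  show **: "gset_iso G X' X" by (rule gset_iso_sym[OF *(2) assms(2) *(1)])
  show "iso_class G X' = iso_class G X" by (rule iso_class_cong[OF ** *(1) assms(2)])
qed

lemma iso_class_nonempty:
  assumes "finite_gset G X" obtains Y where "Y \<in> iso_class G X"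
proof -
  obtain Y :: "('a, nat) gset" where "finite_gset G Y" "gset_iso G X Y"
    using assms by (rule gset_nat_copy)
  thus thesis by (intro that[of Y]) (simp add: iso_class_def)
qed

lemma iso_class_closed: "finite_gset G X \<Longrightarrow> iso_class G X \<in> carrier (gset_semiring G)"
proof -
  assume X: "finite_gset G X"
  obtain Y :: "('a, nat) gset" where Y: "finite_gset G Y" "gset_iso G X Y"
    using X by (rule gset_nat_copy)
  with X have "iso_class G X = iso_class G Y" by (simp add: iso_class_cong)
  with Y show "iso_class G X \<in> carrier (gset_semiring G)" by (cases Y) (auto simp: gset_semiring_def)
qed

lemma gset_semiring_carrierE:
  assumes "A \<in> carrier (gset_semiring G)"
  obtains X :: "('a, nat) gset" where "finite_gset G X" "A = iso_class G X"
  using assms by (auto simp: gset_semiring_def)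

lemma finite_gset_prod:
  assumes "finite_gset G X" "finite_gset G Y" shows "finite_gset G (gset_prod X Y)"
  using finite_gsetD[OF assms(1)] finite_gsetD[OF assms(2)]
  by (intro finite_gsetI) (auto simp: gset_prod_def)

lemma finite_gset_sum:
  assumes "finite_gset G X" "finite_gset G Y" shows "finite_gset G (gset_sum X Y)"
  using finite_gsetD[OF assms(1)] finite_gsetD[OF assms(2)]
  by (intro finite_gsetI) (auto simp: gset_sum_def)

lemma gset_prod_cong:
  assumes "gset_iso G X X'" "gset_iso G Y Y'" "finite_gset G X" "finite_gset G Y"
  shows "gset_iso G (gset_prod X Y) (gset_prod X' Y')"
proof -
  obtain f where f: "bij_betw f (fst X) (fst X')"
    "\<And>g x. g \<in> carrier G \<Longrightarrow> x \<in> fst X \<Longrightarrow> f (snd X g x) = snd X' g (f x)"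
    using assms(1) by (rule gset_isoE) auto
  obtain h where h: "bij_betw h (fst Y) (fst Y')"
    "\<And>g x. g \<in> carrier G \<Longrightarrow> x \<in> fst Y \<Longrightarrow> h (snd Y g x) = snd Y' g (h x)"
    using assms(2) by (rule gset_isoE) auto
  have "bij_betw (map_prod f h) (fst X \<times> fst Y) (fst X' \<times> fst Y')"
    using f(1) h(1) by (rule bij_betw_map_prod)
  thus ?thesis
    using f h assms bij_betwE[OF f(1)] bij_betwE[OF h(1)]
    by (intro gset_isoI[OF finite_gset_prod, of _ _ "map_prod f h"]) (auto simp: gset_prod_def)
qed

lemma gset_sum_cong:
  assumes "gset_iso G X X'" "gset_iso G Y Y'" "finite_gset G X" "finite_gset G Y"
  shows "gset_iso G (gset_sum X Y) (gset_sum X' Y')"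
proof -
  obtain f where f: "bij_betw f (fst X) (fst X')"
    "\<And>g x. g \<in> carrier G \<Longrightarrow> x \<in> fst X \<Longrightarrow> f (snd X g x) = snd X' g (f x)"
    using assms(1) by (rule gset_isoE) auto
  obtain h where h: "bij_betw h (fst Y) (fst Y')"
    "\<And>g x. g \<in> carrier G \<Longrightarrow> x \<in> fst Y \<Longrightarrow> h (snd Y g x) = snd Y' g (h x)"
    using assms(2) by (rule gset_isoE) auto
  have "inj_on (map_sum f h) (Sum_Type.Plus (fst X) (fst Y))"
    using f(1) h(1) by (intro inj_onI) (auto simp: bij_betw_def dest: inj_onD)
  moreover have "map_sum f h ` (Sum_Type.Plus (fst X) (fst Y)) = Sum_Type.Plus (fst X') (fst Y')"
  proof -
    have "map_sum f h ` Sum_Type.Plus (fst X) (fst Y) = Inl ` (f ` fst X) \<union> Inr ` (h ` fst Y)"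
      by (simp add: Sum_Type.Plus_def image_Un image_image)
    thus ?thesis using f(1) h(1) by (simp add: bij_betw_def Sum_Type.Plus_def)
  qed
  ultimately have "bij_betw (map_sum f h) (Sum_Type.Plus (fst X) (fst Y)) (Sum_Type.Plus (fst X') (fst Y'))"
    by (simp add: bij_betw_def)
  thus ?thesis
    using f h assms bij_betwE[OF f(1)] bij_betwE[OF h(1)]
    by (intro gset_isoI[OF finite_gset_sum, of _ _ "map_sum f h"]) (auto simp: gset_sum_def)
qed

text \<open>The product of classes is a union over representatives. Compatibility with isomorphism
  makes all members of the union equal, and since classes are nonempty the union is that common
  value.\<close>

lemma iso_class_mult:
  assumes "finite_gset G X" "finite_gset G Y"
  shows "iso_class G X \<otimes>\<^bsub>gset_semiring G\<^esub> iso_class G Y = iso_class G (gset_prod X Y)"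
proof -
  have "iso_class G (gset_prod X' Y') = iso_class G (gset_prod X Y)"
    if "X' \<in> iso_class G X" "Y' \<in> iso_class G Y" for X' Y'
    using iso_class_memD[OF that(1) assms(1)] iso_class_memD[OF that(2) assms(2)] assms
    by (intro iso_class_cong gset_prod_cong finite_gset_prod)
  moreover obtain X0 Y0 where "X0 \<in> iso_class G X" "Y0 \<in> iso_class G Y"
    using iso_class_nonempty assms by metis
  ultimately show ?thesis by (auto simp: gset_semiring_def)
qed

lemma iso_class_add:
  assumes "finite_gset G X" "finite_gset G Y"
  shows "iso_class G X \<oplus>\<^bsub>gset_semiring G\<^esub> iso_class G Y = iso_class G (gset_sum X Y)"
proof -
  have "iso_class G (gset_sum X' Y') = iso_class G (gset_sum X Y)"
    if "X' \<in> iso_class G X" "Y' \<in> iso_class G Y" for X' Y'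
    using iso_class_memD[OF that(1) assms(1)] iso_class_memD[OF that(2) assms(2)] assms
    by (intro iso_class_cong gset_sum_cong finite_gset_sum)
  moreover obtain X0 Y0 where "X0 \<in> iso_class G X" "Y0 \<in> iso_class G Y"
    using iso_class_nonempty assms by metis
  ultimately show ?thesis by (auto simp: gset_semiring_def)
qed

lemma finite_gset_point: "finite_gset G ({0 :: nat}, \<lambda>g. \<lambda>x\<in>{0}. x)"
  by (rule finite_gsetI) auto

lemma gset_semiring_one: "\<one>\<^bsub>gset_semiring G\<^esub> = iso_class G ({0 :: nat}, \<lambda>g. \<lambda>x\<in>{0}. x)"
  by (simp add: gset_semiring_def)

lemma gset_prod_assoc:
  assumes "finite_gset G X" "finite_gset G Y" "finite_gset G Z"
  shows "gset_iso G (gset_prod (gset_prod X Y) Z) (gset_prod X (gset_prod Y Z))"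
  using assms
  by (intro gset_isoI[of _ "\<lambda>((x, y), z). (x, y, z)"] finite_gset_prod bij_betwI[where g = "\<lambda>(x, y, z). ((x, y), z)"])
    (auto simp: gset_prod_def finite_gsetD)

lemma gset_prod_comm:
  assumes "finite_gset G X" "finite_gset G Y"
  shows "gset_iso G (gset_prod X Y) (gset_prod Y X)"
  using assms
  by (intro gset_isoI[of _ prod.swap] finite_gset_prod bij_betwI[where g = prod.swap])
    (auto simp: gset_prod_def finite_gsetD)

lemma gset_prod_point:
  assumes "finite_gset G X"
  shows "gset_iso G (gset_prod ({0 :: nat}, \<lambda>g. \<lambda>x\<in>{0}. x) X) X"
  using assms finite_gset_point
  by (intro gset_isoI[of _ snd] finite_gset_prod bij_betwI[where g = "Pair 0"])
    (auto simp: gset_prod_def finite_gsetD)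

lemma gset_semiring_comm_monoid: "comm_monoid (gset_semiring G)"
proof (rule comm_monoidI)
  fix A B assume "A \<in> carrier (gset_semiring G)" "B \<in> carrier (gset_semiring G)"
  then obtain X Y :: "('a, nat) gset" where XY: "finite_gset G X" "A = iso_class G X"
    "finite_gset G Y" "B = iso_class G Y" by (auto elim!: gset_semiring_carrierE)
  show "A \<otimes>\<^bsub>gset_semiring G\<^esub> B \<in> carrier (gset_semiring G)"
    using XY by (simp add: iso_class_mult iso_class_closed finite_gset_prod)
  show "A \<otimes>\<^bsub>gset_semiring G\<^esub> B = B \<otimes>\<^bsub>gset_semiring G\<^esub> A"
    using XY by (simp add: iso_class_mult) (intro iso_class_cong gset_prod_comm finite_gset_prod)
  fix C assume "C \<in> carrier (gset_semiring G)"
  then obtain Z :: "('a, nat) gset" where Z: "finite_gset G Z" "C = iso_class G Z"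
    by (auto elim!: gset_semiring_carrierE)
  show "A \<otimes>\<^bsub>gset_semiring G\<^esub> B \<otimes>\<^bsub>gset_semiring G\<^esub> C = A \<otimes>\<^bsub>gset_semiring G\<^esub> (B \<otimes>\<^bsub>gset_semiring G\<^esub> C)"
    using XY Z by (simp add: iso_class_mult finite_gset_prod)
      (intro iso_class_cong gset_prod_assoc finite_gset_prod)
next
  fix A assume "A \<in> carrier (gset_semiring G)"
  then obtain X :: "('a, nat) gset" where X: "finite_gset G X" "A = iso_class G X"
    by (auto elim!: gset_semiring_carrierE)
  thus "\<one>\<^bsub>gset_semiring G\<^esub> \<otimes>\<^bsub>gset_semiring G\<^esub> A = A"
    by (simp add: gset_semiring_one iso_class_mult finite_gset_point)
      (intro iso_class_cong gset_prod_point finite_gset_prod finite_gset_point)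
qed (simp add: gset_semiring_one iso_class_closed finite_gset_point)

section \<open>Counting fixed points as a homomorphism of semirings\<close>

lemma card_fixed_points_iso:
  assumes "gset_iso G X Y" "H \<subseteq> carrier G" "finite_gset G X"
  shows "card (fixed_points X H) = card (fixed_points Y H)"
proof -
  obtain f where f: "bij_betw f (fst X) (fst Y)"
    "\<And>g x. g \<in> carrier G \<Longrightarrow> x \<in> fst X \<Longrightarrow> f (snd X g x) = snd Y g (f x)"
    using assms(1) by (rule gset_isoE) auto
  have "bij_betw f (fixed_points X H) (fixed_points Y H)"
    unfolding bij_betw_def
  proof
    show "inj_on f (fixed_points X H)"
      using f(1) by (auto simp: bij_betw_def fixed_points_def intro: inj_on_subset)
    have "f x = f (snd X h x) \<longleftrightarrow> x = snd X h x" if "h \<in> H" "x \<in> fst X" for h x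
      using f(1) that assms(2) finite_gsetD(2)[OF assms(3)] by (auto simp: bij_betw_def inj_on_def)
    moreover have "fst Y = f ` fst X" using f(1) by (simp add: bij_betw_def)
    moreover have "f (snd X h x) = snd Y h (f x)" if "h \<in> H" "x \<in> fst X" for h x
      using f(2) that assms(2) by blast
    ultimately show "f ` fixed_points X H = fixed_points Y H"
      by (auto simp: fixed_points_def image_iff) (metis+)
  qed
  thus ?thesis by (rule bij_betw_same_card)
qed

lemma card_fixed_points_prod:
  "card (fixed_points (gset_prod X Y) H) = card (fixed_points X H) * card (fixed_points Y H)"
proof -
  have "fixed_points (gset_prod X Y) H = fixed_points X H \<times> fixed_points Y H"
    by (auto simp: fixed_points_def gset_prod_def)
  thus ?thesis by (simp add: card_cartesian_product)
qed

lemma card_fixed_points_sum: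
  assumes "finite_gset G X" "finite_gset G Y"
  shows "card (fixed_points (gset_sum X Y) H) = card (fixed_points X H) + card (fixed_points Y H)"
proof -
  have "fixed_points (gset_sum X Y) H = Sum_Type.Plus (fixed_points X H) (fixed_points Y H)"
    by (auto simp: fixed_points_def gset_sum_def)
  moreover have "finite (fixed_points X H)" "finite (fixed_points Y H)"
    using assms[THEN finite_gsetD(1)] by (auto simp: fixed_points_def)
  ultimately show ?thesis by (simp add: card_Plus)
qed

definition class_fix :: "'a set \<Rightarrow> 'a iso_class \<Rightarrow> nat" where
  "class_fix H A = card (fixed_points (SOME X. X \<in> A) H)"

lemma class_fix_iso_class:
  assumes "finite_gset G X" "H \<subseteq> carrier G"
  shows "class_fix H (iso_class G X) = card (fixed_points X H)"
proof -
  have "(SOME Y. Y \<in> iso_class G X) \<in> iso_class G X"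
    using iso_class_nonempty[OF assms(1)] by (metis someI)
  from card_fixed_points_iso[OF iso_class_memD(2)[OF this assms(1)] assms(2,1)]
  show ?thesis by (simp add: class_fix_def)
qed

text \<open>Taking fixed points commutes with disjoint unions and products. Together with
  \<open>class_fix_one\<close> this is what \<open>ext_hom\<close> asks for to extend the count to
  the Burnside rings.\<close>

lemma class_fix_hom:
  assumes "H \<subseteq> carrier G" "A \<in> carrier (gset_semiring G)" "B \<in> carrier (gset_semiring G)"
  shows "class_fix H (A \<oplus>\<^bsub>gset_semiring G\<^esub> B) = class_fix H A + class_fix H B"
    and "class_fix H (A \<otimes>\<^bsub>gset_semiring G\<^esub> B) = class_fix H A * class_fix H B"
proof -
  obtain X Y :: "('a, nat) gset" where XY: "finite_gset G X" "A = iso_class G X"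
    "finite_gset G Y" "B = iso_class G Y" using assms by (auto elim!: gset_semiring_carrierE)
  show "class_fix H (A \<oplus>\<^bsub>gset_semiring G\<^esub> B) = class_fix H A + class_fix H B"
    using XY assms(1) by (simp add: iso_class_add class_fix_iso_class finite_gset_sum card_fixed_points_sum)
  show "class_fix H (A \<otimes>\<^bsub>gset_semiring G\<^esub> B) = class_fix H A * class_fix H B"
    using XY assms(1) by (simp add: iso_class_mult class_fix_iso_class finite_gset_prod card_fixed_points_prod)
qed

lemma class_fix_one:
  assumes "H \<subseteq> carrier G"
  shows "class_fix H \<one>\<^bsub>gset_semiring G\<^esub> = 1"
proof -
  have "fixed_points ({0 :: nat}, \<lambda>g. \<lambda>x\<in>{0}. x) H = {0}" by (auto simp: fixed_points_def)
  thus "class_fix H \<one>\<^bsub>gset_semiring G\<^esub> = 1"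
    using assms(1) by (simp add: gset_semiring_one class_fix_iso_class finite_gset_point)
qed

end

subsection \<open>The Burnside ring and its marks\<close>

locale finite_group = group +
  assumes finite_carrier: "finite (carrier G)"
begin

text \<open>The \<open>rewrites\<close> clause replaces the generic \<open>ES\<close> by the named
  ring, so that facts with prefix \<open>Z\<close> speak about \<open>Burnside_int G\<close> and, in
  the next step, those with prefix \<open>B\<close> about \<open>\<Omega> G\<close>.\<close>

sublocale Z: scalar_extension "gset_semiring G" "TYPE(int)"
  rewrites "scalar_extension.ES (gset_semiring G) = Burnside_int G"
proof -
  interpret M: comm_monoid "gset_semiring G" by (rule gset_semiring_comm_monoid)
  show *: "scalar_extension (gset_semiring G)"
  proof
    fix A B assume "A \<in> carrier (gset_semiring G)" "B \<in> carrier (gset_semiring G)"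
    thus "A \<oplus>\<^bsub>gset_semiring G\<^esub> B \<in> carrier (gset_semiring G)"
      by (auto elim!: gset_semiring_carrierE simp: iso_class_add iso_class_closed finite_gset_sum)
  qed
  show "scalar_extension.ES (gset_semiring G) = Burnside_int G"
    by (simp add: scalar_extension.ES_def[OF *] Burnside_int_def)
qed

sublocale B: scalar_extension "Burnside_int G" "TYPE(rat)"
  rewrites "scalar_extension.ES (Burnside_int G) = \<Omega> G"
proof -
  show *: "scalar_extension (Burnside_int G)"
    by unfold_locales auto
  show "scalar_extension.ES (Burnside_int G) = \<Omega> G"
    by (simp add: scalar_extension.ES_def[OF *] Burnside_def)
qed

lemma gclass_closed [simp]: "finite_gset G X \<Longrightarrow> gclass G X \<in> carrier (\<Omega> G)"
  by (simp add: gclass_def iso_class_closed)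

lemma gclass_iso: "\<lbrakk>gset_iso G X Y; finite_gset G X; finite_gset G Y\<rbrakk> \<Longrightarrow> gclass G X = gclass G Y"
  by (simp add: gclass_def iso_class_cong)

lemma gclass_sum:
  "\<lbrakk>finite_gset G X; finite_gset G Y\<rbrakk> \<Longrightarrow> gclass G (gset_sum X Y) = gclass G X \<oplus>\<^bsub>\<Omega> G\<^esub> gclass G Y"
  by (simp add: gclass_def iso_class_closed Z.tensor_add_1 B.tensor_add_1 flip: iso_class_add)

text \<open>An element of \<open>\<Omega> G\<close> is built from nested tensors, an integer one
  inside a rational one. The work is to turn the inner integer into an outer scalar, by additivity
  for natural numbers and by negation for the rest.\<close>

lemma Burnside_induct_gclass [consumes 1, case_names gclass smult add]:
  assumes "x \<in> carrier (\<Omega> G)"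
    and g: "\<And>X :: ('a, nat) gset. finite_gset G X \<Longrightarrow> P (gclass G X)"
    and s: "\<And>c x. x \<in> carrier (\<Omega> G) \<Longrightarrow> P x \<Longrightarrow> P (c \<odot>\<^bsub>\<Omega> G\<^esub> x)"
    and a: "\<And>x y. x \<in> carrier (\<Omega> G) \<Longrightarrow> y \<in> carrier (\<Omega> G) \<Longrightarrow> P x \<Longrightarrow> P y \<Longrightarrow> P (x \<oplus>\<^bsub>\<Omega> G\<^esub> y)"
  shows "P x"
  using assms(1)
proof (induction rule: B.ES_induct)
  case (smult_tensor r c)
  from smult_tensor have "P (tensor (Burnside_int G) 1 r)"
  proof (induction rule: Z.ES_induct)
    case (smult_tensor A n)
    let ?t = "\<lambda>n. tensor (Burnside_int G) (1::rat) (tensor (gset_semiring G) n A)"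
    obtain X :: "('a, nat) gset" where X: "finite_gset G X" "A = iso_class G X"
      using smult_tensor by (rule gset_semiring_carrierE)
    have t: "?t n \<in> carrier (\<Omega> G)" for n using smult_tensor by simp
    have t1: "?t 1 = gclass G X" by (simp add: gclass_def X)
    have add: "?t (n + m) = ?t n \<oplus>\<^bsub>\<Omega> G\<^esub> ?t m" for n m
      using smult_tensor by (simp add: Z.tensor_add_scalar B.tensor_add_1)
    \<comment> \<open>This element is its own double, hence zero. Zero is written as a scalar
      multiple of a class so that the closure rule for scalars yields the base case of the induction
      on natural numbers.\<close>
    have t0: "?t 0 = 0 \<odot>\<^bsub>\<Omega> G\<^esub> gclass G X"
    proof -
      have "?t 0 \<oplus>\<^bsub>\<Omega> G\<^esub> ?t 0 = ?t 0" using add[of 0 0] by simp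
      thus ?thesis using t[of 0] X B.ES.add.l_cancel_one[of "?t 0" "?t 0"]
        by (simp add: B.smult_distr)
    qed
    have neg: "?t (- n) = (- 1) \<odot>\<^bsub>\<Omega> G\<^esub> ?t n" for n
    proof -
      have "?t (- n) \<oplus>\<^bsub>\<Omega> G\<^esub> ?t n = \<zero>\<^bsub>\<Omega> G\<^esub>"
        using add[of "- n" n] t0 X by (simp add: B.smult_distr)
      hence 1: "\<ominus>\<^bsub>\<Omega> G\<^esub> ?t n = ?t (- n)" by (intro B.ES.minus_equality t)
      have "(- 1) \<odot>\<^bsub>\<Omega> G\<^esub> ?t n \<oplus>\<^bsub>\<Omega> G\<^esub> ?t n = \<zero>\<^bsub>\<Omega> G\<^esub>"
        using B.smult_distr(1)[OF t, of "- 1" 1 n] by (simp add: B.smult_distr(4,5)[OF t])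
      hence "\<ominus>\<^bsub>\<Omega> G\<^esub> ?t n = (- 1) \<odot>\<^bsub>\<Omega> G\<^esub> ?t n" by (intro B.ES.minus_equality B.smult_closed t)
      with 1 show ?thesis by simp
    qed
    have P1: "P (?t 1)" unfolding t1 by (rule g[OF X(1)])
    have nat: "P (?t (int m))" for m
    proof (induction m)
      case 0 thus ?case using s[OF gclass_closed[OF X(1)] g[OF X(1)], of 0] by (simp add: t0)
    next
      case (Suc m)
      have "P (?t (int m + 1))" unfolding add by (rule a[OF t t Suc P1])
      thus ?case by (simp add: add.commute)
    qed
    have "P (?t n)"
    proof (cases "n \<ge> 0")
      case True thus ?thesis using nat[of "nat n"] by simp
    next
      case False
      have "P (?t (- int (nat (- n))))" unfolding neg by (rule s[OF t nat])
      thus ?thesis using False by simp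
    qed
    thus ?case using smult_tensor by (simp add: Z.smult_tensor)
  next
    case (add x y)
    thus ?case by (simp add: B.tensor_add_1 a)
  qed
  thus ?case using smult_tensor by (intro s) auto
qed (rule a)

section \<open>Marks as twofold extensions of fixed-point counts\<close>

definition int_mark :: "'a set \<Rightarrow> 'a int_burnside \<Rightarrow> int" where
  "int_mark H = Z.ext_hom (\<lambda>A. int (class_fix H A))"

context
  fixes H assumes H: "H \<subseteq> carrier G"
begin

private lemma int_mark:
  "A \<in> carrier (gset_semiring G) \<Longrightarrow> int_mark H (tensor (gset_semiring G) c A) = c * int (class_fix H A)"
  "\<lbrakk>x \<in> carrier (Burnside_int G); y \<in> carrier (Burnside_int G)\<rbrakk> \<Longrightarrow>
    int_mark H (x \<oplus>\<^bsub>Burnside_int G\<^esub> y) = int_mark H x + int_mark H y"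
  "\<lbrakk>x \<in> carrier (Burnside_int G); y \<in> carrier (Burnside_int G)\<rbrakk> \<Longrightarrow>
    int_mark H (x \<otimes>\<^bsub>Burnside_int G\<^esub> y) = int_mark H x * int_mark H y"
  "int_mark H \<one>\<^bsub>Burnside_int G\<^esub> = 1"
  unfolding int_mark_def
  by (subst Z.ext_hom_tensor Z.ext_hom_add Z.ext_hom_mult Z.ext_hom_one; simp add: class_fix_hom[OF H] class_fix_one[OF H])+

private definition rmark :: "'a burnside \<Rightarrow> rat" where
  "rmark = B.ext_hom (\<lambda>x. of_int (int_mark H x))"

private lemma rmark:
  "b \<in> carrier (Burnside_int G) \<Longrightarrow> rmark (tensor (Burnside_int G) c b) = c * of_int (int_mark H b)"
  "\<lbrakk>x \<in> carrier (\<Omega> G); y \<in> carrier (\<Omega> G)\<rbrakk> \<Longrightarrow> rmark (x \<oplus>\<^bsub>\<Omega> G\<^esub> y) = rmark x + rmark y"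
  "\<lbrakk>x \<in> carrier (\<Omega> G); y \<in> carrier (\<Omega> G)\<rbrakk> \<Longrightarrow> rmark (x \<otimes>\<^bsub>\<Omega> G\<^esub> y) = rmark x * rmark y"
  "rmark \<one>\<^bsub>\<Omega> G\<^esub> = 1"
  "x \<in> carrier (\<Omega> G) \<Longrightarrow> rmark (d \<odot>\<^bsub>\<Omega> G\<^esub> x) = d * rmark x"
  unfolding rmark_def
  by (subst B.ext_hom_tensor B.ext_hom_add B.ext_hom_mult B.ext_hom_one B.ext_hom_smult; simp add: int_mark)+

private lemma rmark_gclass: "finite_gset G X \<Longrightarrow> rmark (gclass G X) = of_nat (card (fixed_points X H))"
  by (simp add: gclass_def rmark int_mark iso_class_closed class_fix_iso_class H)

text \<open>Uniqueness holds because a linear map is determined by its values on the spanning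
  classes of G-sets; the restriction matches the extensionality demanded by
  \<open>mark\<close>.\<close>

private lemma mark_rmark: "mark G H = restrict rmark (carrier (\<Omega> G))"
  unfolding mark_def
proof (rule the_equality)
  fix m assume m: "m \<in> extensional (carrier (\<Omega> G)) \<and> burnside_linear G m \<and>
     (\<forall>X :: ('a, nat) gset. finite_gset G X \<longrightarrow> m (gclass G X) = of_nat (card (fixed_points X H)))"
  have "m x = rmark x" if "x \<in> carrier (\<Omega> G)" for x
    using that by (induction rule: Burnside_induct_gclass)
      (use m in \<open>auto simp: burnside_linear_def rmark rmark_gclass\<close>)
  thus "m = restrict rmark (carrier (\<Omega> G))"
    using m by (intro extensionalityI[where A = "carrier (\<Omega> G)"]) auto
qed (auto simp: burnside_linear_def rmark rmark_gclass B.smult_closed)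

lemma mark_gclass: "finite_gset G X \<Longrightarrow> mark G H (gclass G X) = of_nat (card (fixed_points X H))"
  and mark_add: "\<lbrakk>x \<in> carrier (\<Omega> G); y \<in> carrier (\<Omega> G)\<rbrakk> \<Longrightarrow>
    mark G H (x \<oplus>\<^bsub>\<Omega> G\<^esub> y) = mark G H x + mark G H y"
  and mark_mult: "\<lbrakk>x \<in> carrier (\<Omega> G); y \<in> carrier (\<Omega> G)\<rbrakk> \<Longrightarrow>
    mark G H (x \<otimes>\<^bsub>\<Omega> G\<^esub> y) = mark G H x * mark G H y"
  and mark_smult: "x \<in> carrier (\<Omega> G) \<Longrightarrow> mark G H (c \<odot>\<^bsub>\<Omega> G\<^esub> x) = c * mark G H x"
  by (simp_all add: mark_rmark rmark_gclass rmark B.smult_closed)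

lemma mark_zero: "mark G H \<zero>\<^bsub>\<Omega> G\<^esub> = 0"
  using mark_add[of "\<zero>\<^bsub>\<Omega> G\<^esub>" "\<zero>\<^bsub>\<Omega> G\<^esub>"] by simp

lemma mark_minus: "\<lbrakk>x \<in> carrier (\<Omega> G); y \<in> carrier (\<Omega> G)\<rbrakk> \<Longrightarrow>
    mark G H (x \<ominus>\<^bsub>\<Omega> G\<^esub> y) = mark G H x - mark G H y"
  using mark_add[of "x \<ominus>\<^bsub>\<Omega> G\<^esub> y" y]
  by simp (simp add: a_minus_def B.ES.a_assoc B.ES.l_neg)

lemma mark_finsum:
  "\<lbrakk>finite I; \<And>i. i \<in> I \<Longrightarrow> f i \<in> carrier (\<Omega> G)\<rbrakk> \<Longrightarrow>
    mark G H (\<Oplus>\<^bsub>\<Omega> G\<^esub>i\<in>I. f i) = (\<Sum>i\<in>I. mark G H (f i))"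
proof (induction I rule: finite_induct)
  case (insert i I)
  hence f: "f \<in> I \<rightarrow> carrier (\<Omega> G)" "f i \<in> carrier (\<Omega> G)" by auto
  hence "mark G H (\<Oplus>\<^bsub>\<Omega> G\<^esub>i\<in>insert i I. f i) = mark G H (f i \<oplus>\<^bsub>\<Omega> G\<^esub> (\<Oplus>\<^bsub>\<Omega> G\<^esub>i\<in>I. f i))"
    using insert by (subst B.ES.finsum_insert) auto
  also have "\<dots> = mark G H (f i) + mark G H (\<Oplus>\<^bsub>\<Omega> G\<^esub>i\<in>I. f i)"
    using f by (intro mark_add B.ES.finsum_closed) auto
  finally show ?case using insert by simp
qed (simp add: mark_zero)

end

end

subsection \<open>Conjugation\<close>

context group
begin

lemma subgroup_conj_set: "\<lbrakk>subgroup H G; g \<in> carrier G\<rbrakk> \<Longrightarrow> subgroup (conj_set G g H) G"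
  unfolding conj_set_def by (rule subgroup_conjugation_is_surj2)

lemma conj_set_inv:
  assumes "H \<subseteq> carrier G" "g \<in> carrier G"
  shows "conj_set G (inv g) (conj_set G g H) = H"
  using assms by (simp add: conj_map_one(2) flip: conj_set_mult)

lemma card_conj_set:
  assumes "H \<subseteq> carrier G" "g \<in> carrier G"
  shows "card (conj_set G g H) = card H"
  unfolding conj_set_eq
proof (intro card_image inj_onI)
  fix x y assume "x \<in> H" "y \<in> H" and e: "g \<otimes> x \<otimes> inv g = g \<otimes> y \<otimes> inv g"
  hence "x \<in> carrier G" "y \<in> carrier G" using assms(1) by auto
  thus "x = y" using e assms(2) by simp
qed

lemma mem_conj_set_iff:
  assumes "H \<subseteq> carrier G" "g \<in> carrier G" "x \<in> carrier G"
  shows "x \<in> conj_set G g H \<longleftrightarrow> inv g \<otimes> x \<otimes> g \<in> H"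
proof
  assume "x \<in> conj_set G g H"
  then obtain h where "h \<in> H" "x = g \<otimes> h \<otimes> inv g" by (auto simp: conj_set_eq)
  moreover have "inv g \<otimes> (g \<otimes> h \<otimes> inv g) \<otimes> g = h" if "h \<in> carrier G"
    using assms that by (simp add: m_assoc) (simp flip: m_assoc)
  ultimately show "inv g \<otimes> x \<otimes> g \<in> H" using assms(1) by auto
next
  assume "inv g \<otimes> x \<otimes> g \<in> H"
  moreover have "x = g \<otimes> (inv g \<otimes> x \<otimes> g) \<otimes> inv g"
    using assms by (simp add: m_assoc) (simp flip: m_assoc)
  ultimately show "x \<in> conj_set G g H" unfolding conj_set_eq by blast
qed

lemma conjugate_in_sym: "\<lbrakk>subgroup H G; conjugate_in G H K\<rbrakk> \<Longrightarrow> conjugate_in G K H"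
  using conj_set_inv subgroup.subset unfolding conjugate_in_def by (metis inv_closed)

lemma conjugate_in_trans:
  assumes "subgroup H G" "conjugate_in G H K" "conjugate_in G K L"
  shows "conjugate_in G H L"
proof -
  obtain g h where "g \<in> carrier G" "h \<in> carrier G" "conj_set G g H = K" "conj_set G h K = L"
    using assms by (auto simp: conjugate_in_def)
  hence "conj_set G (h \<otimes> g) H = L"
    using assms(1) subgroup.subset by (subst conj_set_mult) auto
  thus ?thesis using \<open>g \<in> carrier G\<close> \<open>h \<in> carrier G\<close> by (auto simp: conjugate_in_def)
qed

lemma conjugate_in_refl: "subgroup H G \<Longrightarrow> conjugate_in G H H"
  unfolding conjugate_in_def using conj_map_one(2)[OF subgroup.subset] one_closed by blast

lemma card_conjugate_in: "\<lbrakk>subgroup H G; conjugate_in G H K\<rbrakk> \<Longrightarrow> card K = card H"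
  using card_conj_set[OF subgroup.subset] unfolding conjugate_in_def by blast

text \<open>\<open>x g K = g K\<close> means that \<open>inv g x g\<close> lies in \<open>K\<close>.
  All fixed-point counts on coset spaces come from this computation of stabilizers.\<close>

lemma coset_fixed_iff:
  assumes "subgroup K G" "g \<in> carrier G" "x \<in> carrier G"
  shows "x <# (g <# K) = g <# K \<longleftrightarrow> x \<in> conj_set G g K"
proof -
  have K: "K \<subseteq> carrier G" using assms(1) by (rule subgroup.subset)
  have "x <# (g <# K) = (x \<otimes> g) <# K" using assms K by (simp add: lcos_m_assoc)
  also have "\<dots> = g <# K \<longleftrightarrow> inv g \<otimes> (x \<otimes> g) \<in> K"
  proof
    assume "(x \<otimes> g) <# K = g <# K"
    hence "x \<otimes> g \<in> g <# K" using lcos_self[OF _ assms(1), of "x \<otimes> g"] assms by simp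
    thus "inv g \<otimes> (x \<otimes> g) \<in> K" using subgroup.lcos_module_imp[OF assms(1) is_group] assms by simp
  next
    assume "inv g \<otimes> (x \<otimes> g) \<in> K"
    thus "(x \<otimes> g) <# K = g <# K" using lcos_eq_iff[OF assms(1), of g "x \<otimes> g"] assms by simp
  qed
  also have "\<dots> \<longleftrightarrow> x \<in> conj_set G g K" using assms K by (simp add: mem_conj_set_iff m_assoc)
  finally show ?thesis .
qed

lemma fixed_points_coset:
  assumes "subgroup K G" "g \<in> carrier G" "H \<subseteq> carrier G"
  shows "g <# K \<in> fixed_points (coset_gset G K) H \<longleftrightarrow> H \<subseteq> conj_set G g K"
proof -
  have "g <# K \<in> lcosets K" using assms by (auto simp: LCOSETS_def)
  thus ?thesis using assms coset_fixed_iff[OF assms(1,2)]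
    by (auto simp: fixed_points_def coset_gset_def subset_iff)
qed

end

subsection \<open>Transitive \<open>G\<close>-sets span the Burnside ring\<close>

context finite_group
begin

lemma finite_gset_coset: "subgroup H G \<Longrightarrow> finite_gset G (coset_gset G H)"
  by (rule coset_gset_finite_gset[OF finite_carrier])

lemma finite_sub: "subgroup H G \<Longrightarrow> finite H"
  using finite_carrier subgroup.subset finite_subset by metis

text \<open>The orbit-stabilizer correspondence, with the stabilizer \<open>S\<close> of the chosen
  point as the subgroup.\<close>

lemma transitive_gset_iso:
  assumes X: "finite_gset G X" and x: "x \<in> fst X" and tr: "\<And>y. y \<in> fst X \<Longrightarrow> \<exists>g\<in>carrier G. y = snd X g x"
  defines "S \<equiv> {g \<in> carrier G. snd X g x = x}"
  shows "subgroup S G" "gset_iso G (coset_gset G S) X"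
proof -
  note X' = finite_gsetD[OF X]
  show S: "subgroup S G"
  proof (rule subgroupI)
    show "S \<noteq> {}" using X' x by (auto simp: S_def)
    show "inv a \<in> S" if "a \<in> S" for a using that X'(5)[of a x] x by (auto simp: S_def)
  qed (use X' x in \<open>auto simp: S_def\<close>)
  \<comment> \<open>The coset of \<open>g\<close> goes to the point \<open>g x\<close>; the choice
    of a representative is harmless since \<open>S\<close> fixes \<open>x\<close>.\<close>
  define f where "f C = snd X (SOME g. g \<in> C) x" for C
  have f: "f (g <# S) = snd X g x" if g: "g \<in> carrier G" for g
  proof -
    have "(SOME a. a \<in> g <# S) \<in> g <# S" by (rule someI[of _ g]) (rule lcos_self[OF g S])
    then obtain s where "s \<in> S" "(SOME a. a \<in> g <# S) = g \<otimes> s" by (auto simp: l_coset_def)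
    thus ?thesis using g x X' by (simp add: f_def S_def)
  qed
  have eq: "a <# S = b <# S" if "a \<in> carrier G" "b \<in> carrier G" "snd X a x = snd X b x" for a b
  proof (rule lcos_eq_iff[OF S that(1,2)])
    have "snd X (inv a \<otimes> b) x = snd X (inv a) (snd X b x)" using that x X' by simp
    also have "\<dots> = x" using that x X'(5)[of a x] by simp
    finally show "inv a \<otimes> b \<in> S" using that by (simp add: S_def)
  qed
  show "gset_iso G (coset_gset G S) X"
  proof (rule gset_isoI[OF finite_gset_coset[OF S], of f])
    have "inj_on f (lcosets S)"
    proof (rule inj_onI)
      fix C D assume "C \<in> lcosets S" "D \<in> lcosets S" and e: "f C = f D"
      then obtain a b where "a \<in> carrier G" "C = a <# S" "b \<in> carrier G" "D = b <# S"
        by (auto simp: LCOSETS_def)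
      thus "C = D" using e eq[of a b] by (simp add: f)
    qed
    moreover have "f ` (lcosets S) = fst X"
    proof -
      have "lcosets S = (\<lambda>a. a <# S) ` carrier G" by (auto simp: LCOSETS_def)
      hence "f ` (lcosets S) = (\<lambda>a. snd X a x) ` carrier G" by (simp add: image_image f)
      also have "\<dots> = fst X" using tr X'(2) x by blast
      finally show ?thesis .
    qed
    ultimately show "bij_betw f (fst (coset_gset G S)) (fst X)" by (simp add: bij_betw_def)
    fix g C assume g: "g \<in> carrier G" "C \<in> fst (coset_gset G S)"
    then obtain a where a: "a \<in> carrier G" "C = a <# S" by (auto simp: LCOSETS_def)
    have "snd (coset_gset G S) g C = (g \<otimes> a) <# S"
      using g a S by (simp add: coset_gset_def lcos_m_assoc subgroup.subset)
    thus "f (snd (coset_gset G S) g C) = snd X g (f C)" using g a x X' by (simp add: f)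
  qed
qed

lemma coset_gset_transitive:
  assumes "subgroup K G" "C \<in> lcosets K" "D \<in> lcosets K"
  shows "\<exists>g\<in>carrier G. D = snd (coset_gset G K) g C"
proof -
  obtain a b where ab: "a \<in> carrier G" "C = a <# K" "b \<in> carrier G" "D = b <# K"
    using assms by (auto simp: LCOSETS_def)
  have "(b \<otimes> inv a) <# (a <# K) = b <# K"
    using ab assms(1) by (simp add: lcos_m_assoc subgroup.subset m_assoc)
  thus ?thesis using ab assms(2) by (intro bexI[of _ "b \<otimes> inv a"]) (auto simp: coset_gset_def)
qed

text \<open>The orbit-stabilizer correspondence at the point \<open>g <# K\<close>, whose stabilizer
  is the conjugate of \<open>K\<close>.\<close>

lemma coset_gset_conj:
  assumes "subgroup K G" "g \<in> carrier G"
  shows "gset_iso G (coset_gset G (conj_set G g K)) (coset_gset G K)"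
proof -
  have c: "g <# K \<in> lcosets K" using assms by (auto simp: LCOSETS_def)
  have "{a \<in> carrier G. snd (coset_gset G K) a (g <# K) = g <# K} = conj_set G g K"
    using c assms coset_fixed_iff[OF assms] subgroup.subset[OF subgroup_conj_set[OF assms]]
    by (auto simp: coset_gset_def)
  with transitive_gset_iso(2)[OF finite_gset_coset[OF assms(1)], of "g <# K"] c
    coset_gset_transitive[OF assms(1) c] show ?thesis by simp
qed

lemma gclass_coset_conj:
  assumes "subgroup H G" "conjugate_in G H K"
  shows "gclass G (coset_gset G K) = gclass G (coset_gset G H)"
proof -
  obtain g where g: "g \<in> carrier G" "K = conj_set G g H" using assms by (auto simp: conjugate_in_def)
  show ?thesis unfolding g(2)
    by (intro gclass_iso coset_gset_conj finite_gset_coset subgroup_conj_set assms g(1))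
qed

text \<open>Two copies of the empty set are empty again, so the class is its own double. Any
  function, here \<open>undefined\<close>, is a bijection between empty sets.\<close>

lemma gclass_empty:
  assumes "finite_gset G X" "fst X = {}"
  shows "gclass G X = \<zero>\<^bsub>\<Omega> G\<^esub>"
proof -
  have "gclass G (gset_sum X X) = gclass G X"
    using assms by (intro gclass_iso finite_gset_sum gset_isoI[of _ undefined]) (auto simp: gset_sum_def bij_betw_def Sum_Type.Plus_def)
  hence "gclass G X \<oplus>\<^bsub>\<Omega> G\<^esub> gclass G X = gclass G X" using assms by (simp add: gclass_sum)
  thus ?thesis using assms B.ES.add.l_cancel_one[of "gclass G X" "gclass G X"] by simp
qed

definition sub_gset :: "('a, 'x) gset \<Rightarrow> 'x set \<Rightarrow> ('a, 'x) gset" where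
  "sub_gset X A = (A, \<lambda>g. restrict (snd X g) A)"

lemma finite_sub_gset:
  assumes "finite_gset G X" "A \<subseteq> fst X" "\<And>g x. g \<in> carrier G \<Longrightarrow> x \<in> A \<Longrightarrow> snd X g x \<in> A"
  shows "finite_gset G (sub_gset X A)"
  using finite_gsetD[OF assms(1)] assms(2,3) finite_subset[OF assms(2)]
  by (intro finite_gsetI) (auto simp: sub_gset_def subset_iff)

lemma gclass_split:
  assumes X: "finite_gset G X" and A: "A \<subseteq> fst X" "\<And>g x. g \<in> carrier G \<Longrightarrow> x \<in> A \<Longrightarrow> snd X g x \<in> A"
  shows "finite_gset G (sub_gset X A)" "finite_gset G (sub_gset X (fst X - A))"
    "gclass G X = gclass G (sub_gset X A) \<oplus>\<^bsub>\<Omega> G\<^esub> gclass G (sub_gset X (fst X - A))"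
proof -
  note X' = finite_gsetD[OF X]
  have A': "snd X g x \<in> fst X - A" if "g \<in> carrier G" "x \<in> fst X - A" for g x
    using A(2)[of "inv g" "snd X g x"] X'(5)[of g x] X'(2)[of g x] that by auto
  show f: "finite_gset G (sub_gset X A)" "finite_gset G (sub_gset X (fst X - A))"
    using assms A' by (auto intro!: finite_sub_gset)
  have "gset_iso G (gset_sum (sub_gset X A) (sub_gset X (fst X - A))) X"
  proof (rule gset_isoI[OF finite_gset_sum[OF f], of "case_sum id id"])
    show "bij_betw (case_sum id id) (fst (gset_sum (sub_gset X A) (sub_gset X (fst X - A)))) (fst X)"
      using A(1) by (intro bij_betwI[where g = "\<lambda>x. if x \<in> A then Inl x else Inr x"])
        (auto simp: gset_sum_def sub_gset_def split: sum.splits)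
  qed (use A A' in \<open>auto simp: gset_sum_def sub_gset_def\<close>)
  thus "gclass G X = gclass G (sub_gset X A) \<oplus>\<^bsub>\<Omega> G\<^esub> gclass G (sub_gset X (fst X - A))"
    using f X by (simp flip: gclass_sum) (intro gclass_iso[symmetric] finite_gset_sum)
qed

text \<open>Decomposition into orbits: the orbit \<open>A\<close> of one point is transitive, hence
  a coset space, and its complement is smaller.\<close>

lemma gclass_induct [consumes 1, case_names zero coset add]:
  assumes X: "finite_gset G X" and z: "P \<zero>\<^bsub>\<Omega> G\<^esub>"
    and c: "\<And>H. subgroup H G \<Longrightarrow> P (gclass G (coset_gset G H))"
    and a: "\<And>x y. x \<in> carrier (\<Omega> G) \<Longrightarrow> y \<in> carrier (\<Omega> G) \<Longrightarrow> P x \<Longrightarrow> P y \<Longrightarrow> P (x \<oplus>\<^bsub>\<Omega> G\<^esub> y)"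
  shows "P (gclass G X)"
  using X
proof (induction "card (fst X)" arbitrary: X rule: less_induct)
  case less
  note X' = finite_gsetD[OF less.prems]
  show ?case
  proof (cases "fst X = {}")
    case True
    thus ?thesis using z less.prems by (simp add: gclass_empty)
  next
    case False
    then obtain x where x: "x \<in> fst X" by blast
    define A where "A = (\<lambda>g. snd X g x) ` carrier G"
    have A: "A \<subseteq> fst X" "x \<in> A" using X' x by (auto simp: A_def image_iff intro!: bexI[of _ \<one>])
    have A2: "snd X g y \<in> A" if "g \<in> carrier G" "y \<in> A" for g y
      using that x by (auto simp: A_def simp flip: X'(4))
    note sp = gclass_split[OF less.prems A(1) A2]
    have p2: "P (gclass G (sub_gset X (fst X - A)))"
      by (rule less.hyps[OF _ sp(2)]) (use X'(1) A x in \<open>auto simp: sub_gset_def intro!: psubset_card_mono\<close>)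
    have p1: "P (gclass G (sub_gset X A))"
    proof -
      have tr: "\<exists>g\<in>carrier G. y = snd (sub_gset X A) g x" if "y \<in> fst (sub_gset X A)" for y
        using that A(2) by (auto simp: sub_gset_def A_def)
      have xA: "x \<in> fst (sub_gset X A)" using A by (simp add: sub_gset_def)
      note t = transitive_gset_iso[OF sp(1) xA tr]
      show ?thesis using c[OF t(1)] gclass_iso[OF t(2) finite_gset_coset[OF t(1)] sp(1)] by simp
    qed
    from a[OF gclass_closed[OF sp(1)] gclass_closed[OF sp(2)] p1 p2]
    show ?thesis by (simp only: sp(3))
  qed
qed

text \<open>Acting by \<open>g\<close> carries the \<open>H\<close>-fixed points of a G-set onto
  those of the conjugate subgroup; the general case follows because classes of G-sets span.\<close>

lemma mark_conj:
  assumes "subgroup H G" "conjugate_in G H K" "x \<in> carrier (\<Omega> G)"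
  shows "mark G K x = mark G H x"
proof -
  obtain g where g: "g \<in> carrier G" "conj_set G g H = K" using assms by (auto simp: conjugate_in_def)
  have H: "H \<subseteq> carrier G" "K \<subseteq> carrier G"
    using assms(1) g(1) unfolding g(2)[symmetric] by (auto intro!: subgroup.subset subgroup_conj_set)
  have "card (fixed_points X K) = card (fixed_points X H)" if X: "finite_gset G X" for X :: "('a, nat) gset"
  proof -
    note X' = finite_gsetD[OF X]
    have "bij_betw (snd X g) (fixed_points X H) (fixed_points X K)"
    proof (rule bij_betwI[where g = "snd X (inv g)"])
      show "snd X g \<in> fixed_points X H \<rightarrow> fixed_points X K"
      proof
        fix x assume x: "x \<in> fixed_points X H"
        have "snd X (g \<otimes> h \<otimes> inv g) (snd X g x) = snd X g x" if "h \<in> H" for h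
        proof -
          have "h \<in> carrier G" using that H by blast
          thus ?thesis using x g X' that by (simp add: fixed_points_def)
        qed
        thus "snd X g x \<in> fixed_points X K"
          using x g X' by (auto simp: fixed_points_def conj_set_eq)
      qed
      show "snd X (inv g) \<in> fixed_points X K \<rightarrow> fixed_points X H"
      proof
        fix x assume x: "x \<in> fixed_points X K"
        have "snd X h (snd X (inv g) x) = snd X (inv g) x" if "h \<in> H" for h
        proof -
          have h: "h \<in> carrier G" "g \<otimes> h \<otimes> inv g \<in> K" using that H g by (auto simp: conj_set_eq)
          have xX: "x \<in> fst X" using x by (simp add: fixed_points_def)
          have "x = snd X (g \<otimes> h \<otimes> inv g) x"
            using x h by (simp add: fixed_points_def)
          also have "\<dots> = snd X g (snd X h (snd X (inv g) x))"
            using xX h(1) g(1) X'(2,4) by simp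
          finally have "snd X (inv g) x = snd X (inv g) (snd X g (snd X h (snd X (inv g) x)))" by simp
          also have "\<dots> = snd X h (snd X (inv g) x)" using xX h(1) g(1) X'(2,5) by simp
          finally show ?thesis by simp
        qed
        thus "snd X (inv g) x \<in> fixed_points X H"
          using x g X' by (auto simp: fixed_points_def)
      qed
    qed (use g X' in \<open>auto simp: fixed_points_def\<close>)
    thus ?thesis by (simp add: bij_betw_same_card)
  qed
  with assms(3) show ?thesis
    by (induction rule: Burnside_induct_gclass) (auto simp: mark_gclass mark_smult mark_add H)
qed

lemma mark_coset_nonzero:
  assumes "subgroup K G" "subgroup H G" "mark G H (gclass G (coset_gset G K)) \<noteq> 0"
  obtains g where "g \<in> carrier G" "H \<subseteq> conj_set G g K"
proof -
  have H: "H \<subseteq> carrier G" using assms(2) by (rule subgroup.subset)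
  have "card (fixed_points (coset_gset G K) H) \<noteq> 0"
    using assms mark_gclass[OF H finite_gset_coset[OF assms(1)]] by simp
  then obtain C where C: "C \<in> fixed_points (coset_gset G K) H" by (auto simp: card_eq_0_iff)
  then obtain g where "g \<in> carrier G" "C = g <# K"
    by (auto simp: fixed_points_def LCOSETS_def)
  with C that fixed_points_coset[OF assms(1) _ H] show thesis by auto
qed

lemma mark_coset_self:
  assumes "subgroup K G"
  shows "mark G K (gclass G (coset_gset G K)) \<noteq> 0"
proof -
  have K: "K \<subseteq> carrier G" using assms(1) by (rule subgroup.subset)
  have "\<one> <# K \<in> fixed_points (coset_gset G K) K"
    using fixed_points_coset[OF assms one_closed K] conj_map_one(2)[OF K] by simp
  moreover have "finite (fixed_points (coset_gset G K) K)"
    using finite_gsetD(1)[OF finite_gset_coset[OF assms]] by (auto simp: fixed_points_def)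
  ultimately have "card (fixed_points (coset_gset G K) K) \<noteq> 0" by auto
  thus ?thesis using mark_gclass[OF K finite_gset_coset[OF assms]] by simp
qed

text \<open>A fixed coset puts \<open>H\<close> inside a conjugate of \<open>K\<close>, and for
  finite sets inclusion with equal size is equality. This makes the table of marks triangular with
  respect to the size of subgroups.\<close>

lemma mark_coset_triangular:
  assumes "subgroup K G" "subgroup H G" "mark G H (gclass G (coset_gset G K)) \<noteq> 0"
  shows "card H \<le> card K" "card K \<le> card H \<Longrightarrow> conjugate_in G K H"
proof -
  obtain g where g: "g \<in> carrier G" "H \<subseteq> conj_set G g K"
    using mark_coset_nonzero[OF assms] .
  have fin: "finite (conj_set G g K)" using finite_sub[OF subgroup_conj_set[OF assms(1) g(1)]] .
  have c: "card (conj_set G g K) = card K" using card_conj_set[OF subgroup.subset[OF assms(1)] g(1)] .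
  show "card H \<le> card K" using card_mono[OF fin g(2)] c by simp
  show "conjugate_in G K H" if "card K \<le> card H"
    using card_seteq[OF fin g(2)] c that g by (auto simp: conjugate_in_def)
qed

end

locale finite_group_reps = finite_group +
  fixes \<R> :: "'a set set"
  assumes reps: "conj_class_reps G \<R>"
begin

lemma reps_subgroup: "K \<in> \<R> \<Longrightarrow> subgroup K G"
  using reps by (simp add: conj_class_reps_def)

lemma repE:
  assumes "subgroup H G" obtains K where "K \<in> \<R>" "conjugate_in G H K"
  using reps assms by (auto simp: conj_class_reps_def)

lemma reps_unique: "\<lbrakk>K \<in> \<R>; L \<in> \<R>; conjugate_in G K L\<rbrakk> \<Longrightarrow> K = L"
  using reps reps_subgroup conjugate_in_refl by (metis conj_class_reps_def)

lemma finite_reps: "finite \<R>"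
proof (rule finite_subset)
  show "\<R> \<subseteq> Pow (carrier G)" using reps_subgroup subgroup.subset by blast
qed (simp add: finite_carrier)

lemma coset_closed [simp]: "K \<in> \<R> \<Longrightarrow> gclass G (coset_gset G K) \<in> carrier (\<Omega> G)"
  using finite_gset_coset reps_subgroup by simp

text \<open>Orbits give coset spaces, and conjugate subgroups give isomorphic ones, so
  representatives suffice.\<close>

lemma Burnside_coset_expansion:
  assumes "x \<in> carrier (\<Omega> G)"
  shows "\<exists>c. x = (\<Oplus>\<^bsub>\<Omega> G\<^esub>K\<in>\<R>. c K \<odot>\<^bsub>\<Omega> G\<^esub> gclass G (coset_gset G K))"
proof -
  define S where "S c = (\<Oplus>\<^bsub>\<Omega> G\<^esub>K\<in>\<R>. c K \<odot>\<^bsub>\<Omega> G\<^esub> gclass G (coset_gset G K))" for c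
  have S_add: "S c \<oplus>\<^bsub>\<Omega> G\<^esub> S d = S (\<lambda>K. c K + d K)" for c d
  proof -
    have "S c \<oplus>\<^bsub>\<Omega> G\<^esub> S d = (\<Oplus>\<^bsub>\<Omega> G\<^esub>K\<in>\<R>. c K \<odot>\<^bsub>\<Omega> G\<^esub> gclass G (coset_gset G K) \<oplus>\<^bsub>\<Omega> G\<^esub>
        d K \<odot>\<^bsub>\<Omega> G\<^esub> gclass G (coset_gset G K))"
      unfolding S_def by (rule B.ES.finsum_addf[symmetric]) (simp_all add: B.smult_closed)
    also have "\<dots> = S (\<lambda>K. c K + d K)"
      unfolding S_def by (rule B.ES.finsum_cong') (simp_all add: B.smult_closed B.smult_distr)
    finally show ?thesis .
  qed
  have S_smult: "q \<odot>\<^bsub>\<Omega> G\<^esub> S c = S (\<lambda>K. q * c K)" for q c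
  proof -
    have "q \<odot>\<^bsub>\<Omega> G\<^esub> S c = (\<Oplus>\<^bsub>\<Omega> G\<^esub>K\<in>\<R>. q \<odot>\<^bsub>\<Omega> G\<^esub> (c K \<odot>\<^bsub>\<Omega> G\<^esub> gclass G (coset_gset G K)))"
      unfolding S_def B.ES_simps(6)[of q]
      by (rule B.ES.finsum_rdistr) (simp_all add: finite_reps B.smult_closed)
    also have "\<dots> = S (\<lambda>K. q * c K)"
      unfolding S_def by (rule B.ES.finsum_cong') (simp_all add: B.smult_closed B.smult_distr)
    finally show ?thesis .
  qed
  have S_single: "S (\<lambda>L. if K = L then 1 else 0) = gclass G (coset_gset G K)" if K: "K \<in> \<R>" for K
  proof -
    have "S (\<lambda>L. if K = L then 1 else 0) =
        (\<Oplus>\<^bsub>\<Omega> G\<^esub>L\<in>\<R>. if K = L then gclass G (coset_gset G L) else \<zero>\<^bsub>\<Omega> G\<^esub>)"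
      unfolding S_def by (rule B.ES.finsum_cong') (auto simp: B.smult_distr)
    thus ?thesis using K finite_reps by (subst (asm) B.ES.finsum_singleton) auto
  qed
  have "\<exists>c. x = S c" using assms
  proof (induction rule: Burnside_induct_gclass)
    case (gclass X)
    thus ?case
    proof (induction rule: gclass_induct)
      case zero
      have "S (\<lambda>K. 0) = \<zero>\<^bsub>\<Omega> G\<^esub>" unfolding S_def
        by (rule trans[OF B.ES.finsum_cong' B.ES.finsum_zero]) (auto simp: B.smult_distr)
      thus ?case by metis
    next
      case (coset H)
      obtain K where "K \<in> \<R>" "conjugate_in G H K" using coset by (rule repE)
      thus ?case using gclass_coset_conj[OF coset] S_single by metis
    qed (use S_add in metis)
  qed (use S_add S_smult in metis)+
  thus ?thesis unfolding S_def .
qed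

text \<open>Marks separate elements. To the mark at \<open>K\<close> only \<open>K\<close> itself
  and strictly larger representatives can contribute, so the coefficients vanish one after the other
  from the largest subgroups down; hence the measure
  \<open>card (carrier G) - card K\<close>.\<close>

lemma Burnside_zeroI:
  assumes x: "x \<in> carrier (\<Omega> G)" and z: "\<And>K. K \<in> \<R> \<Longrightarrow> mark G K x = 0"
  shows "x = \<zero>\<^bsub>\<Omega> G\<^esub>"
proof -
  obtain c where c: "x = (\<Oplus>\<^bsub>\<Omega> G\<^esub>K\<in>\<R>. c K \<odot>\<^bsub>\<Omega> G\<^esub> gclass G (coset_gset G K))"
    using Burnside_coset_expansion[OF x] by blast
  have "c K = 0" if "K \<in> \<R>" for K
    using that
  proof (induction "card (carrier G) - card K" arbitrary: K rule: less_induct)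
    case less
    have K: "subgroup K G" using less.prems by (rule reps_subgroup)
    have other: "c L * mark G K (gclass G (coset_gset G L)) = 0" if L: "L \<in> \<R>" "L \<noteq> K" for L
    proof (rule ccontr)
      assume *: "c L * mark G K (gclass G (coset_gset G L)) \<noteq> 0"
      hence "mark G K (gclass G (coset_gset G L)) \<noteq> 0" by simp
      note t = mark_coset_triangular[OF reps_subgroup[OF L(1)] K this]
      have "card K < card L" using t reps_unique[OF L(1) less.prems] L(2) by force
      moreover have "card L \<le> card (carrier G)"
        using reps_subgroup[OF L(1)] finite_carrier by (intro card_mono subgroup.subset)
      ultimately have "c L = 0" using less.hyps[of L] L by linarith
      thus False using * by simp
    qed
    have "0 = mark G K x" using z less.prems by simp
    also have "\<dots> = (\<Sum>L\<in>\<R>. c L * mark G K (gclass G (coset_gset G L)))"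
      unfolding c using subgroup.subset[OF K]
      by (subst mark_finsum) (auto simp: finite_reps B.smult_closed mark_smult)
    also have "\<dots> = c K * mark G K (gclass G (coset_gset G K))"
    proof -
      have "(\<Sum>L\<in>\<R> - {K}. c L * mark G K (gclass G (coset_gset G L))) = 0"
        by (rule sum.neutral) (use other in blast)
      thus ?thesis using less.prems finite_reps by (subst sum.remove[of _ K]) simp_all
    qed
    finally show "c K = 0" using mark_coset_self[OF K] by simp
  qed
  hence "x = (\<Oplus>\<^bsub>\<Omega> G\<^esub>K\<in>\<R>. \<zero>\<^bsub>\<Omega> G\<^esub>)"
    unfolding c by (intro B.ES.finsum_cong') (auto simp: B.smult_distr)
  thus ?thesis by (simp add: B.ES.finsum_zero)
qed

lemma Burnside_eqI:
  assumes x: "x \<in> carrier (\<Omega> G)" and y: "y \<in> carrier (\<Omega> G)"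
    and z: "\<And>K. K \<in> \<R> \<Longrightarrow> mark G K x = mark G K y"
  shows "x = y"
proof -
  have "x \<ominus>\<^bsub>\<Omega> G\<^esub> y = \<zero>\<^bsub>\<Omega> G\<^esub>"
    using x y z by (intro Burnside_zeroI) (auto simp: mark_minus subgroup.subset[OF reps_subgroup])
  moreover have "x = x \<ominus>\<^bsub>\<Omega> G\<^esub> y \<oplus>\<^bsub>\<Omega> G\<^esub> y"
    using x y by (simp add: a_minus_def B.ES.a_assoc B.ES.l_neg)
  ultimately show ?thesis using y by simp
qed

subsection \<open>The primitive idempotents\<close>

text \<open>Inverts the triangular table of marks. From G/K the elements already found for smaller
  subgroups are subtracted, with the marks of G/K as coefficients; this kills the marks at all
  subgroups smaller than \<open>K\<close>, and division by the mark at \<open>K\<close> normalizes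
  what is left.\<close>

lemma ex_delta_marks:
  assumes "subgroup K G"
  shows "\<exists>e\<in>carrier (\<Omega> G). \<forall>H. subgroup H G \<longrightarrow> mark G H e = (if conjugate_in G H K then 1 else 0)"
  using assms
proof (induction "card K" arbitrary: K rule: less_induct)
  case less
  note K = less.prems
  define D where "D = {L \<in> \<R>. card L < card K}"
  have D: "finite D" "\<And>L. L \<in> D \<Longrightarrow> subgroup L G" using finite_reps reps_subgroup by (auto simp: D_def)
  have "\<forall>L\<in>D. \<exists>e\<in>carrier (\<Omega> G). \<forall>H. subgroup H G \<longrightarrow> mark G H e = (if conjugate_in G H L then 1 else 0)"
    using less.hyps D by (auto simp: D_def)
  then obtain e where e: "\<And>L. L \<in> D \<Longrightarrow> e L \<in> carrier (\<Omega> G)"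
    "\<And>L H. L \<in> D \<Longrightarrow> subgroup H G \<Longrightarrow> mark G H (e L) = (if conjugate_in G H L then 1 else 0)" by metis
  let ?k = "gclass G (coset_gset G K)"
  define s where "s = (\<Oplus>\<^bsub>\<Omega> G\<^esub>L\<in>D. mark G L ?k \<odot>\<^bsub>\<Omega> G\<^esub> e L)"
  define x where "x = (1 / mark G K ?k) \<odot>\<^bsub>\<Omega> G\<^esub> (?k \<ominus>\<^bsub>\<Omega> G\<^esub> s)"
  have k: "?k \<in> carrier (\<Omega> G)" using K finite_gset_coset by simp
  have s: "s \<in> carrier (\<Omega> G)" unfolding s_def by (intro B.ES.finsum_closed) (auto simp: e B.smult_closed)
  have ks: "?k \<ominus>\<^bsub>\<Omega> G\<^esub> s \<in> carrier (\<Omega> G)" using k s by simp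
  show ?case
  proof (intro bexI[of _ x] allI impI)
    show "x \<in> carrier (\<Omega> G)" unfolding x_def using ks by (rule B.smult_closed)
    fix H assume H: "subgroup H G"
    have Hc: "H \<subseteq> carrier G" using H by (rule subgroup.subset)
    have "mark G H s = (\<Sum>L\<in>D. mark G L ?k * (if conjugate_in G H L then 1 else 0))"
      unfolding s_def using D by (subst mark_finsum[OF Hc]) (auto simp: e B.smult_closed mark_smult Hc H)
    also have "\<dots> = (if card H < card K then mark G H ?k else 0)"
    proof -
      \<comment> \<open>Exactly one representative is conjugate to \<open>H\<close>, so at most one
        term of the sum survives.\<close>
      obtain L0 where L0: "L0 \<in> \<R>" "conjugate_in G H L0" using H by (rule repE)
      have "conjugate_in G H L \<longleftrightarrow> L = L0" if "L \<in> D" for L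
        using that L0 H reps_unique[of L L0] conjugate_in_trans[OF _ conjugate_in_sym] D(2)
        by (metis (no_types, lifting) D_def conjugate_in_sym mem_Collect_eq)
      hence "(\<Sum>L\<in>D. mark G L ?k * (if conjugate_in G H L then 1 else 0)) =
          (\<Sum>L\<in>D. if L = L0 then mark G L0 ?k else 0)" by (intro sum.cong) auto
      also have "\<dots> = (if L0 \<in> D then mark G L0 ?k else 0)" using D by (simp add: sum.delta)
      finally show ?thesis
        using L0 card_conjugate_in[OF H L0(2)] mark_conj[OF H L0(2) k] by (simp add: D_def)
    qed
    finally have "mark G H (?k \<ominus>\<^bsub>\<Omega> G\<^esub> s) = (if card H < card K then 0 else mark G H ?k)"
      by (simp add: mark_minus[OF Hc k s])
    also have "\<dots> = (if conjugate_in G H K then mark G K ?k else 0)"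
    proof (cases "conjugate_in G H K")
      case True
      thus ?thesis using card_conjugate_in[OF H] mark_conj[OF H True k] by simp
    next
      case False
      have "mark G H ?k = 0" if "\<not> card H < card K"
        using mark_coset_triangular(2)[OF K H] conjugate_in_sym[OF K, of H] that False by auto
      thus ?thesis using False by simp
    qed
    finally show "mark G H x = (if conjugate_in G H K then 1 else 0)"
      unfolding x_def using mark_coset_self[OF K] by (simp add: mark_smult[OF Hc ks])
  qed
qed

text \<open>The element with delta marks is idempotent because marks are multiplicative and separate
  elements. It is primitive because idempotents have marks 0 or 1: if \<open>e\<close> is the sum of
  \<open>a\<close> and \<open>b\<close>, only one of them can have a nonzero mark at the single
  class where \<open>e\<close> has one.\<close>

lemma burnside_idem:
  assumes K: "subgroup K G"
  shows "burnside_idem G K \<in> carrier (\<Omega> G)"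
    and "subgroup H G \<Longrightarrow> mark G H (burnside_idem G K) = (if conjugate_in G H K then 1 else 0)"
proof -
  let ?P = "\<lambda>e. primitive_idempotent (\<Omega> G) e \<and>
     (\<forall>H. subgroup H G \<longrightarrow> mark G H e = (if conjugate_in G H K then 1 else 0))"
  obtain e where e: "e \<in> carrier (\<Omega> G)"
    "\<And>H. subgroup H G \<Longrightarrow> mark G H e = (if conjugate_in G H K then 1 else 0)"
    using ex_delta_marks[OF K] by blast
  note rc = subgroup.subset[OF reps_subgroup]
  have idem01: "mark G L a = 0 \<or> mark G L a = 1"
    if "a \<in> carrier (\<Omega> G)" "a \<otimes>\<^bsub>\<Omega> G\<^esub> a = a" "L \<in> \<R>" for a L
    using mark_mult[OF rc[OF that(3)] that(1,1)] that(2) by simp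
  have "?P e"
  proof (intro conjI allI impI e(2))
    show "primitive_idempotent (\<Omega> G) e"
      unfolding primitive_idempotent_def
    proof (intro conjI ballI impI)
      show "e \<otimes>\<^bsub>\<Omega> G\<^esub> e = e"
        using e by (intro Burnside_eqI) (auto simp: mark_mult rc reps_subgroup)
      show "e \<noteq> \<zero>\<^bsub>\<Omega> G\<^esub>"
        using e(2)[OF K] conjugate_in_refl[OF K] mark_zero[OF subgroup.subset[OF K]] by auto
      fix a b assume ab: "a \<in> carrier (\<Omega> G)" "b \<in> carrier (\<Omega> G)" and
        "a \<otimes>\<^bsub>\<Omega> G\<^esub> a = a \<and> b \<otimes>\<^bsub>\<Omega> G\<^esub> b = b \<and> a \<otimes>\<^bsub>\<Omega> G\<^esub> b = \<zero>\<^bsub>\<Omega> G\<^esub> \<and> b \<otimes>\<^bsub>\<Omega> G\<^esub> a = \<zero>\<^bsub>\<Omega> G\<^esub> \<and> e = a \<oplus>\<^bsub>\<Omega> G\<^esub> b"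
      hence id: "a \<otimes>\<^bsub>\<Omega> G\<^esub> a = a" "b \<otimes>\<^bsub>\<Omega> G\<^esub> b = b" and eab: "e = a \<oplus>\<^bsub>\<Omega> G\<^esub> b" by auto
      obtain K0 where K0: "K0 \<in> \<R>" "conjugate_in G K K0" using K by (rule repE)
      have sum: "mark G L a + mark G L b = (if L = K0 then 1 else 0)" if L: "L \<in> \<R>" for L
      proof -
        have "conjugate_in G L K \<longleftrightarrow> L = K0"
          using reps_unique[OF L K0(1)] K0 L conjugate_in_trans conjugate_in_sym[OF K K0(2)] reps_subgroup by metis
        thus ?thesis using e(2)[OF reps_subgroup[OF L]] mark_add[OF rc[OF L] ab] eab by simp
      qed
      have "mark G L a = 0 \<and> mark G L b = 0" if L: "L \<in> \<R>" "L \<noteq> K0" for L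
        using sum[OF L(1)] idem01[OF ab(1) id(1) L(1)] idem01[OF ab(2) id(2) L(1)] L(2) by auto
      moreover have "mark G K0 a = 0 \<or> mark G K0 b = 0"
        using sum[OF K0(1)] idem01[OF ab(1) id(1) K0(1)] idem01[OF ab(2) id(2) K0(1)] by auto
      ultimately show "a = \<zero>\<^bsub>\<Omega> G\<^esub> \<or> b = \<zero>\<^bsub>\<Omega> G\<^esub>"
        using Burnside_zeroI[OF ab(1)] Burnside_zeroI[OF ab(2)] by metis
    qed (rule e(1))
  qed
  moreover have "e' = e" if "?P e'" for e'
    using that e reps_subgroup by (intro Burnside_eqI) (auto simp: primitive_idempotent_def)
  ultimately have "burnside_idem G K = e" unfolding burnside_idem_def by (rule the_equality)
  thus "burnside_idem G K \<in> carrier (\<Omega> G)"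
    "subgroup H G \<Longrightarrow> mark G H (burnside_idem G K) = (if conjugate_in G H K then 1 else 0)"
    using e by auto
qed

end

subsection \<open>Values of rational functions at \<open>- 1\<close>\<close>

abbreviation poly_to_fls :: "rat poly \<Rightarrow> rat fls" where
  "poly_to_fls p \<equiv> fps_to_fls (fps_of_poly p)"

text \<open>The value \<open>v\<close> at -1 of the rational function whose Laurent series is
  \<open>F\<close>. Cross-multiplication with a polynomial that does not vanish at -1 expresses
  regularity there without choosing a reduced fraction.\<close>

definition rat_value :: "rat fls \<Rightarrow> rat \<Rightarrow> bool" where
  "rat_value F v \<longleftrightarrow> (\<exists>p q. poly q (- 1) \<noteq> 0 \<and> F * poly_to_fls q = poly_to_fls p \<and>
     v = poly p (- 1) / poly q (- 1))"

lemma poly_to_fls_simps: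
  "poly_to_fls (p * q) = poly_to_fls p * poly_to_fls q"
  "poly_to_fls (p + q) = poly_to_fls p + poly_to_fls q"
  "poly_to_fls p = poly_to_fls q \<longleftrightarrow> p = q"
  "poly_to_fls [:c:] = fls_const c"
  by (simp_all add: fps_of_poly_mult fps_of_poly_add fps_of_poly_eq_iff fls_times_fps_to_fls
      fps_of_poly_const)

text \<open>Cross-multiplying two presentations gives an identity between the Laurent series of
  polynomials, hence between polynomials, which can be evaluated at -1.\<close>

lemma rat_value_unique:
  assumes "rat_value F v" "rat_value F w"
  shows "v = w"
proof -
  obtain p q where pq: "poly q (- 1) \<noteq> 0" "F * poly_to_fls q = poly_to_fls p" "v = poly p (- 1) / poly q (- 1)"
    using assms(1) by (auto simp: rat_value_def)
  obtain p' q' where pq': "poly q' (- 1) \<noteq> 0" "F * poly_to_fls q' = poly_to_fls p'" "w = poly p' (- 1) / poly q' (- 1)"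
    using assms(2) by (auto simp: rat_value_def)
  have "poly_to_fls (p * q') = (F * poly_to_fls q) * poly_to_fls q'"
    by (simp only: pq poly_to_fls_simps)
  also have "\<dots> = (F * poly_to_fls q') * poly_to_fls q" by (simp only: mult_ac)
  also have "\<dots> = poly_to_fls (p' * q)" by (simp only: pq' poly_to_fls_simps)
  finally have "p * q' = p' * q" by (simp only: poly_to_fls_simps(3))
  hence "poly p (- 1) * poly q' (- 1) = poly p' (- 1) * poly q (- 1)" by (metis poly_mult)
  thus ?thesis using pq pq' by (simp add: frac_eq_eq)
qed

lemma rat_value_add:
  assumes "rat_value F v" "rat_value F' v'"
  shows "rat_value (F + F') (v + v')"
proof -
  obtain p q where pq: "poly q (- 1) \<noteq> 0" "F * poly_to_fls q = poly_to_fls p" "v = poly p (- 1) / poly q (- 1)"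
    using assms(1) by (auto simp: rat_value_def)
  obtain p' q' where pq': "poly q' (- 1) \<noteq> 0" "F' * poly_to_fls q' = poly_to_fls p'" "v' = poly p' (- 1) / poly q' (- 1)"
    using assms(2) by (auto simp: rat_value_def)
  have "(F + F') * poly_to_fls (q * q') =
      (F * poly_to_fls q) * poly_to_fls q' + (F' * poly_to_fls q') * poly_to_fls q"
    by (simp only: poly_to_fls_simps algebra_simps)
  also have "\<dots> = poly_to_fls (p * q' + p' * q)" by (simp only: pq pq' poly_to_fls_simps)
  finally have "(F + F') * poly_to_fls (q * q') = poly_to_fls (p * q' + p' * q)" .
  moreover have "v + v' = poly (p * q' + p' * q) (- 1) / poly (q * q') (- 1)"
    unfolding pq(3) pq'(3) using pq(1) pq'(1) by (simp add: add_frac_eq)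
  moreover have "poly (q * q') (- 1) \<noteq> 0" using pq pq' by simp
  ultimately show ?thesis unfolding rat_value_def by blast
qed

lemma rat_value_mult:
  assumes "rat_value F v"
  shows "rat_value (poly_to_fls r * F) (poly r (- 1) * v)"
proof -
  obtain p q where pq: "poly q (- 1) \<noteq> 0" "F * poly_to_fls q = poly_to_fls p" "v = poly p (- 1) / poly q (- 1)"
    using assms(1) by (auto simp: rat_value_def)
  have "poly_to_fls r * F * poly_to_fls q = poly_to_fls (r * p)"
    by (simp only: pq poly_to_fls_simps mult.assoc)
  thus ?thesis unfolding rat_value_def using pq by (intro exI[of _ "r * p"] exI[of _ q]) simp
qed

text \<open>Solves a linear equation for the series \<open>F\<close>; this is where the factor in
  front of the unknown chain series is divided out.\<close>

lemma rat_value_cancel: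
  assumes "rat_value (F * poly_to_fls r) v" "poly r (- 1) \<noteq> 0"
  shows "rat_value F (v / poly r (- 1))"
proof -
  obtain p q where pq: "poly q (- 1) \<noteq> 0" "F * poly_to_fls r * poly_to_fls q = poly_to_fls p"
    "v = poly p (- 1) / poly q (- 1)"
    using assms(1) by (auto simp: rat_value_def)
  have "F * poly_to_fls (r * q) = poly_to_fls p"
    by (simp only: poly_to_fls_simps(1) pq(2)[symmetric] mult.assoc)
  thus ?thesis unfolding rat_value_def using pq assms(2)
    by (intro exI[of _ p] exI[of _ "r * q"]) (simp add: mult.commute)
qed

lemma rat_value_poly: "rat_value (poly_to_fls p) (poly p (- 1))"
  unfolding rat_value_def by (rule exI[of _ p], rule exI[of _ 1]) simp

lemma rat_value_sum:
  "\<lbrakk>finite I; \<And>i. i \<in> I \<Longrightarrow> rat_value (F i) (v i)\<rbrakk> \<Longrightarrow>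
    rat_value (\<Sum>i\<in>I. fls_const (c i) * F i) (\<Sum>i\<in>I. c i * v i)"
proof (induction I rule: finite_induct)
  case empty
  show ?case using rat_value_poly[of 0] by simp
next
  case (insert i I)
  have "rat_value (fls_const (c i) * F i) (c i * v i)"
    using rat_value_mult[of "F i" "v i" "[:c i:]"] insert by (simp add: poly_to_fls_simps(4))
  thus ?case using insert by (simp add: rat_value_add)
qed

lemma poly_minus_one_nz: "\<not> [:1, 1:] dvd q \<longleftrightarrow> poly q (- 1 :: rat) \<noteq> 0"
  by (simp add: poly_eq_0_iff_dvd)

lemma rat_value_laurent:
  assumes "\<not> [:1, 1:] dvd q"
  shows "rat_value (laurent_of_ratfun p q) (poly p (- 1) / poly q (- 1))"
proof -
  have "q \<noteq> 0" using assms by auto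
  hence "poly_to_fls q \<noteq> 0" using fps_of_poly_eq_iff[of q 0] by simp
  hence "laurent_of_ratfun p q * poly_to_fls q = poly_to_fls p" by (simp add: laurent_of_ratfun_def)
  thus ?thesis unfolding rat_value_def using assms poly_minus_one_nz by blast
qed

lemma rat_value_obtain:
  assumes "rat_value F v"
  obtains p q where "\<not> [:1, 1:] dvd q" "F = laurent_of_ratfun p q" "v = poly p (- 1) / poly q (- 1)"
proof -
  obtain p q where pq: "poly q (- 1) \<noteq> 0" "F * poly_to_fls q = poly_to_fls p" "v = poly p (- 1) / poly q (- 1)"
    using assms(1) by (auto simp: rat_value_def)
  have "q \<noteq> 0" using pq by auto
  hence "poly_to_fls q \<noteq> 0" using fps_of_poly_eq_iff[of q 0] by simp
  hence "F = laurent_of_ratfun p q" using pq(2) by (simp add: laurent_of_ratfun_def field_simps)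
  thus thesis using that pq poly_minus_one_nz by blast
qed

subsection \<open>The series Lefschetz invariant through marks\<close>

context finite_group_reps
begin

abbreviation mark_series :: "('a, 'o, 'm, 'z) gcat_scheme \<Rightarrow> 'a set \<Rightarrow> rat fls" where
  "mark_series D K \<equiv> fps_to_fls (Abs_fps (\<lambda>n. mark G K (gclass G (chain_gset D n))))"

text \<open>A mark turns any presentation of the chain series into an ordinary rational function, so
  the marks of \<open>y\<close> depend on \<open>D\<close> alone. With separation by marks this
  justifies the definite description in \<open>series_Lefschetz\<close>.\<close>

lemma series_Lefschetz_value_mark:
  assumes "series_Lefschetz_value G D y"
  shows "y \<in> carrier (\<Omega> G)" and "K \<in> \<R> \<Longrightarrow> rat_value (mark_series D K) (mark G K y)"
proof -
  obtain k :: nat and w p q where w: "\<And>i. i < k \<Longrightarrow> w i \<in> carrier (\<Omega> G)" "\<And>i. i < k \<Longrightarrow> \<not> [:1, 1:] dvd q i"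
    and ser: "\<And>n. chain_series G D n =
           (\<Oplus>\<^bsub>\<Omega> G\<^esub>i\<in>{..<k}. fls_nth (laurent_of_ratfun (p i) (q i)) n \<odot>\<^bsub>\<Omega> G\<^esub> w i)"
    and y: "y = (\<Oplus>\<^bsub>\<Omega> G\<^esub>i\<in>{..<k}. (poly (p i) (- 1) / poly (q i) (- 1)) \<odot>\<^bsub>\<Omega> G\<^esub> w i)"
    using assms unfolding series_Lefschetz_value_def by blast
  show "y \<in> carrier (\<Omega> G)"
    unfolding y by (intro B.ES.finsum_closed) (auto simp: w B.smult_closed)
  assume K: "K \<in> \<R>"
  have Kc: "K \<subseteq> carrier G" using K by (intro subgroup.subset reps_subgroup)
  have m: "mark G K (\<Oplus>\<^bsub>\<Omega> G\<^esub>i\<in>{..<k}. a i \<odot>\<^bsub>\<Omega> G\<^esub> w i) = (\<Sum>i<k. mark G K (w i) * a i)" for a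
    by (subst mark_finsum[OF Kc]) (auto simp: w B.smult_closed mark_smult[OF Kc] mult.commute)
  have "mark_series D K = (\<Sum>i<k. fls_const (mark G K (w i)) * laurent_of_ratfun (p i) (q i))"
  proof (rule fls_eqI)
    fix n
    have "fls_nth (mark_series D K) n = mark G K (chain_series G D n)"
      by (simp add: chain_series_def mark_zero[OF Kc])
    also have "\<dots> = fls_nth (\<Sum>i<k. fls_const (mark G K (w i)) * laurent_of_ratfun (p i) (q i)) n"
      unfolding ser m by (simp add: fls_nth_sum fls_mult_const_nth)
    finally show "fls_nth (mark_series D K) n = \<dots>" .
  qed
  moreover have "rat_value (\<Sum>i<k. fls_const (mark G K (w i)) * laurent_of_ratfun (p i) (q i)) (mark G K y)"
    unfolding y m by (rule rat_value_sum) (auto simp: w rat_value_laurent)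
  ultimately show "rat_value (mark_series D K) (mark G K y)" by simp
qed

text \<open>Replaces the numerical index range of the definition by any finite index set; it is
  applied with the family of subgroups itself.\<close>

lemma series_Lefschetz_valueI:
  assumes I: "finite I" and w: "\<And>i. i \<in> I \<Longrightarrow> w i \<in> carrier (\<Omega> G)"
    and v: "\<And>i. i \<in> I \<Longrightarrow> rat_value (fps_to_fls (Abs_fps (u i))) (v i)"
    and ch: "\<And>n. gclass G (chain_gset D n) = (\<Oplus>\<^bsub>\<Omega> G\<^esub>i\<in>I. u i n \<odot>\<^bsub>\<Omega> G\<^esub> w i)"
  shows "series_Lefschetz_value G D (\<Oplus>\<^bsub>\<Omega> G\<^esub>i\<in>I. v i \<odot>\<^bsub>\<Omega> G\<^esub> w i)"
proof -
  obtain h where h: "bij_betw h {..<card I} I"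
    using ex_bij_betw_nat_finite[OF I] by (auto simp: atLeast0LessThan)
  have hI: "h i \<in> I" if "i < card I" for i using bij_betwE[OF h] that by auto
  have "\<forall>i\<in>I. \<exists>p q. \<not> [:1, 1:] dvd q \<and> fps_to_fls (Abs_fps (u i)) = laurent_of_ratfun p q \<and>
      v i = poly p (- 1) / poly q (- 1)"
    using v by (blast elim: rat_value_obtain)
  then obtain p q where pq: "\<And>i. i \<in> I \<Longrightarrow> \<not> [:1, 1:] dvd q i"
    "\<And>i. i \<in> I \<Longrightarrow> fps_to_fls (Abs_fps (u i)) = laurent_of_ratfun (p i) (q i)"
    "\<And>i. i \<in> I \<Longrightarrow> v i = poly (p i) (- 1) / poly (q i) (- 1)" by metis
  have re: "(\<Oplus>\<^bsub>\<Omega> G\<^esub>i\<in>I. a i \<odot>\<^bsub>\<Omega> G\<^esub> w i) = (\<Oplus>\<^bsub>\<Omega> G\<^esub>i\<in>{..<card I}. a (h i) \<odot>\<^bsub>\<Omega> G\<^esub> w (h i))" for a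
  proof -
    have "(\<Oplus>\<^bsub>\<Omega> G\<^esub>i\<in>h ` {..<card I}. a i \<odot>\<^bsub>\<Omega> G\<^esub> w i) = (\<Oplus>\<^bsub>\<Omega> G\<^esub>i\<in>{..<card I}. a (h i) \<odot>\<^bsub>\<Omega> G\<^esub> w (h i))"
      using h hI w by (intro B.ES.finsum_reindex) (auto simp: bij_betw_def B.smult_closed)
    thus ?thesis using h by (simp add: bij_betw_def)
  qed
  have ser: "chain_series G D n =
     (\<Oplus>\<^bsub>\<Omega> G\<^esub>i\<in>{..<card I}. fls_nth (laurent_of_ratfun (p (h i)) (q (h i))) n \<odot>\<^bsub>\<Omega> G\<^esub> w (h i))" for n
  proof -
    \<comment> \<open>In negative degrees both sides vanish: the chain series by definition, the
      \<open>u i\<close> because they come from power series.\<close>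
    have "chain_series G D n = (\<Oplus>\<^bsub>\<Omega> G\<^esub>i\<in>I. (if n < 0 then 0 else u i (nat n)) \<odot>\<^bsub>\<Omega> G\<^esub> w i)"
    proof (cases "n < 0")
      case True
      have "(\<Oplus>\<^bsub>\<Omega> G\<^esub>i\<in>I. 0 \<odot>\<^bsub>\<Omega> G\<^esub> w i) = (\<Oplus>\<^bsub>\<Omega> G\<^esub>i\<in>I. \<zero>\<^bsub>\<Omega> G\<^esub>)"
        by (rule B.ES.finsum_cong') (simp_all add: w B.smult_distr)
      thus ?thesis using True by (simp add: chain_series_def B.ES.finsum_zero)
    qed (simp add: chain_series_def ch)
    also have "\<dots> = (\<Oplus>\<^bsub>\<Omega> G\<^esub>i\<in>I. fls_nth (laurent_of_ratfun (p i) (q i)) n \<odot>\<^bsub>\<Omega> G\<^esub> w i)"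
      by (rule B.ES.finsum_cong') (simp_all add: w B.smult_closed flip: pq(2))
    finally show ?thesis unfolding re .
  qed
  show ?thesis
    unfolding series_Lefschetz_value_def
  proof (rule exI[of _ "card I"], rule exI[of _ "w \<circ> h"], rule exI[of _ "p \<circ> h"],
      rule exI[of _ "q \<circ> h"], intro conjI allI impI)
    have "(\<Oplus>\<^bsub>\<Omega> G\<^esub>i\<in>I. v i \<odot>\<^bsub>\<Omega> G\<^esub> w i) = (\<Oplus>\<^bsub>\<Omega> G\<^esub>i\<in>I. (poly (p i) (- 1) / poly (q i) (- 1)) \<odot>\<^bsub>\<Omega> G\<^esub> w i)"
      by (rule B.ES.finsum_cong') (simp_all add: w pq(3) B.smult_closed)
    thus "(\<Oplus>\<^bsub>\<Omega> G\<^esub>i\<in>I. v i \<odot>\<^bsub>\<Omega> G\<^esub> w i) = (\<Oplus>\<^bsub>\<Omega> G\<^esub>i\<in>{..<card I}.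
        (poly ((p \<circ> h) i) (- 1) / poly ((q \<circ> h) i) (- 1)) \<odot>\<^bsub>\<Omega> G\<^esub> (w \<circ> h) i)"
      by (simp add: re)
  qed (simp_all add: hI w pq(1) ser)
qed

lemma series_Lefschetz_eq:
  assumes "series_Lefschetz_value G D y"
  shows "series_Lefschetz G D = y"
  unfolding series_Lefschetz_def
proof (rule the_equality)
  fix y' assume y': "series_Lefschetz_value G D y'"
  show "y' = y"
    by (intro Burnside_eqI series_Lefschetz_value_mark(1)[OF assms] series_Lefschetz_value_mark(1)[OF y']
        rat_value_unique[OF series_Lefschetz_value_mark(2)[OF y'] series_Lefschetz_value_mark(2)[OF assms]])
qed (rule assms)

end

subsection \<open>Euler characteristics and weightings\<close>

text \<open>Covers inclusion and its reverse at once. Chains are the same for both, so by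
  \<open>r_comparable\<close> one order complex can be read in either direction; the posets above a
  subgroup for \<open>EO\<close> and those below one for \<open>EA\<close> then share their
  proofs.\<close>

locale inclusion_order =
  fixes r :: "'p set \<Rightarrow> 'p set \<Rightarrow> bool"
  assumes r_irrefl: "\<not> r A A"
    and r_trans: "r A B \<Longrightarrow> r B C \<Longrightarrow> r A C"
    and r_comparable: "A \<subseteq> B \<or> B \<subseteq> A \<longleftrightarrow> A = B \<or> r A B \<or> r B A"
begin

abbreviation up :: "'p set set \<Rightarrow> 'p set \<Rightarrow> 'p set set" where
  "up Y P \<equiv> {Q \<in> Y. r P Q}"

lemma order_complex_iff:
  "\<sigma> \<in> order_complex Y \<longleftrightarrow>
     \<sigma> \<subseteq> Y \<and> finite \<sigma> \<and> \<sigma> \<noteq> {} \<and> (\<forall>A\<in>\<sigma>. \<forall>B\<in>\<sigma>. A = B \<or> r A B \<or> r B A)"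
  unfolding order_complex_def chains_def chain_subset_def r_comparable by auto

text \<open>Simplices are grouped by their least vertex.\<close>

lemma euler_char_sum:
  assumes Y: "finite Y"
  shows "euler_char Y = (\<Sum>Q\<in>Y. - reduced_euler_char (up Y Q))"
proof -
  have fin: "finite (order_complex Z)" if "finite Z" for Z :: "'p set set"
    by (rule finite_subset[of _ "Pow Z"]) (use that in \<open>auto simp: order_complex_iff\<close>)
  define W where "W = Sigma Y (\<lambda>Q. insert {} (order_complex (up Y Q)))"
  have W: "Q \<in> Y" "\<tau> \<subseteq> up Y Q" "finite \<tau>" "\<forall>A\<in>\<tau>. \<forall>B\<in>\<tau>. A = B \<or> r A B \<or> r B A" "Q \<notin> \<tau>"
    if "(Q, \<tau>) \<in> W" for Q \<tau>
    using that r_irrefl by (auto simp: W_def order_complex_iff)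
  have "inj_on (\<lambda>(Q, \<tau>). insert Q \<tau>) W"
  proof (rule inj_onI, clarify)
    fix Q \<tau> Q' \<tau>' assume w: "(Q, \<tau>) \<in> W" "(Q', \<tau>') \<in> W" and e: "insert Q \<tau> = insert Q' \<tau>'"
    have "Q = Q'"
    proof (rule ccontr)
      assume "Q \<noteq> Q'"
      hence "Q \<in> \<tau>'" "Q' \<in> \<tau>" using e by blast+
      hence "r Q' Q" "r Q Q'" using W(2)[OF w(1)] W(2)[OF w(2)] by auto
      thus False using r_trans r_irrefl by blast
    qed
    moreover have "\<tau> = \<tau>'"
      using insert_ident[OF W(5)[OF w(1)], of \<tau>'] W(5)[OF w(2)] e \<open>Q = Q'\<close> by simp
    ultimately show "Q = Q' \<and> \<tau> = \<tau>'" by simp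
  qed
  moreover have "(\<lambda>(Q, \<tau>). insert Q \<tau>) ` W = order_complex Y"
  proof (intro equalityI subsetI)
    fix \<sigma> assume "\<sigma> \<in> (\<lambda>(Q, \<tau>). insert Q \<tau>) ` W"
    then obtain Q \<tau> where "(Q, \<tau>) \<in> W" "\<sigma> = insert Q \<tau>" by auto
    thus "\<sigma> \<in> order_complex Y" using W[of Q \<tau>] by (auto simp: order_complex_iff)
  next
    fix \<sigma> assume \<sigma>: "\<sigma> \<in> order_complex Y"
    hence s: "\<sigma> \<subseteq> Y" "finite \<sigma>" "\<sigma> \<noteq> {}" "\<And>A B. A \<in> \<sigma> \<Longrightarrow> B \<in> \<sigma> \<Longrightarrow> A = B \<or> r A B \<or> r B A"
      by (auto simp: order_complex_iff)
    have "\<exists>Q\<in>\<sigma>. \<forall>A\<in>\<sigma>. A \<noteq> Q \<longrightarrow> \<not> r A Q"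
    proof (rule Finite_Set.bex_min_element[OF s(2) _ _ s(3)])
      show "asymp_on \<sigma> r" by (rule asymp_onI) (use r_trans r_irrefl in blast)
      show "transp_on \<sigma> r" by (rule transp_onI) (rule r_trans)
    qed
    then obtain Q where Q: "Q \<in> \<sigma>" and min: "\<And>A. A \<in> \<sigma> \<Longrightarrow> A \<noteq> Q \<Longrightarrow> \<not> r A Q" by blast
    have "r Q A" if "A \<in> \<sigma>" "A \<noteq> Q" for A
      using s(4)[OF that(1) Q] min[OF that] that(2) by simp
    hence "\<sigma> - {Q} \<subseteq> up Y Q" using s(1) by blast
    moreover have "\<forall>A\<in>\<sigma> - {Q}. \<forall>B\<in>\<sigma> - {Q}. A = B \<or> r A B \<or> r B A"
      by (intro ballI s(4)) simp_all
    ultimately have "\<sigma> - {Q} = {} \<or> \<sigma> - {Q} \<in> order_complex (up Y Q)"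
      unfolding order_complex_iff using s(2) by blast
    hence "(Q, \<sigma> - {Q}) \<in> W" unfolding W_def using s(1) Q by blast
    moreover have "\<sigma> = (\<lambda>(Q, \<tau>). insert Q \<tau>) (Q, \<sigma> - {Q})" using Q by auto
    ultimately show "\<sigma> \<in> (\<lambda>(Q, \<tau>). insert Q \<tau>) ` W" by (rule rev_image_eqI)
  qed
  ultimately have "bij_betw (\<lambda>(Q, \<tau>). insert Q \<tau>) W (order_complex Y)" by (simp add: bij_betw_def)
  hence "euler_char Y = (\<Sum>w\<in>W. (- 1) ^ (card ((\<lambda>(Q, \<tau>). insert Q \<tau>) w) - 1))"
    unfolding euler_char_def by (rule sum.reindex_bij_betw[symmetric])
  also have "\<dots> = (\<Sum>(Q, \<tau>)\<in>W. (- 1) ^ card \<tau>)"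
    using W by (intro sum.cong) auto
  also have "\<dots> = (\<Sum>Q\<in>Y. \<Sum>\<tau>\<in>insert {} (order_complex (up Y Q)). (- 1) ^ card \<tau>)"
    unfolding W_def using Y fin by (subst sum.Sigma) auto
  also have "\<dots> = (\<Sum>Q\<in>Y. - reduced_euler_char (up Y Q))"
  proof (rule sum.cong[OF refl])
    fix Q
    \<comment> \<open>As a simplex of its own, \<open>\<tau>\<close> carries the exponent
      \<open>card \<tau> - 1\<close>, one less than here, hence the sign; nonemptiness rules out
      truncated subtraction.\<close>
    have "(- 1) ^ card \<tau> = - ((- 1 :: int) ^ (card \<tau> - 1))" if "\<tau> \<in> order_complex (up Y Q)" for \<tau>
    proof -
      have "card \<tau> \<noteq> 0" using that by (simp add: order_complex_iff)
      then obtain c where "card \<tau> = Suc c" by (cases "card \<tau>") auto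
      thus ?thesis by simp
    qed
    hence "(\<Sum>\<tau>\<in>order_complex (up Y Q). (- 1 :: int) ^ card \<tau>) = - euler_char (up Y Q)"
      unfolding euler_char_def sum_negf[symmetric] by (intro sum.cong refl)
    moreover have "{} \<notin> order_complex (up Y Q)" by (simp add: order_complex_iff)
    ultimately show "(\<Sum>\<tau>\<in>insert {} (order_complex (up Y Q)). (- 1) ^ card \<tau>) = - reduced_euler_char (up Y Q)"
      using fin[of "up Y Q"] Y by (simp add: reduced_euler_char_def)
  qed
  finally show ?thesis .
qed

text \<open>With \<open>k_Q\<close> for minus the reduced Euler characteristic above
  \<open>Q\<close>, the left side is \<open>1 - k_P\<close>: this is the defining equation of the
  weighting.\<close>

lemma euler_char_up:
  assumes "finite Y"
  shows "euler_char (up Y P) = (\<Sum>Q\<in>up Y P. - reduced_euler_char (up Y Q))"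
proof -
  have "up (up Y P) Q = up Y Q" if "Q \<in> up Y P" for Q using that r_trans by blast
  thus ?thesis using assms by (subst euler_char_sum) auto
qed

text \<open>The number of chains of length \<open>n\<close> that start over \<open>P\<close>, in a preorder in which \<open>m Q\<close>
  isomorphic objects lie over each \<open>Q\<close>.\<close>

primrec weighted_chains :: "'p set set \<Rightarrow> ('p set \<Rightarrow> nat) \<Rightarrow> nat \<Rightarrow> 'p set \<Rightarrow> rat" where
  "weighted_chains Y m 0 P = 1"
| "weighted_chains Y m (Suc n) P = (of_nat (m P) - 1) * weighted_chains Y m n P +
     (\<Sum>Q\<in>up Y P. of_nat (m Q) * weighted_chains Y m n Q)"

lemma fps_to_fls_sum_const:
  "fps_to_fls (\<Sum>i\<in>I. fps_const (c i) * f i) = (\<Sum>i\<in>I. fls_const (c i) * fps_to_fls (f i :: rat fps))"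
  by (rule fls_eqI) (simp add: fls_nth_sum fls_mult_const_nth fps_sum_nth)

text \<open>Induction from the top of the poset down, each step solving a linear equation with known
  right-hand side. At -1 the factors \<open>m Q\<close> cancel, and \<open>euler_char_up\<close>
  evaluates the remaining sum of weights.\<close>

lemma weighted_chains_value:
  assumes Y: "finite Y" and m: "\<And>P. P \<in> Y \<Longrightarrow> m P > 0" and P: "P \<in> Y"
  shows "rat_value (fps_to_fls (Abs_fps (\<lambda>n. weighted_chains Y m n P)))
     (- of_int (reduced_euler_char (up Y P)) / of_nat (m P))"
  using P
proof (induction "card (up Y P)" arbitrary: P rule: less_induct)
  case less
  define F where "F P = Abs_fps (\<lambda>n. weighted_chains Y m n P)" for P
  let ?k = "\<lambda>P. rat_of_int (reduced_euler_char (up Y P))"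
  \<comment> \<open>Moving the term in \<open>F P\<close> of the recursion to the left leaves this
    factor, whose value at -1 is \<open>m P\<close>.\<close>
  let ?q = "[:1, - (of_nat (m P) - 1):] :: rat poly"
  have IH: "rat_value (fps_to_fls (F Q)) (- ?k Q / of_nat (m Q))" if "Q \<in> up Y P" for Q
  proof -
    have "up Y Q \<subset> up Y P" using that r_trans r_irrefl by blast
    hence "card (up Y Q) < card (up Y P)" using Y by (intro psubset_card_mono) auto
    thus ?thesis unfolding F_def using that by (intro less.hyps) auto
  qed
  have "F P * fps_of_poly ?q = 1 + fps_X * (\<Sum>Q\<in>up Y P. fps_const (of_nat (m Q)) * F Q)"
  proof (rule fps_ext)
    fix n
    have "F P * fps_of_poly ?q = F P + fps_const (1 - of_nat (m P)) * (fps_X * F P)"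
      by (simp add: fps_of_poly_pCons algebra_simps flip: fps_const_neg fps_const_sub)
    thus "(F P * fps_of_poly ?q) $ n = (1 + fps_X * (\<Sum>Q\<in>up Y P. fps_const (of_nat (m Q)) * F Q)) $ n"
      by (cases n) (simp_all add: F_def fps_sum_nth algebra_simps)
  qed
  hence "F P * fps_of_poly ?q =
      fps_of_poly 1 + fps_of_poly [:0, 1:] * (\<Sum>Q\<in>up Y P. fps_const (of_nat (m Q)) * F Q)"
    by (simp only: fps_of_poly_1 fps_of_poly_fps_X)
  hence "fps_to_fls (F P) * poly_to_fls ?q = poly_to_fls 1 + poly_to_fls [:0, 1:] *
       (\<Sum>Q\<in>up Y P. fls_const (of_nat (m Q)) * fps_to_fls (F Q))"
    by (simp only: fps_to_fls_plus flip: fls_times_fps_to_fls fps_to_fls_sum_const)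
  moreover have "rat_value (poly_to_fls 1 + poly_to_fls [:0, 1:] *
       (\<Sum>Q\<in>up Y P. fls_const (of_nat (m Q)) * fps_to_fls (F Q)))
       (poly 1 (- 1) + poly [:0, 1:] (- 1) * (\<Sum>Q\<in>up Y P. of_nat (m Q) * (- ?k Q / of_nat (m Q))))"
    using Y by (intro rat_value_add rat_value_poly rat_value_mult rat_value_sum IH) auto
  moreover have "(\<Sum>Q\<in>up Y P. of_nat (m Q) * (- ?k Q / of_nat (m Q))) = (\<Sum>Q\<in>up Y P. - ?k Q)"
  proof (rule sum.cong[OF refl])
    fix Q assume "Q \<in> up Y P"
    hence "m Q > 0" using m by blast
    thus "of_nat (m Q) * (- ?k Q / of_nat (m Q)) = - ?k Q" by simp
  qed
  moreover have "(\<Sum>Q\<in>up Y P. - ?k Q) = of_int (euler_char (up Y P))"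
    by (simp add: euler_char_up[OF Y])
  ultimately have "rat_value (fps_to_fls (F P) * poly_to_fls ?q) (- ?k P)"
    by (simp add: reduced_euler_char_def)
  hence "rat_value (fps_to_fls (F P)) (- ?k P / poly ?q (- 1))"
    using m[OF less.prems] by (intro rat_value_cancel) auto
  thus ?case by (simp add: F_def)
qed

end

subsection \<open>\<open>G\<close>-categories fibred over conjugates\<close>

context group
begin

text \<open>For an object \<open>(H, x S)\<close> with \<open>S\<close> normalizing \<open>H\<close> this is \<open>x H x\<^sup>-\<^sup>1\<close>.\<close>

definition conj_label :: "'a set \<times> 'a set \<Rightarrow> 'a set" where
  "conj_label = (\<lambda>(H, X). conj_set G (SOME x. x \<in> X) H)"

text \<open>Two representatives of the coset differ by an element of \<open>S\<close>, which
  conjugates \<open>H\<close> to itself.\<close>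

lemma conj_label_coset:
  assumes "H \<subseteq> carrier G" "subgroup S G" "x \<in> carrier G" "\<And>g. g \<in> S \<Longrightarrow> conj_set G g H = H"
  shows "conj_label (H, x <# S) = conj_set G x H"
proof -
  have "(SOME a. a \<in> x <# S) \<in> x <# S" by (rule someI[of _ x]) (rule lcos_self[OF assms(3,2)])
  then obtain s where s: "s \<in> S" "(SOME a. a \<in> x <# S) = x \<otimes> s" by (auto simp: l_coset_def)
  moreover have "s \<in> carrier G" using s subgroup.subset[OF assms(2)] by blast
  ultimately show ?thesis using assms by (simp add: conj_label_def conj_set_mult)
qed

lemma conj_set_psubset_iff:
  assumes "H \<subseteq> carrier G" "K \<subseteq> carrier G" "g \<in> carrier G"
  shows "conj_set G g H \<subset> conj_set G g K \<longleftrightarrow> H \<subset> K"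
proof -
  have "conj_set G g A \<subseteq> conj_set G g B \<longleftrightarrow> A \<subseteq> B" if "A \<subseteq> carrier G" "B \<subseteq> carrier G" for A B
  proof
    assume "conj_set G g A \<subseteq> conj_set G g B"
    hence "conj_set G (inv g) (conj_set G g A) \<subseteq> conj_set G (inv g) (conj_set G g B)"
      unfolding conj_set_eq[of G "inv g"] by (rule image_mono)
    thus "A \<subseteq> B" using that assms by (simp add: conj_set_inv)
  qed (auto simp: conj_set_eq)
  thus ?thesis using assms by (simp only: less_le_not_le)
qed

lemma rcos_conj:
  assumes "S \<subseteq> carrier G" "x \<in> carrier G"
  shows "x <# S = conj_set G x S #> x"
  using assms by (simp add: conj_set_def coset_mult_assoc l_coset_subset_G)

text \<open>Lagrange for both kinds of cosets. The objects with a given label correspond to right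
  cosets, whereas \<open>index\<close> counts left ones.\<close>

lemma card_lcosets_rcosets:
  assumes "finite (carrier G)" "subgroup H G"
  shows "card (lcosets H) = card (rcosets H)"
proof -
  have "card (lcosets H) * card H = card (rcosets H) * card H"
    using l_lagrange[OF assms] lagrange_finite[OF assms] by simp
  moreover have "card H \<noteq> 0"
    using subgroup.one_closed[OF assms(2)] finite_subset[OF subgroup.subset[OF assms(2)] assms(1)] by auto
  ultimately show ?thesis by simp
qed

end

text \<open>The object \<open>(H, x S H)\<close> has stabilizer \<open>x S H inv x\<close>, that is,
  \<open>S\<close> of its label. \<open>S_T\<close> is an adjunction: \<open>K\<close> is contained
  in \<open>S Q\<close> exactly when \<open>Q\<close> lies in the up-set of \<open>T K\<close>.
  \<open>D_thin\<close> and \<open>D_arr\<close> say that \<open>D\<close> is the preorder pulled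
  back along the label from \<open>\<C>\<close> ordered by \<open>r\<close>, and
  \<open>S_mono\<close> makes stabilizers grow along arrows.\<close>

locale conj_fibred_gcategory = finite_group_reps G \<R> + inclusion_order r
  for G :: "('a, 'b) monoid_scheme" (structure) and \<R> :: "'a set set" and r :: "'a set \<Rightarrow> 'a set \<Rightarrow> bool" +
  fixes \<C> :: "'a set set" and S T :: "'a set \<Rightarrow> 'a set"
    and D :: "('a, 'a set \<times> 'a set, 'm, 'z) gcat_scheme"
  assumes C_sub: "H \<in> \<C> \<Longrightarrow> subgroup H G"
    and C_conj: "\<lbrakk>H \<in> \<C>; g \<in> carrier G\<rbrakk> \<Longrightarrow> conj_set G g H \<in> \<C>"
    and S_sub: "H \<in> \<C> \<Longrightarrow> subgroup (S H) G"
    and S_conj: "\<lbrakk>H \<in> \<C>; g \<in> carrier G\<rbrakk> \<Longrightarrow> S (conj_set G g H) = conj_set G g (S H)"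
    and S_norm: "\<lbrakk>H \<in> \<C>; g \<in> S H\<rbrakk> \<Longrightarrow> conj_set G g H = H"
    and S_mono: "\<lbrakk>H \<in> \<C>; K \<in> \<C>; r H K\<rbrakk> \<Longrightarrow> S H \<subseteq> S K"
    and S_T: "\<lbrakk>Q \<in> \<C>; subgroup K G\<rbrakk> \<Longrightarrow> K \<subseteq> S Q \<longleftrightarrow> T K = Q \<or> r (T K) Q"
    and r_conj: "\<lbrakk>H \<in> \<C>; K \<in> \<C>; g \<in> carrier G; r H K\<rbrakk> \<Longrightarrow> r (conj_set G g H) (conj_set G g K)"
    and D_gcat: "finite_gcategory G D"
    and D_Obj: "Obj D = Sigma \<C> (\<lambda>H. lcosets (S H))"
    and D_act: "\<lbrakk>g \<in> carrier G; H \<in> \<C>; X \<in> lcosets (S H)\<rbrakk> \<Longrightarrow> obj_act D g (H, X) = (H, g <# X)"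
    and D_thin: "\<lbrakk>a \<in> Arr D; b \<in> Arr D; Dom D a = Dom D b; Cod D a = Cod D b\<rbrakk> \<Longrightarrow> a = b"
    and D_arr: "\<lbrakk>z \<in> Obj D; z' \<in> Obj D\<rbrakk> \<Longrightarrow> (\<exists>a\<in>Arr D. Dom D a = z \<and> Cod D a = z') \<longleftrightarrow>
      conj_label z = conj_label z' \<or> r (conj_label z) (conj_label z')"
begin

lemma C_subset: "H \<in> \<C> \<Longrightarrow> H \<subseteq> carrier G"
  using C_sub subgroup.subset by blast

lemma S_subset: "H \<in> \<C> \<Longrightarrow> S H \<subseteq> carrier G"
  using S_sub subgroup.subset by blast

lemma finite_C: "finite \<C>"
  by (rule finite_subset[of _ "Pow (carrier G)"]) (use C_subset finite_carrier in auto)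

lemma ObjE:
  assumes "z \<in> Obj D"
  obtains H x where "H \<in> \<C>" "x \<in> carrier G" "z = (H, x <# S H)"
  using assms by (auto simp: D_Obj LCOSETS_def)

lemma label: "\<lbrakk>H \<in> \<C>; x \<in> carrier G\<rbrakk> \<Longrightarrow> conj_label (H, x <# S H) = conj_set G x H"
  by (intro conj_label_coset C_subset S_sub S_norm)

lemma label_in: "z \<in> Obj D \<Longrightarrow> conj_label z \<in> \<C>"
  by (erule ObjE) (simp add: label C_conj)

lemma finite_Obj: "finite (Obj D)"
  using D_gcat by (simp add: finite_gcategory_def finite_category_def)

abbreviation mult :: "'a set \<Rightarrow> nat" where "mult Q \<equiv> index G (S Q)"

text \<open>The objects over \<open>Q\<close> correspond to the right cosets of \<open>S Q\<close>, because \<open>x S H = S Q x\<close> for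
  \<open>Q = x H x\<^sup>-\<^sup>1\<close>.\<close>

lemma card_fibre:
  assumes Q: "Q \<in> \<C>"
  shows "card {z \<in> Obj D. conj_label z = Q} = mult Q"
proof -
  let ?F = "{z \<in> Obj D. conj_label z = Q}"
  have "inj_on snd ?F"
  proof (rule inj_onI)
    fix z z' assume z: "z \<in> ?F" "z' \<in> ?F" and e: "snd z = snd z'"
    obtain H x where H: "H \<in> \<C>" "x \<in> carrier G" "z = (H, x <# S H)" using z by (auto elim: ObjE)
    obtain H' x' where H': "H' \<in> \<C>" "x' \<in> carrier G" "z' = (H', x' <# S H')" using z by (auto elim: ObjE)
    \<comment> \<open>With \<open>x\<close> as a common representative of both cosets, equal labels
      become equal conjugates by the same element, which forces \<open>H' = H\<close>.\<close>
    have "x \<in> x' <# S H'" using e lcos_self[OF H(2) S_sub[OF H(1)]] by (simp add: H H')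
    hence "z' = (H', x <# S H')" using l_repr_independence[OF _ H'(2) S_sub[OF H'(1)]] by (simp add: H')
    hence "conj_set G x H' = conj_set G x H" using z by (simp add: H H' label)
    hence "H' = H" using conj_set_inv[OF C_subset[OF H(1)] H(2)] conj_set_inv[OF C_subset[OF H'(1)] H(2)] by metis
    thus "z = z'" using e by (simp add: H H')
  qed
  moreover have "snd ` ?F = rcosets (S Q)"
  proof (intro equalityI subsetI)
    fix X assume "X \<in> snd ` ?F"
    then obtain z where z: "z \<in> ?F" "X = snd z" by blast
    then obtain H x where H: "H \<in> \<C>" "x \<in> carrier G" "z = (H, x <# S H)" by (auto elim: ObjE)
    have "Q = conj_set G x H" using z label[OF H(1,2)] by (simp add: H)
    hence "X = S Q #> x" using rcos_conj[OF S_subset[OF H(1)] H(2)] z by (simp add: H S_conj)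
    thus "X \<in> rcosets (S Q)" using H by (auto simp: RCOSETS_def)
  next
    fix X assume "X \<in> rcosets (S Q)"
    then obtain x where x: "x \<in> carrier G" "X = S Q #> x" by (auto simp: RCOSETS_def)
    define H where "H = conj_set G (inv x) Q"
    have H: "H \<in> \<C>" using Q x by (simp add: H_def C_conj)
    have QH: "Q = conj_set G x H" using conj_set_inv[OF C_subset[OF Q], of "inv x"] x by (simp add: H_def)
    have "X = x <# S H" using rcos_conj[OF S_subset[OF H] x(1)] H x by (simp add: QH S_conj)
    moreover have "(H, x <# S H) \<in> ?F" using H x by (auto simp: label QH D_Obj LCOSETS_def)
    ultimately show "X \<in> snd ` ?F" by (force simp: image_iff)
  qed
  ultimately have "card ?F = card (rcosets (S Q))" using card_image[of snd ?F] by simp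
  thus ?thesis using card_lcosets_rcosets[OF finite_carrier S_sub[OF Q]] by (simp add: index_def)
qed

lemma mult_pos: "Q \<in> \<C> \<Longrightarrow> mult Q > 0"
proof -
  assume Q: "Q \<in> \<C>"
  have "finite (lcosets (S Q))" "\<one> <# S Q \<in> lcosets (S Q)"
    using finite_carrier by (auto simp: LCOSETS_def)
  thus ?thesis unfolding index_def by (auto simp: card_gt_0_iff)
qed

lemma mult_conj:
  assumes "Q \<in> \<C>" "g \<in> carrier G"
  shows "mult (conj_set G g Q) = mult Q"
proof -
  have s: "subgroup (S Q) G" "subgroup (conj_set G g (S Q)) G"
    using assms by (simp_all add: S_sub subgroup_conj_set)
  have "card (lcosets (conj_set G g (S Q))) * card (S Q) = card (lcosets (S Q)) * card (S Q)"
    using l_lagrange[OF finite_carrier s(1)] l_lagrange[OF finite_carrier s(2)]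
      card_conj_set[OF subgroup.subset[OF s(1)] assms(2)] by simp
  moreover have "card (S Q) \<noteq> 0" using finite_sub[OF s(1)] subgroup.one_closed[OF s(1)] by auto
  ultimately show ?thesis by (simp add: index_def S_conj assms)
qed

abbreviation U :: "nat \<Rightarrow> 'a set \<Rightarrow> rat" where "U \<equiv> weighted_chains \<C> mult"

text \<open>Conjugation by \<open>g\<close> is an automorphism of the poset that preserves
  \<open>mult\<close>. Hence the number of chains starting at \<open>(P, X)\<close>, found through
  its label, depends on \<open>P\<close> alone.\<close>

lemma U_conj:
  assumes "P \<in> \<C>" "g \<in> carrier G"
  shows "U n (conj_set G g P) = U n P"
  using assms(1)
proof (induction n arbitrary: P)
  case (Suc n)
  have inv1: "conj_set G (inv g) (conj_set G g Q) = Q" if "Q \<in> \<C>" for Q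
    using conj_set_inv[OF C_subset[OF that] assms(2)] .
  have inv2: "conj_set G g (conj_set G (inv g) Q) = Q" if "Q \<in> \<C>" for Q
    using conj_set_inv[OF C_subset[OF that], of "inv g"] assms(2) by simp
  have "(\<Sum>Q\<in>up \<C> (conj_set G g P). of_nat (mult Q) * U n Q) = (\<Sum>Q\<in>up \<C> P. of_nat (mult Q) * U n Q)"
  proof (rule sum.reindex_bij_witness[of _ "conj_set G g" "conj_set G (inv g)"])
    fix Q assume "Q \<in> up \<C> (conj_set G g P)"
    hence Q: "Q \<in> \<C>" "r (conj_set G g P) Q" by auto
    have "r (conj_set G (inv g) (conj_set G g P)) (conj_set G (inv g) Q)"
      using Q assms Suc.prems by (intro r_conj) (auto simp: C_conj)
    thus "conj_set G (inv g) Q \<in> up \<C> P" using Q assms Suc.prems by (simp add: inv1 C_conj)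
    show "conj_set G g (conj_set G (inv g) Q) = Q" using Q by (simp add: inv2)
    show "of_nat (mult (conj_set G (inv g) Q)) * U n (conj_set G (inv g) Q) = of_nat (mult Q) * U n Q"
      using Suc.IH[of "conj_set G (inv g) Q"] mult_conj[of "conj_set G (inv g) Q" g] Q assms
      by (simp add: inv2 C_conj)
  next
    fix Q assume "Q \<in> up \<C> P"
    thus "conj_set G g Q \<in> up \<C> (conj_set G g P)" "conj_set G (inv g) (conj_set G g Q) = Q"
      using assms Suc.prems by (auto simp: r_conj C_conj inv1)
  qed
  thus ?case using Suc assms(2) by (simp add: mult_conj)
qed simp

section \<open>Counting chains by their initial object\<close>

definition paths :: "nat \<Rightarrow> 'a set \<times> 'a set \<Rightarrow> 'm list set" where
  "paths n z = {ms. nonid_path D z ms \<and> length ms = n}"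

lemma D_cat:
  "finite (Arr D)"
  "a \<in> Arr D \<Longrightarrow> Dom D a \<in> Obj D" "a \<in> Arr D \<Longrightarrow> Cod D a \<in> Obj D"
  "z \<in> Obj D \<Longrightarrow> Id D z \<in> Arr D" "z \<in> Obj D \<Longrightarrow> Dom D (Id D z) = z" "z \<in> Obj D \<Longrightarrow> Cod D (Id D z) = z"
  using D_gcat by (simp_all add: finite_gcategory_def finite_category_def)

lemma D_equivariant:
  "\<lbrakk>g \<in> carrier G; a \<in> Arr D\<rbrakk> \<Longrightarrow> Dom D (arr_act D g a) = obj_act D g (Dom D a)"
  "\<lbrakk>g \<in> carrier G; a \<in> Arr D\<rbrakk> \<Longrightarrow> Cod D (arr_act D g a) = obj_act D g (Cod D a)"
  "\<lbrakk>g \<in> carrier G; z \<in> Obj D\<rbrakk> \<Longrightarrow> arr_act D g (Id D z) = Id D (obj_act D g z)"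
  using D_gcat by (simp_all add: finite_gcategory_def)

lemma gset_Obj: "finite_gset G (Obj D, obj_act D)" and gset_Arr: "finite_gset G (Arr D, arr_act D)"
  using D_gcat by (simp_all add: finite_gset_def finite_gcategory_def finite_category_def)

lemmas Obj_act = finite_gsetD[OF gset_Obj, simplified fst_conv snd_conv]
lemmas Arr_act = finite_gsetD[OF gset_Arr, simplified fst_conv snd_conv]

lemma nonid_path_Obj: "nonid_path D z ms \<Longrightarrow> z \<in> Obj D"
  by (cases ms) (auto simp: D_cat)

lemma nonid_path_Arr: "nonid_path D z ms \<Longrightarrow> set ms \<subseteq> Arr D"
proof (induction ms arbitrary: z)
  case (Cons a ms)
  thus ?case using Cons.IH[of "Cod D a"] by simp
qed simp

lemma finite_paths: "finite (paths n z)"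
  by (rule finite_subset[OF _ finite_lists_length_eq[OF D_cat(1), of n]])
    (auto simp: paths_def dest: nonid_path_Arr)

text \<open>In a thin category the first arrow of a chain is determined by its target, which is
  either another object with the same label or any object with a label further up; each label
  \<open>Q\<close> has \<open>mult Q\<close> objects.\<close>

lemma card_paths: "z \<in> Obj D \<Longrightarrow> of_nat (card (paths n z)) = U n (conj_label z)"
proof (induction n arbitrary: z)
  case 0
  have "paths 0 z = {[]}" using 0 by (auto simp: paths_def)
  thus ?case by simp
next
  case (Suc n)
  note z = Suc.prems
  define A where "A = {a \<in> Arr D. Dom D a = z \<and> a \<noteq> Id D z}"
  \<comment> \<open>\<open>z' \<noteq> z\<close> removes the identity, the only endomorphism of
    \<open>z\<close>, and is the origin of the \<open>- 1\<close> in
    \<open>weighted_chains\<close>.\<close>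
  define B where "B = {z' \<in> Obj D. z' \<noteq> z \<and> (conj_label z = conj_label z' \<or> r (conj_label z) (conj_label z'))}"
  have A: "finite A" using D_cat(1) by (simp add: A_def)
  have "bij_betw (\<lambda>(a, ms). a # ms) (Sigma A (\<lambda>a. paths n (Cod D a))) (paths (Suc n) z)"
  proof (rule bij_betwI[where g = "\<lambda>ms. (hd ms, tl ms)"])
    show "(\<lambda>ms. (hd ms, tl ms)) \<in> paths (Suc n) z \<rightarrow> Sigma A (\<lambda>a. paths n (Cod D a))"
      by (auto simp: paths_def A_def length_Suc_conv)
  qed (auto simp: paths_def A_def length_Suc_conv)
  hence "card (paths (Suc n) z) = card (Sigma A (\<lambda>a. paths n (Cod D a)))" by (simp add: bij_betw_same_card)
  also have "\<dots> = (\<Sum>a\<in>A. card (paths n (Cod D a)))" using A finite_paths by (simp add: card_SigmaI)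
  also have "\<dots> = (\<Sum>z'\<in>B. card (paths n z'))"
  proof (rule sum.reindex_bij_betw)
    have "inj_on (Cod D) A" by (rule inj_onI) (auto simp: A_def intro: D_thin)
    moreover have "Cod D ` A = B"
    proof (intro equalityI subsetI)
      fix z' assume "z' \<in> Cod D ` A"
      then obtain a where a: "a \<in> Arr D" "Dom D a = z" "a \<noteq> Id D z" "z' = Cod D a" by (auto simp: A_def)
      have "z' \<noteq> z" using D_thin[OF a(1) D_cat(4)[OF z]] a D_cat(5,6)[OF z] by auto
      thus "z' \<in> B" using D_arr[OF z, of z'] a by (auto simp: B_def D_cat)
    next
      fix z' assume z': "z' \<in> B"
      then obtain a where "a \<in> Arr D" "Dom D a = z" "Cod D a = z'" using D_arr[OF z, of z'] by (auto simp: B_def)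
      moreover have "a \<noteq> Id D z" using z' calculation D_cat(6)[OF z] by (auto simp: B_def)
      ultimately show "z' \<in> Cod D ` A" by (auto simp: A_def)
    qed
    ultimately show "bij_betw (Cod D) A B" by (simp add: bij_betw_def)
  qed
  finally have "rat_of_nat (card (paths (Suc n) z)) = (\<Sum>z'\<in>B. U n (conj_label z'))"
    using Suc.IH by (simp add: B_def)
  also have "\<dots> = (\<Sum>Q\<in>insert (conj_label z) (up \<C> (conj_label z)). \<Sum>z'\<in>{z' \<in> B. conj_label z' = Q}. U n (conj_label z'))"
    using finite_C finite_Obj by (intro sum.group[symmetric]) (auto simp: B_def label_in)
  also have "\<dots> = (\<Sum>z'\<in>{z' \<in> B. conj_label z' = conj_label z}. U n (conj_label z')) +
      (\<Sum>Q\<in>up \<C> (conj_label z). \<Sum>z'\<in>{z' \<in> B. conj_label z' = Q}. U n (conj_label z'))"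
    using finite_C r_irrefl by (subst sum.insert) auto
  also have "(\<Sum>z'\<in>{z' \<in> B. conj_label z' = conj_label z}. U n (conj_label z')) =
      (of_nat (mult (conj_label z)) - 1) * U n (conj_label z)"
  proof -
    let ?E = "{z' \<in> Obj D. conj_label z' = conj_label z}"
    have "{z' \<in> B. conj_label z' = conj_label z} = ?E - {z}" by (auto simp: B_def)
    moreover have "card (?E - {z}) = mult (conj_label z) - 1"
      using z card_fibre[OF label_in[OF z]] by (subst card_Diff_singleton) auto
    moreover have "mult (conj_label z) > 0" by (rule mult_pos[OF label_in[OF z]])
    ultimately show ?thesis by (simp add: of_nat_diff)
  qed
  also have "(\<Sum>Q\<in>up \<C> (conj_label z). \<Sum>z'\<in>{z' \<in> B. conj_label z' = Q}. U n (conj_label z')) =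
      (\<Sum>Q\<in>up \<C> (conj_label z). of_nat (mult Q) * U n Q)"
  proof (rule sum.cong[OF refl])
    fix Q assume Q: "Q \<in> up \<C> (conj_label z)"
    have "{z' \<in> B. conj_label z' = Q} = {z' \<in> Obj D. conj_label z' = Q}"
      using Q r_irrefl by (auto simp: B_def)
    thus "(\<Sum>z'\<in>{z' \<in> B. conj_label z' = Q}. U n (conj_label z')) = of_nat (mult Q) * U n Q"
      using card_fibre[of Q] Q by simp
  qed
  finally show ?case by simp
qed

section \<open>The G-set of chains and its fixed points\<close>

definition Ch :: "nat \<Rightarrow> (('a set \<times> 'a set) \<times> 'm list) set" where
  "Ch n = {(z, ms). nonid_path D z ms \<and> length ms = n}"

lemma chain_gset_eq: "chain_gset D n = (Ch n, \<lambda>g. \<lambda>(z, ms)\<in>Ch n. (obj_act D g z, map (arr_act D g) ms))"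
  by (simp add: chain_gset_def Ch_def Let_def)

lemma nonid_path_act:
  assumes "nonid_path D z ms" "g \<in> carrier G"
  shows "nonid_path D (obj_act D g z) (map (arr_act D g) ms)"
  using assms(1)
proof (induction ms arbitrary: z)
  case Nil
  thus ?case using assms(2) Obj_act(2) by simp
next
  case (Cons a ms)
  hence a: "a \<in> Arr D" "Dom D a = z" "a \<noteq> Id D z" by auto
  hence z: "z \<in> Obj D" using D_cat(2) by auto
  have "arr_act D g a \<noteq> Id D (obj_act D g z)"
  proof
    assume "arr_act D g a = Id D (obj_act D g z)"
    hence "arr_act D (inv g) (arr_act D g a) = arr_act D (inv g) (arr_act D g (Id D z))"
      using D_equivariant(3)[OF assms(2) z] by simp
    thus False using a Arr_act(5)[OF assms(2)] D_cat(4)[OF z] by simp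
  qed
  thus ?case using Cons a assms(2) Arr_act(2) D_equivariant(1,2) by auto
qed

lemma Ch_eq_Sigma: "Ch n = Sigma (Obj D) (paths n)"
  by (auto simp: Ch_def paths_def dest: nonid_path_Obj)

lemma finite_chain_gset: "finite_gset G (chain_gset D n)"
  unfolding chain_gset_eq
proof (rule finite_gsetI, unfold fst_conv snd_conv)
  show "finite (Ch n)" unfolding Ch_eq_Sigma using finite_Obj finite_paths by auto
  have cl: "(obj_act D g z, map (arr_act D g) ms) \<in> Ch n" if "g \<in> carrier G" "(z, ms) \<in> Ch n" for g z ms
    using that nonid_path_act by (simp add: Ch_def)
  show "(\<lambda>(z, ms)\<in>Ch n. (obj_act D g z, map (arr_act D g) ms)) c \<in> Ch n"
    if "g \<in> carrier G" "c \<in> Ch n" for g c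
    using that cl[of g "fst c" "snd c"] by (simp add: case_prod_unfold)
  have set: "z \<in> Obj D" "set ms \<subseteq> Arr D" if "(z, ms) \<in> Ch n" for z ms
    using that nonid_path_Obj[of z ms] nonid_path_Arr[of z ms] by (simp_all add: Ch_def)
  show "(\<lambda>(z, ms)\<in>Ch n. (obj_act D \<one> z, map (arr_act D \<one>) ms)) c = c" if "c \<in> Ch n" for c
    using that set[of "fst c" "snd c"] Obj_act(3) Arr_act(3)
    by (auto simp: case_prod_unfold subset_iff intro!: prod_eqI map_idI)
  show "(\<lambda>(z, ms)\<in>Ch n. (obj_act D (g \<otimes> h) z, map (arr_act D (g \<otimes> h)) ms)) c =
      (\<lambda>(z, ms)\<in>Ch n. (obj_act D g z, map (arr_act D g) ms))
        ((\<lambda>(z, ms)\<in>Ch n. (obj_act D h z, map (arr_act D h) ms)) c)"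
    if "g \<in> carrier G" "h \<in> carrier G" "c \<in> Ch n" for g h c
    using that set[of "fst c" "snd c"] cl[of h "fst c" "snd c"] Obj_act(4) Arr_act(4)
    by (auto simp: case_prod_unfold subset_iff)
qed auto

text \<open>Phrased through the label so that these objects can be grouped either by first component
  or by label; \<open>fixed_objects_iff\<close> identifies them as the objects that every element of
  \<open>K\<close> fixes.\<close>

definition fixed_objects :: "'a set \<Rightarrow> ('a set \<times> 'a set) set" where
  "fixed_objects K = {z \<in> Obj D. K \<subseteq> S (conj_label z)}"

lemma fixed_objects_Sigma:
  assumes "K \<subseteq> carrier G"
  shows "fixed_objects K = Sigma \<C> (\<lambda>P. fixed_points (coset_gset G (S P)) K)"
proof -
  have "(H, X) \<in> fixed_objects K \<longleftrightarrow> X \<in> fixed_points (coset_gset G (S H)) K"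
    if H: "H \<in> \<C>" "X \<in> lcosets (S H)" for H X
  proof -
    obtain x where x: "x \<in> carrier G" "X = x <# S H" using H by (auto simp: LCOSETS_def)
    have "(H, X) \<in> fixed_objects K \<longleftrightarrow> K \<subseteq> conj_set G x (S H)"
      using H x by (simp add: fixed_objects_def D_Obj label S_conj)
    thus ?thesis using fixed_points_coset[OF S_sub[OF H(1)] x(1) assms] x by simp
  qed
  thus ?thesis by (auto simp: fixed_objects_def D_Obj fixed_points_def)
qed

lemma fixed_objects_iff:
  assumes "K \<subseteq> carrier G" "z \<in> Obj D"
  shows "z \<in> fixed_objects K \<longleftrightarrow> (\<forall>g\<in>K. obj_act D g z = z)"
proof -
  obtain H X where z: "z = (H, X)" "H \<in> \<C>" "X \<in> lcosets (S H)" using assms(2) by (auto simp: D_Obj)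
  have "z \<in> fixed_objects K \<longleftrightarrow> X \<in> fixed_points (coset_gset G (S H)) K"
    using z by (simp add: fixed_objects_Sigma[OF assms(1)])
  also have "\<dots> \<longleftrightarrow> (\<forall>g\<in>K. obj_act D g z = z)"
    using z assms(1) D_act by (auto simp: fixed_points_def coset_gset_def subset_iff)
  finally show ?thesis .
qed

text \<open>A chain is fixed as soon as its initial object is, since stabilizers grow along arrows.\<close>

lemma path_fixed:
  assumes "nonid_path D z ms" "K \<subseteq> carrier G" "z \<in> fixed_objects K" "g \<in> K"
  shows "map (arr_act D g) ms = ms"
  using assms(1,3)
proof (induction ms arbitrary: z)
  case (Cons a ms)
  hence a: "a \<in> Arr D" "Dom D a = z" and ms: "nonid_path D (Cod D a) ms" by auto
  have z: "z \<in> Obj D" "Cod D a \<in> Obj D" using a D_cat by auto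
  have "conj_label z = conj_label (Cod D a) \<or> r (conj_label z) (conj_label (Cod D a))"
    using D_arr[OF z] a by blast
  hence "S (conj_label z) \<subseteq> S (conj_label (Cod D a))"
    using S_mono[OF label_in[OF z(1)] label_in[OF z(2)]] by auto
  hence c: "Cod D a \<in> fixed_objects K" using Cons.prems z by (auto simp: fixed_objects_def)
  have g: "g \<in> carrier G" using assms by blast
  have "arr_act D g a = a"
  proof (rule D_thin)
    show "arr_act D g a \<in> Arr D" using Arr_act(2) g a by blast
    show "Dom D (arr_act D g a) = Dom D a"
      using D_equivariant(1)[OF g a(1)] fixed_objects_iff[OF assms(2) z(1)] Cons.prems a assms(4) by simp
    show "Cod D (arr_act D g a) = Cod D a"
      using D_equivariant(2)[OF g a(1)] fixed_objects_iff[OF assms(2) z(2)] c assms(4) by simp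
  qed (rule a)
  thus ?case using Cons.IH[OF ms c] by simp
qed simp

text \<open>By \<open>path_fixed\<close> the fixed chains are all chains whose initial object is
  fixed, and \<open>card_paths\<close> counts them.\<close>

lemma mark_chain_gset:
  assumes K: "K \<subseteq> carrier G"
  shows "mark G K (gclass G (chain_gset D n)) = (\<Sum>z\<in>fixed_objects K. U n (conj_label z))"
proof -
  have "fixed_points (chain_gset D n) K = Sigma (fixed_objects K) (paths n)"
  proof (intro equalityI subsetI)
    fix c assume c: "c \<in> fixed_points (chain_gset D n) K"
    obtain z ms where zm: "c = (z, ms)" by (cases c)
    have "(z, ms) \<in> Ch n" "\<And>g. g \<in> K \<Longrightarrow> obj_act D g z = z"
      using c by (auto simp: zm fixed_points_def chain_gset_eq)
    thus "c \<in> Sigma (fixed_objects K) (paths n)"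
      using fixed_objects_iff[OF K, of z] by (simp add: zm Ch_eq_Sigma)
  next
    fix c assume c: "c \<in> Sigma (fixed_objects K) (paths n)"
    then obtain z ms where zm: "c = (z, ms)" "z \<in> fixed_objects K" "ms \<in> paths n z" by auto
    have z: "z \<in> Obj D" using zm by (simp add: fixed_objects_def)
    have "(z, ms) \<in> Ch n" using z zm by (simp add: Ch_eq_Sigma)
    moreover have "obj_act D g z = z \<and> map (arr_act D g) ms = ms" if "g \<in> K" for g
      using fixed_objects_iff[OF K z] path_fixed[OF _ K zm(2) that, of ms] zm that by (simp add: paths_def)
    ultimately show "c \<in> fixed_points (chain_gset D n) K"
      by (simp add: zm(1) fixed_points_def chain_gset_eq)
  qed
  moreover have "finite (fixed_objects K)" using finite_Obj by (simp add: fixed_objects_def)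
  ultimately have "card (fixed_points (chain_gset D n) K) = (\<Sum>z\<in>fixed_objects K. card (paths n z))"
    using finite_paths by (simp add: card_SigmaI)
  thus ?thesis
    by (simp add: mark_gclass[OF K finite_chain_gset] card_paths fixed_objects_def)
qed

lemma coset_S_closed: "P \<in> \<C> \<Longrightarrow> gclass G (coset_gset G (S P)) \<in> carrier (\<Omega> G)"
  by (intro gclass_closed finite_gset_coset S_sub)

text \<open>Comparison of marks. The objects fixed by \<open>K\<close> with first component
  \<open>P\<close> are the fixed points of the coset space of \<open>S P\<close>, and by
  \<open>U_conj\<close> each of them starts the same number \<open>U n P\<close> of chains.\<close>

lemma gclass_chain_gset:
  "gclass G (chain_gset D n) = (\<Oplus>\<^bsub>\<Omega> G\<^esub>P\<in>\<C>. U n P \<odot>\<^bsub>\<Omega> G\<^esub> gclass G (coset_gset G (S P)))"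
proof (rule Burnside_eqI)
  show "(\<Oplus>\<^bsub>\<Omega> G\<^esub>P\<in>\<C>. U n P \<odot>\<^bsub>\<Omega> G\<^esub> gclass G (coset_gset G (S P))) \<in> carrier (\<Omega> G)"
    by (intro B.ES.finsum_closed) (auto simp: B.smult_closed coset_S_closed)
  fix K assume "K \<in> \<R>"
  hence K: "K \<subseteq> carrier G" by (intro subgroup.subset reps_subgroup)
  have fin: "finite (fixed_points (coset_gset G (S P)) K)" if "P \<in> \<C>" for P
    using finite_gsetD(1)[OF finite_gset_coset[OF S_sub[OF that]]] by (auto simp: fixed_points_def)
  have "mark G K (gclass G (chain_gset D n)) =
      (\<Sum>P\<in>\<C>. \<Sum>X\<in>fixed_points (coset_gset G (S P)) K. U n (conj_label (P, X)))"
    unfolding mark_chain_gset[OF K] fixed_objects_Sigma[OF K]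
    using finite_C fin by (subst sum.Sigma) auto
  also have "\<dots> = (\<Sum>P\<in>\<C>. U n P * mark G K (gclass G (coset_gset G (S P))))"
  proof (rule sum.cong[OF refl])
    fix P assume P: "P \<in> \<C>"
    have "U n (conj_label (P, X)) = U n P" if "X \<in> fixed_points (coset_gset G (S P)) K" for X
      using that P by (auto simp: fixed_points_def LCOSETS_def label U_conj)
    thus "(\<Sum>X\<in>fixed_points (coset_gset G (S P)) K. U n (conj_label (P, X))) =
        U n P * mark G K (gclass G (coset_gset G (S P)))"
      by (simp add: mark_gclass[OF K finite_gset_coset[OF S_sub[OF P]]])
  qed
  also have "\<dots> = mark G K (\<Oplus>\<^bsub>\<Omega> G\<^esub>P\<in>\<C>. U n P \<odot>\<^bsub>\<Omega> G\<^esub> gclass G (coset_gset G (S P)))"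
    by (subst mark_finsum[OF K finite_C])
      (auto simp: B.smult_closed coset_S_closed mark_smult[OF K])
  finally show "mark G K (gclass G (chain_gset D n)) = \<dots>" .
qed (rule gclass_closed[OF finite_chain_gset])

section \<open>The value at -1 and its two expansions\<close>

abbreviation k :: "'a set \<Rightarrow> rat" where "k P \<equiv> - of_int (reduced_euler_char (up \<C> P))"

theorem series_Lefschetz_value:
  "series_Lefschetz_value G D (\<Oplus>\<^bsub>\<Omega> G\<^esub>P\<in>\<C>. (k P / of_nat (mult P)) \<odot>\<^bsub>\<Omega> G\<^esub> gclass G (coset_gset G (S P)))"
proof (rule series_Lefschetz_valueI[where u = "\<lambda>P n. U n P"])
  fix P assume "P \<in> \<C>"
  thus "rat_value (fps_to_fls (Abs_fps (\<lambda>n. U n P))) (k P / of_nat (mult P))"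
    by (intro weighted_chains_value[where m = mult] finite_C mult_pos)
qed (simp_all add: finite_C coset_S_closed gclass_chain_gset)

text \<open>Here fixed objects are grouped by label: over \<open>Q\<close> all \<open>mult Q\<close>
  objects are fixed if \<open>K\<close> lies in \<open>S Q\<close>, and none otherwise. By
  \<open>S_T\<close> these \<open>Q\<close> form the up-set of \<open>T K\<close>, over which the
  weights sum to 1 if \<open>T K\<close> is itself a member and to the Euler characteristic of the
  strict part if not.\<close>

theorem mark_series_Lefschetz:
  assumes "K \<in> \<R>"
  shows "mark G K (series_Lefschetz G D) = (if T K \<in> \<C> then 1 else of_int (euler_char (up \<C> (T K))))"
proof -
  have K: "subgroup K G" "K \<subseteq> carrier G" using assms reps_subgroup subgroup.subset by blast+
  define Y where "Y = {Q \<in> \<C>. K \<subseteq> S Q}"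
  have Y: "finite Y" using finite_C by (simp add: Y_def)
  have ser: "mark_series D K = (\<Sum>Q\<in>Y. fls_const (of_nat (mult Q)) * fps_to_fls (Abs_fps (\<lambda>n. U n Q)))"
  proof -
    have "mark G K (gclass G (chain_gset D n)) = (\<Sum>Q\<in>Y. of_nat (mult Q) * U n Q)" for n
    proof -
      have "mark G K (gclass G (chain_gset D n)) =
          (\<Sum>Q\<in>Y. \<Sum>z\<in>{z \<in> fixed_objects K. conj_label z = Q}. U n (conj_label z))"
        unfolding mark_chain_gset[OF K(2)] using Y finite_Obj
        by (intro sum.group[symmetric]) (auto simp: fixed_objects_def Y_def label_in)
      also have "\<dots> = (\<Sum>Q\<in>Y. of_nat (mult Q) * U n Q)"
      proof (rule sum.cong[OF refl])
        fix Q assume Q: "Q \<in> Y"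
        hence "{z \<in> fixed_objects K. conj_label z = Q} = {z \<in> Obj D. conj_label z = Q}"
          by (auto simp: fixed_objects_def Y_def)
        thus "(\<Sum>z\<in>{z \<in> fixed_objects K. conj_label z = Q}. U n (conj_label z)) = of_nat (mult Q) * U n Q"
          using card_fibre[of Q] Q by (simp add: Y_def)
      qed
      finally show ?thesis .
    qed
    thus ?thesis unfolding fps_to_fls_sum_const[symmetric]
      by (simp add: fps_eq_iff fps_sum_nth)
  qed
  have v1: "rat_value (\<Sum>Q\<in>Y. fls_const (of_nat (mult Q)) * fps_to_fls (Abs_fps (\<lambda>n. U n Q)))
      (\<Sum>Q\<in>Y. of_nat (mult Q) * (k Q / of_nat (mult Q)))"
    by (rule rat_value_sum[OF Y], rule weighted_chains_value)
      (auto simp: finite_C mult_pos Y_def)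
  have v2: "rat_value (mark_series D K) (mark G K (series_Lefschetz G D))"
    unfolding series_Lefschetz_eq[OF series_Lefschetz_value]
    by (rule series_Lefschetz_value_mark(2)[OF series_Lefschetz_value assms])
  have "mark G K (series_Lefschetz G D) = (\<Sum>Q\<in>Y. of_nat (mult Q) * (k Q / of_nat (mult Q)))"
    by (rule rat_value_unique[OF v2[unfolded ser] v1])
  also have "\<dots> = (\<Sum>Q\<in>Y. k Q)"
  proof (rule sum.cong[OF refl])
    fix Q assume "Q \<in> Y"
    hence "mult Q > 0" by (simp add: Y_def mult_pos)
    thus "of_nat (mult Q) * (k Q / of_nat (mult Q)) = k Q" by simp
  qed
  also have "\<dots> = (if T K \<in> \<C> then 1 else of_int (euler_char (up \<C> (T K))))"
  proof -
    have e: "of_int (euler_char (up \<C> (T K))) = (\<Sum>Q\<in>up \<C> (T K). k Q)"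
      by (simp add: euler_char_up[OF finite_C])
    show ?thesis
    proof (cases "T K \<in> \<C>")
      case True
      hence "Y = insert (T K) (up \<C> (T K))" using S_T[OF _ K(1)] by (auto simp: Y_def)
      hence "(\<Sum>Q\<in>Y. k Q) = k (T K) + (\<Sum>Q\<in>up \<C> (T K). k Q)"
        using finite_C r_irrefl by simp
      thus ?thesis using True e by (simp add: reduced_euler_char_def)
    next
      case False
      hence "Y = up \<C> (T K)" using S_T[OF _ K(1)] by (auto simp: Y_def)
      thus ?thesis using False e by simp
    qed
  qed
  finally show ?thesis .
qed

lemma mark_trivial_gset: "K \<subseteq> carrier G \<Longrightarrow> mark G K (gclass G (coset_gset G (carrier G))) = 1"
proof -
  assume K: "K \<subseteq> carrier G"
  have "a <# carrier G = \<one> <# carrier G" if "a \<in> carrier G" for a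
    using that by (intro lcos_eq_iff) (auto simp: subgroup_self)
  hence l: "fst (coset_gset G (carrier G)) = {\<one> <# carrier G}"
    unfolding fst_coset_gset LCOSETS_def using one_closed by blast
  have "snd (coset_gset G (carrier G)) g (\<one> <# carrier G) = \<one> <# carrier G" if "g \<in> K" for g
    using finite_gsetD(2)[OF finite_gset_coset[OF subgroup_self], unfolded l, of g "\<one> <# carrier G"]
      that K by blast
  hence "fixed_points (coset_gset G (carrier G)) K = {\<one> <# carrier G}"
    unfolding fixed_points_def l by blast
  thus ?thesis using mark_gclass[OF K finite_gset_coset[OF subgroup_self]] by simp
qed

theorem reduced_series_Lefschetz_cosets:
  "reduced_series_Lefschetz G D =
     (\<Oplus>\<^bsub>\<Omega> G\<^esub>P\<in>\<C>. (k P / of_nat (mult P)) \<odot>\<^bsub>\<Omega> G\<^esub> gclass G (coset_gset G (S P)))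
      \<ominus>\<^bsub>\<Omega> G\<^esub> gclass G (coset_gset G (carrier G))"
  by (simp add: reduced_series_Lefschetz_def series_Lefschetz_eq[OF series_Lefschetz_value])

text \<open>Where \<open>T K\<close> belongs to \<open>\<C>\<close> the mark is 1 and cancels
  against that of the trivial G-set; elsewhere subtracting 1 makes the Euler characteristic
  reduced.\<close>

theorem reduced_series_Lefschetz_idempotents:
  "reduced_series_Lefschetz G D =
     (\<Oplus>\<^bsub>\<Omega> G\<^esub>K\<in>{K \<in> \<R>. T K \<notin> \<C>}. of_int (reduced_euler_char (up \<C> (T K))) \<odot>\<^bsub>\<Omega> G\<^esub> burnside_idem G K)"
proof (rule Burnside_eqI)
  let ?R = "{K \<in> \<R>. T K \<notin> \<C>}" and ?x = "\<lambda>K. rat_of_int (reduced_euler_char (up \<C> (T K)))"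
  have L: "series_Lefschetz G D \<in> carrier (\<Omega> G)"
    unfolding series_Lefschetz_eq[OF series_Lefschetz_value]
    by (rule series_Lefschetz_value_mark(1)[OF series_Lefschetz_value])
  have pt: "gclass G (coset_gset G (carrier G)) \<in> carrier (\<Omega> G)"
    by (intro gclass_closed finite_gset_coset subgroup_self)
  have e: "burnside_idem G K \<in> carrier (\<Omega> G)" if "K \<in> \<R>" for K
    using burnside_idem(1) reps_subgroup that by blast
  show "reduced_series_Lefschetz G D \<in> carrier (\<Omega> G)"
    unfolding reduced_series_Lefschetz_def using L pt by simp
  show "(\<Oplus>\<^bsub>\<Omega> G\<^esub>K\<in>?R. ?x K \<odot>\<^bsub>\<Omega> G\<^esub> burnside_idem G K) \<in> carrier (\<Omega> G)"
    by (intro B.ES.finsum_closed) (auto simp: e B.smult_closed)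
  fix K assume KR: "K \<in> \<R>"
  hence K: "subgroup K G" "K \<subseteq> carrier G" using reps_subgroup subgroup.subset by blast+
  have "mark G K (\<Oplus>\<^bsub>\<Omega> G\<^esub>K\<in>?R. ?x K \<odot>\<^bsub>\<Omega> G\<^esub> burnside_idem G K) =
      (\<Sum>L\<in>?R. ?x L * (if conjugate_in G K L then 1 else 0))"
    using finite_reps K
    by (subst mark_finsum[OF K(2)]) (auto simp: e B.smult_closed mark_smult burnside_idem(2) reps_subgroup)
  also have "\<dots> = (\<Sum>L\<in>?R. if L = K then ?x K else 0)"
    using reps_unique[OF KR] conjugate_in_refl[OF K(1)] by (intro sum.cong) auto
  also have "\<dots> = (if T K \<notin> \<C> then ?x K else 0)"
    using finite_reps KR by (subst sum.delta) auto
  also have "\<dots> = mark G K (reduced_series_Lefschetz G D)"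
    unfolding reduced_series_Lefschetz_def mark_minus[OF K(2) L pt] mark_series_Lefschetz[OF KR]
      mark_trivial_gset[OF K(2)] by (simp add: reduced_euler_char_def)
  finally show "mark G K (reduced_series_Lefschetz G D) =
      mark G K (\<Oplus>\<^bsub>\<Omega> G\<^esub>K\<in>?R. ?x K \<odot>\<^bsub>\<Omega> G\<^esub> burnside_idem G K)" by simp
qed

lemma has_series_Lefschetz: "has_series_Lefschetz G D"
  unfolding has_series_Lefschetz_def using series_Lefschetz_value by blast

end

subsection \<open>The categories \<open>EO\<close> and \<open>EA\<close>\<close>

interpretation psubset: inclusion_order "(\<subset>)"
  by unfold_locales auto

interpretation psupset: inclusion_order "\<lambda>A B. B \<subset> A"
  by unfold_locales auto

context group
begin

text \<open>An equivariant map can only enlarge stabilizers, and these are the two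
  conjugates.\<close>

lemma coset_gmap_fixed:
  fixes f :: "'a set \<Rightarrow> 'a set"
  assumes H: "subgroup H G" and K: "subgroup K G" and x: "x \<in> carrier G" "y \<in> carrier G"
    and f: "f \<in> gmaps G (coset_gset G H) (coset_gset G K)" "f (x <# H) = y <# K"
  shows "conj_set G x H \<subseteq> conj_set G y K"
proof
  fix g assume g: "g \<in> conj_set G x H"
  have gc: "g \<in> carrier G" using g subgroup.subset[OF subgroup_conj_set[OF H x(1)]] by blast
  have l: "x <# H \<in> lcosets H" "y <# K \<in> lcosets K" using x by (auto simp: LCOSETS_def)
  have "g <# (x <# H) = x <# H" using coset_fixed_iff[OF H x(1) gc] g by simp
  moreover have "f (snd (coset_gset G H) g (x <# H)) = snd (coset_gset G K) g (f (x <# H))"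
    using f(1) gc l by (intro gmaps_app(2)) auto
  ultimately have "g <# (y <# K) = y <# K" using l f(2) by (simp add: coset_gset_def)
  thus "g \<in> conj_set G y K" using coset_fixed_iff[OF K x(2) gc] by simp
qed

text \<open>A coset space is transitive, so one value determines the map; this is the source of
  thinness for \<open>EO\<close>.\<close>

lemma coset_gmap_unique:
  fixes f f' :: "'a set \<Rightarrow> 'y"
  assumes H: "subgroup H G" and x: "x \<in> carrier G"
    and f: "f \<in> gmaps G (coset_gset G H) Y" "f' \<in> gmaps G (coset_gset G H) Y" "f (x <# H) = f' (x <# H)"
  shows "f = f'"
proof (rule extensionalityI[where A = "lcosets H"])
  show "f \<in> extensional (lcosets H)" "f' \<in> extensional (lcosets H)"
    using f by (auto simp: gmaps_def PiE_iff)
  fix X assume "X \<in> lcosets H"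
  then obtain z where z: "z \<in> carrier G" "X = z <# H" by (auto simp: LCOSETS_def)
  have l: "x <# H \<in> lcosets H" using x by (auto simp: LCOSETS_def)
  have X: "X = snd (coset_gset G H) (z \<otimes> inv x) (x <# H)"
    using z x l subgroup.subset[OF H] by (simp add: coset_gset_def lcos_m_assoc m_assoc)
  have e: "h X = snd Y (z \<otimes> inv x) (h (x <# H))" if "h \<in> gmaps G (coset_gset G H) Y" for h
    unfolding X using that x z l by (intro gmaps_app(2)) auto
  show "f X = f' X" by (simp only: e[OF f(1)] e[OF f(2)] f(3))
qed

text \<open>The map is right multiplication, sending \<open>z H\<close> to \<open>z g K\<close>,
  with \<open>g\<close> chosen so that \<open>x H\<close> goes to \<open>y K\<close>. It is well
  defined because \<open>inv g h g\<close> lies in \<open>K\<close> for every \<open>h\<close> in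
  \<open>H\<close>, which is the inclusion of stabilizers rewritten.\<close>

lemma coset_gmap_exists:
  assumes H: "subgroup H G" and K: "subgroup K G" and x: "x \<in> carrier G" "y \<in> carrier G"
    and sub: "conj_set G x H \<subseteq> conj_set G y K"
  shows "\<exists>f\<in>gmaps G (coset_gset G H) (coset_gset G K). f (x <# H) = y <# K"
proof -
  define g where "g = inv x \<otimes> y"
  have g: "g \<in> carrier G" using x by (simp add: g_def)
  have Hc: "H \<subseteq> carrier G" and Kc: "K \<subseteq> carrier G" by (fact subgroup.subset[OF H], fact subgroup.subset[OF K])
  define f where "f = (\<lambda>X\<in>lcosets H. ((SOME a. a \<in> X) \<otimes> g) <# K)"
  have f: "f (z <# H) = (z \<otimes> g) <# K" if z: "z \<in> carrier G" for z
  proof -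
    have "(SOME a. a \<in> z <# H) \<in> z <# H" by (rule someI[of _ z]) (rule lcos_self[OF z H])
    then obtain h where h: "h \<in> H" "(SOME a. a \<in> z <# H) = z \<otimes> h" by (auto simp: l_coset_def)
    have hc: "h \<in> carrier G" using h Hc by blast
    have "x \<otimes> h \<otimes> inv x \<in> conj_set G y K" using sub h by (auto simp: conj_set_eq)
    hence "inv y \<otimes> (x \<otimes> h \<otimes> inv x) \<otimes> y \<in> K" using mem_conj_set_iff[OF Kc x(2)] x hc by simp
    moreover have "inv (z \<otimes> g) \<otimes> (z \<otimes> h \<otimes> g) = inv y \<otimes> (x \<otimes> h \<otimes> inv x) \<otimes> y"
    proof -
      have "inv z \<otimes> (z \<otimes> (h \<otimes> g)) = h \<otimes> g" using z hc g by (simp flip: m_assoc)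
      thus ?thesis using x z hc g by (simp add: inv_mult_group m_assoc) (simp add: g_def inv_mult_group m_assoc)
    qed
    ultimately have "(z \<otimes> g) <# K = (z \<otimes> h \<otimes> g) <# K"
      using z g hc by (intro lcos_eq_iff[OF K]) auto
    moreover have "z <# H \<in> lcosets H" using z by (auto simp: LCOSETS_def)
    ultimately show ?thesis using h by (simp add: f_def)
  qed
  have "f \<in> gmaps G (coset_gset G H) (coset_gset G K)"
    unfolding gmaps_def
  proof (intro CollectI conjI ballI)
    show "f \<in> fst (coset_gset G H) \<rightarrow>\<^sub>E fst (coset_gset G K)"
    proof (rule PiE_I)
      fix X assume "X \<in> fst (coset_gset G H)"
      then obtain z where z: "z \<in> carrier G" "X = z <# H" by (auto simp: LCOSETS_def)
      thus "f X \<in> fst (coset_gset G K)" using f g by (auto simp: LCOSETS_def)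
    qed (simp add: f_def)
    fix a X assume a: "a \<in> carrier G" and X: "X \<in> fst (coset_gset G H)"
    then obtain z where z: "z \<in> carrier G" "X = z <# H" by (auto simp: LCOSETS_def)
    have l: "z <# H \<in> lcosets H" "(z \<otimes> g) <# K \<in> lcosets K" using z g by (auto simp: LCOSETS_def)
    have "snd (coset_gset G H) a X = (a \<otimes> z) <# H"
      using l a z Hc by (simp add: coset_gset_def lcos_m_assoc)
    moreover have "snd (coset_gset G K) a ((z \<otimes> g) <# K) = (a \<otimes> z \<otimes> g) <# K"
      using l a z g Kc by (simp add: coset_gset_def lcos_m_assoc m_assoc)
    ultimately show "f (snd (coset_gset G H) a X) = snd (coset_gset G K) a (f X)"
      using f a z by simp
  qed
  moreover have "f (x <# H) = y <# K"
    using f[OF x(1)] x by (simp add: g_def flip: m_assoc)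
  ultimately show ?thesis by blast
qed

lemma conj_set_self: "\<lbrakk>subgroup H G; g \<in> H\<rbrakk> \<Longrightarrow> conj_set G g H = H"
proof -
  assume H: "subgroup H G" and g: "g \<in> H"
  have Hc: "H \<subseteq> carrier G" using H by (rule subgroup.subset)
  have gc: "g \<in> carrier G" using g Hc by blast
  have sub: "conj_set G a H \<subseteq> H" if "a \<in> H" for a
    using that H by (auto simp: conj_set_eq intro!: subgroup.m_closed subgroup.m_inv_closed)
  have "H = conj_set G g (conj_set G (inv g) H)"
    using conj_set_inv[OF Hc inv_closed[OF gc]] gc by simp
  also have "\<dots> \<subseteq> conj_set G g H"
    unfolding conj_set_eq[of G g] by (rule image_mono[OF sub[OF subgroup.m_inv_closed[OF H g]]])
  finally show "conj_set G g H = H" using sub[OF g] by blast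
qed

lemma conj_set_centralizer_self:
  assumes "H \<subseteq> carrier G" "g \<in> centralizer G H"
  shows "conj_set G g H = H"
proof -
  have "g \<otimes> h \<otimes> inv g = h" if "h \<in> H" for h
  proof -
    have "g \<in> carrier G" "h \<in> carrier G" "g \<otimes> h = h \<otimes> g" using assms that by (auto simp: centralizer_def)
    thus ?thesis by (simp add: m_assoc)
  qed
  thus ?thesis by (simp add: conj_set_eq)
qed

text \<open>Both directions are \<open>conj_centralizer\<close>, for \<open>g\<close> and for its
  inverse.\<close>

lemma centralizer_conj_set:
  assumes H: "H \<subseteq> carrier G" and g: "g \<in> carrier G"
  shows "centralizer G (conj_set G g H) = conj_set G g (centralizer G H)"
proof -
  have gH: "conj_set G g H \<subseteq> carrier G" using H g by (auto simp: conj_set_eq)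
  have C: "centralizer G A \<subseteq> carrier G" for A by (auto simp: centralizer_def)
  have "c \<in> centralizer G (conj_set G g H) \<longleftrightarrow> inv g \<otimes> c \<otimes> g \<in> centralizer G H"
    if c: "c \<in> carrier G" for c
  proof
    assume "c \<in> centralizer G (conj_set G g H)"
    from conj_centralizer[OF H g order_refl this] show "inv g \<otimes> c \<otimes> g \<in> centralizer G H"
      using g c by (simp add: m_assoc)
  next
    assume "inv g \<otimes> c \<otimes> g \<in> centralizer G H"
    from conj_centralizer[OF gH inv_closed[OF g] _ this]
    have "g \<otimes> (inv g \<otimes> c \<otimes> g \<otimes> inv g) \<in> centralizer G (conj_set G g H)"
      using g by (simp add: conj_set_inv[OF H])
    moreover have "g \<otimes> (inv g \<otimes> c \<otimes> g \<otimes> inv g) = c"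
      using g c by (simp add: m_assoc) (simp flip: m_assoc)
    ultimately show "c \<in> centralizer G (conj_set G g H)" by simp
  qed
  moreover have "conj_set G g (centralizer G H) \<subseteq> carrier G" using C g by (auto simp: conj_set_eq)
  ultimately show ?thesis using mem_conj_set_iff[OF C g] C by blast
qed

text \<open>The source of thinness for \<open>EA\<close>: equal cosets mean that \<open>g'\<close>
  is \<open>g\<close> times an element centralizing \<open>L\<close>, and such a factor does not
  affect conjugation on \<open>L\<close>.\<close>

lemma conj_map_eq_of_coset_eq:
  assumes L: "L \<subseteq> carrier G" and g: "g \<in> carrier G" "g' \<in> carrier G" and x: "x \<in> carrier G"
    and e: "(x \<otimes> g) <# centralizer G L = (x \<otimes> g') <# centralizer G L"
  shows "conj_map G g L = conj_map G g' L"
proof -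
  have "x \<otimes> g' \<in> (x \<otimes> g) <# centralizer G L"
    unfolding e using g x by (intro lcos_self subgroup_centralizer L) auto
  then obtain c where c: "c \<in> centralizer G L" "x \<otimes> g' = x \<otimes> g \<otimes> c" by (auto simp: l_coset_def)
  have cc: "c \<in> carrier G" using c by (simp add: centralizer_def)
  have g': "g' = g \<otimes> c" using c cc g x by (simp add: m_assoc)
  have "g \<otimes> c \<otimes> l \<otimes> inv (g \<otimes> c) = g \<otimes> l \<otimes> inv g" if l: "l \<in> L" for l
  proof -
    have lc: "l \<in> carrier G" "c \<otimes> l = l \<otimes> c" using L l c by (auto simp: centralizer_def)
    have "g \<otimes> c \<otimes> l \<otimes> inv (g \<otimes> c) = g \<otimes> (c \<otimes> l) \<otimes> inv c \<otimes> inv g"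
      using cc lc(1) g by (simp add: inv_mult_group m_assoc)
    also have "\<dots> = g \<otimes> l \<otimes> inv g" unfolding lc(2) using cc lc(1) g by (simp add: m_assoc)
    finally show ?thesis .
  qed
  thus ?thesis unfolding g' conj_map_def by (intro restrict_ext) simp
qed

end

lemma grothendieck_Obj: "Obj (grothendieck C F Fm) = Sigma (Obj C) (\<lambda>x. fst (F x))"
  by (simp add: grothendieck_def Let_def)

lemma grothendieck_Arr:
  "((x, a), \<phi>, (y, b)) \<in> Arr (grothendieck C F Fm) \<longleftrightarrow> x \<in> Obj C \<and> y \<in> Obj C \<and> a \<in> fst (F x) \<and>
     b \<in> fst (F y) \<and> \<phi> \<in> Arr C \<and> Dom C \<phi> = x \<and> Cod C \<phi> = y \<and> Fm \<phi> a = b"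
  by (auto simp: grothendieck_def Let_def)

lemma grothendieck_Dom_Cod:
  "Dom (grothendieck C F Fm) (s, \<phi>, t) = s" "Cod (grothendieck C F Fm) (s, \<phi>, t) = t"
  by (simp_all add: grothendieck_def Let_def)

lemma grothendieck_obj_act:
  "x \<in> Obj C \<Longrightarrow> a \<in> fst (F x) \<Longrightarrow> obj_act (grothendieck C F Fm) g (x, a) = (x, snd (F x) g a)"
  by (simp add: grothendieck_def Let_def)

context finite_group_reps
begin

text \<open>Arrows from \<open>(H, x H)\<close> to \<open>(K, y K)\<close> are G-maps with one
  prescribed value: there is at most one, and there is one exactly when the stabilizers, which here
  are the labels, are nested.\<close>

lemma EO_conj_fibred:
  assumes \<C>: "\<forall>H\<in>\<C>. subgroup H G" and cc: "conj_closed G \<C>"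
  shows "conj_fibred_gcategory G \<R> (\<subset>) \<C> (\<lambda>H. H) (\<lambda>H. H) (EO G \<C>)"
proof -
  have sub: "subgroup H G" "H \<subseteq> carrier G" if "H \<in> \<C>" for H using \<C> that subgroup.subset by blast+
  have ObjO: "Obj (orbit_category G \<C>) = \<C>" by (simp add: orbit_category_def)
  have ArrO: "((H, X), (H', f, K'), (K, Y)) \<in> Arr (EO G \<C>) \<longleftrightarrow> H' = H \<and> K' = K \<and> H \<in> \<C> \<and> K \<in> \<C> \<and>
      X \<in> lcosets H \<and> Y \<in> lcosets K \<and> f \<in> gmaps G (coset_gset G H) (coset_gset G K) \<and> f X = Y"
    for H X H' f K' K Y
    unfolding EO_def grothendieck_Arr by (auto simp: orbit_category_def)
  have lab: "conj_label (H, x <# H) = conj_set G x H" if "H \<in> \<C>" "x \<in> carrier G" for H x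
    using that sub by (intro conj_label_coset) (auto simp: conj_set_self)
  show ?thesis
  proof (intro conj_fibred_gcategory.intro conj_fibred_gcategory_axioms.intro)
    fix a b assume ab: "a \<in> Arr (EO G \<C>)" "b \<in> Arr (EO G \<C>)" "Dom (EO G \<C>) a = Dom (EO G \<C>) b"
      "Cod (EO G \<C>) a = Cod (EO G \<C>) b"
    obtain H X H' f K' K Y where a: "a = ((H, X), (H', f, K'), (K, Y))" by (metis prod.collapse)
    obtain J Z J' f' L' L W where b: "b = ((J, Z), (J', f', L'), (L, W))" by (metis prod.collapse)
    have "J = H" "Z = X" "L = K" "W = Y" using ab(3,4) by (auto simp: a b EO_def grothendieck_Dom_Cod)
    with ab(1,2) have *: "H' = H" "J' = H" "K' = K" "L' = K" "H \<in> \<C>" "X \<in> lcosets H"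
      "f \<in> gmaps G (coset_gset G H) (coset_gset G K)" "f' \<in> gmaps G (coset_gset G H) (coset_gset G K)" "f X = f' X"
      by (auto simp: a b ArrO)
    obtain x where "x \<in> carrier G" "X = x <# H" using * by (auto simp: LCOSETS_def)
    hence "f = f'" using coset_gmap_unique[OF sub(1)] * by blast
    thus "a = b" using * \<open>J = H\<close> \<open>Z = X\<close> \<open>L = K\<close> \<open>W = Y\<close> by (simp add: a b)
  next
    fix z z' assume z: "z \<in> Obj (EO G \<C>)" "z' \<in> Obj (EO G \<C>)"
    obtain H x where H: "z = (H, x <# H)" "H \<in> \<C>" "x \<in> carrier G"
      using z by (auto simp: EO_def grothendieck_Obj ObjO LCOSETS_def)
    obtain K y where K: "z' = (K, y <# K)" "K \<in> \<C>" "y \<in> carrier G"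
      using z by (auto simp: EO_def grothendieck_Obj ObjO LCOSETS_def)
    have l: "x <# H \<in> lcosets H" "y <# K \<in> lcosets K" using H K by (auto simp: LCOSETS_def)
    have "(\<exists>a\<in>Arr (EO G \<C>). Dom (EO G \<C>) a = z \<and> Cod (EO G \<C>) a = z') \<longleftrightarrow>
        (\<exists>f\<in>gmaps G (coset_gset G H) (coset_gset G K). f (x <# H) = y <# K)"
    proof
      assume "\<exists>a\<in>Arr (EO G \<C>). Dom (EO G \<C>) a = z \<and> Cod (EO G \<C>) a = z'"
      then obtain a where a: "a \<in> Arr (EO G \<C>)" "Dom (EO G \<C>) a = z" "Cod (EO G \<C>) a = z'" by blast
      obtain s J f L t where "a = (s, (J, f, L), t)" by (metis prod.collapse)
      with a show "\<exists>f\<in>gmaps G (coset_gset G H) (coset_gset G K). f (x <# H) = y <# K"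
        by (auto simp: EO_def[of G] grothendieck_Dom_Cod H K ArrO[unfolded EO_def])
    next
      assume "\<exists>f\<in>gmaps G (coset_gset G H) (coset_gset G K). f (x <# H) = y <# K"
      then obtain f where "f \<in> gmaps G (coset_gset G H) (coset_gset G K)" "f (x <# H) = y <# K" by blast
      thus "\<exists>a\<in>Arr (EO G \<C>). Dom (EO G \<C>) a = z \<and> Cod (EO G \<C>) a = z'"
        using H K l by (intro bexI[of _ "((H, x <# H), (H, f, K), (K, y <# K))"])
          (auto simp: ArrO, auto simp: EO_def grothendieck_Dom_Cod)
    qed
    also have "\<dots> \<longleftrightarrow> conj_set G x H \<subseteq> conj_set G y K"
      using coset_gmap_fixed[OF sub(1)[OF H(2)] sub(1)[OF K(2)] H(3) K(3)]
        coset_gmap_exists[OF sub(1)[OF H(2)] sub(1)[OF K(2)] H(3) K(3)] by blast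
    finally show "(\<exists>a\<in>Arr (EO G \<C>). Dom (EO G \<C>) a = z \<and> Cod (EO G \<C>) a = z') \<longleftrightarrow>
        conj_label z = conj_label z' \<or> conj_label z \<subset> conj_label z'"
      using H K by (auto simp: lab)
  qed (use sub cc finite_group_reps_axioms psubset.inclusion_order_axioms EO_finite_gcategory[OF finite_carrier \<C>] in \<open>auto simp: conj_closed_def conj_set_self
      conj_set_psubset_iff EO_def grothendieck_Obj ObjO grothendieck_obj_act coset_gset_def\<close>)
qed

text \<open>Since the fusion category is opposed, an arrow from an object over \<open>K\<close> to
  one over \<open>L\<close> comes from a homomorphism \<open>L\<close> to \<open>K\<close>. Hence
  arrows run from larger labels to smaller ones, and \<open>r\<close> is reversed inclusion.\<close>

lemma EA_conj_fibred:
  assumes \<C>: "\<forall>H\<in>\<C>. subgroup H G" and cc: "conj_closed G \<C>"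
  shows "conj_fibred_gcategory G \<R> (\<lambda>A B. B \<subset> A) \<C> (centralizer G) (centralizer G) (EA G \<C>)"
proof -
  let ?C = "centralizer G"
  have sub: "subgroup H G" "H \<subseteq> carrier G" if "H \<in> \<C>" for H using \<C> that subgroup.subset by blast+
  have ObjO: "Obj (opposite (fusion_category G \<C>)) = \<C>" by (simp add: fusion_category_def opposite_def)
  have ArrO: "((K, X), (L', f, K'), (L, Y)) \<in> Arr (EA G \<C>) \<longleftrightarrow> K' = K \<and> L' = L \<and> K \<in> \<C> \<and> L \<in> \<C> \<and>
      X \<in> lcosets (?C K) \<and> Y \<in> lcosets (?C L) \<and>
      (\<exists>g\<in>carrier G. conj_set G g L \<subseteq> K \<and> f = conj_map G g L) \<and> centralizer_coset_map G (L, f, K) X = Y"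
    for K X L' f K' L Y
    unfolding EA_def grothendieck_Arr by (auto simp: fusion_category_def opposite_def)
  have lab: "conj_label (H, x <# ?C H) = conj_set G x H" if "H \<in> \<C>" "x \<in> carrier G" for H x
    using that sub by (intro conj_label_coset) (auto simp: conj_set_centralizer_self subgroup_centralizer)
  have val: "centralizer_coset_map G (L, conj_map G g L, K) (x <# ?C K) = (x \<otimes> g) <# ?C L"
    if "L \<in> \<C>" "K \<in> \<C>" "g \<in> carrier G" "conj_set G g L \<subseteq> K" "x \<in> carrier G" for L K g x
    using centralizer_coset_map_spec(2)[OF sub(2) sub(2)] that by blast
  show ?thesis
  proof (intro conj_fibred_gcategory.intro conj_fibred_gcategory_axioms.intro)
    fix a b assume ab: "a \<in> Arr (EA G \<C>)" "b \<in> Arr (EA G \<C>)" "Dom (EA G \<C>) a = Dom (EA G \<C>) b"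
      "Cod (EA G \<C>) a = Cod (EA G \<C>) b"
    obtain K X L' f K' L Y where a: "a = ((K, X), (L', f, K'), (L, Y))" by (metis prod.collapse)
    obtain M Z J' f' M' J W where b: "b = ((M, Z), (J', f', M'), (J, W))" by (metis prod.collapse)
    have e: "M = K" "Z = X" "J = L" "W = Y" using ab(3,4) by (auto simp: a b EA_def grothendieck_Dom_Cod)
    have a': "K' = K" "L' = L" "K \<in> \<C>" "L \<in> \<C>" "X \<in> lcosets (?C K)"
      "centralizer_coset_map G (L, f, K) X = Y" using ab(1) by (auto simp: a ArrO)
    have b': "M' = K" "J' = L" "centralizer_coset_map G (L, f', K) X = Y" using ab(2) by (auto simp: b ArrO e)
    obtain g where g: "g \<in> carrier G" "conj_set G g L \<subseteq> K" "f = conj_map G g L"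
      using ab(1) by (auto simp: a ArrO)
    obtain g' where g': "g' \<in> carrier G" "conj_set G g' L \<subseteq> K" "f' = conj_map G g' L"
      using ab(2) by (auto simp: b ArrO e)
    obtain x where x: "x \<in> carrier G" "X = x <# ?C K" using a' by (auto simp: LCOSETS_def)
    have "(x \<otimes> g) <# ?C L = (x \<otimes> g') <# ?C L"
      using val[OF a'(4,3) g(1,2) x(1)] val[OF a'(4,3) g'(1,2) x(1)] a'(6) b'(3) by (simp add: x g g')
    hence "f = f'" unfolding g g' by (rule conj_map_eq_of_coset_eq[OF sub(2)[OF a'(4)] g(1) g'(1) x(1)])
    thus "a = b" using a' b' e by (simp add: a b)
  next
    fix z z' assume z: "z \<in> Obj (EA G \<C>)" "z' \<in> Obj (EA G \<C>)"
    obtain K x where K: "z = (K, x <# ?C K)" "K \<in> \<C>" "x \<in> carrier G"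
      using z by (auto simp: EA_def grothendieck_Obj ObjO LCOSETS_def)
    obtain L y where L: "z' = (L, y <# ?C L)" "L \<in> \<C>" "y \<in> carrier G"
      using z by (auto simp: EA_def grothendieck_Obj ObjO LCOSETS_def)
    have l: "x <# ?C K \<in> lcosets (?C K)" "y <# ?C L \<in> lcosets (?C L)" using K L by (auto simp: LCOSETS_def)
    have "(\<exists>a\<in>Arr (EA G \<C>). Dom (EA G \<C>) a = z \<and> Cod (EA G \<C>) a = z') \<longleftrightarrow>
        conj_set G y L \<subseteq> conj_set G x K"
    proof
      assume "\<exists>a\<in>Arr (EA G \<C>). Dom (EA G \<C>) a = z \<and> Cod (EA G \<C>) a = z'"
      then obtain a where a: "a \<in> Arr (EA G \<C>)" "Dom (EA G \<C>) a = z" "Cod (EA G \<C>) a = z'" by blast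
      obtain s J f M t where af: "a = (s, (J, f, M), t)" by (metis prod.collapse)
      have "s = z" "t = z'" using a by (auto simp: af EA_def grothendieck_Dom_Cod)
      with a(1) obtain g where g: "g \<in> carrier G" "conj_set G g L \<subseteq> K"
        "centralizer_coset_map G (L, conj_map G g L, K) (x <# ?C K) = y <# ?C L"
        by (auto simp: af K(1) L(1) ArrO)
      have "y <# ?C L = (x \<otimes> g) <# ?C L" using val[OF L(2) K(2) g(1,2) K(3)] g(3) by simp
      \<comment> \<open>Equal objects have equal labels; this absorbs the ambiguity of
        \<open>y\<close> by an element of the centralizer.\<close>
      hence "conj_set G y L = conj_set G (x \<otimes> g) L"
        using lab[OF L(2,3)] lab[OF L(2), of "x \<otimes> g"] K(3) g(1) by simp
      also have "\<dots> = conj_set G x (conj_set G g L)" using sub(2)[OF L(2)] K(3) g(1) by (simp add: conj_set_mult)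
      also have "\<dots> \<subseteq> conj_set G x K" using g(2) unfolding conj_set_eq[of G x] by (rule image_mono)
      finally show "conj_set G y L \<subseteq> conj_set G x K" .
    next
      assume s: "conj_set G y L \<subseteq> conj_set G x K"
      \<comment> \<open>Forced up to the centralizer of \<open>L\<close>, since the induced map
        sends the coset of \<open>x\<close> to that of \<open>x g\<close>, which has to be the coset
        of \<open>y\<close>.\<close>
      define g where "g = inv x \<otimes> y"
      have g: "g \<in> carrier G" "x \<otimes> g = y" using K L by (auto simp: g_def simp flip: m_assoc)
      have "conj_set G g L = conj_set G (inv x) (conj_set G y L)"
        unfolding g_def using K L sub(2) by (simp add: conj_set_mult)
      also have "\<dots> \<subseteq> conj_set G (inv x) (conj_set G x K)"
        using s unfolding conj_set_eq[of G "inv x"] by (rule image_mono)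
      finally have gL: "conj_set G g L \<subseteq> K" using K sub(2) by (simp add: conj_set_inv)
      have "((K, x <# ?C K), (L, conj_map G g L, K), (L, y <# ?C L)) \<in> Arr (EA G \<C>)"
        unfolding ArrO using val[OF L(2) K(2) g(1) gL K(3)] K L l g gL by auto
      thus "\<exists>a\<in>Arr (EA G \<C>). Dom (EA G \<C>) a = z \<and> Cod (EA G \<C>) a = z'"
        by (rule bexI[rotated]) (simp add: K L EA_def grothendieck_Dom_Cod)
    qed
    thus "(\<exists>a\<in>Arr (EA G \<C>). Dom (EA G \<C>) a = z \<and> Cod (EA G \<C>) a = z') \<longleftrightarrow>
        conj_label z = conj_label z' \<or> conj_label z' \<subset> conj_label z"
      using K L by (auto simp: lab)
  next
    fix Q K assume Q: "Q \<in> \<C>" "subgroup K G"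
    have "Q \<subseteq> carrier G" "K \<subseteq> carrier G" using sub(2)[OF Q(1)] subgroup.subset[OF Q(2)] .
    \<comment> \<open>Both sides say that the elements of \<open>K\<close> commute with those of
      \<open>Q\<close>; the right side splits the inclusion of \<open>Q\<close> in the centralizer
      of \<open>K\<close> into equality and proper inclusion.\<close>
    thus "K \<subseteq> ?C Q \<longleftrightarrow> ?C K = Q \<or> Q \<subset> ?C K"
      unfolding centralizer_def by (auto simp: subset_iff psubset_eq)
  next
    fix H K assume "H \<in> \<C>" "K \<in> \<C>" "K \<subset> H"
    thus "?C H \<subseteq> ?C K" by (auto simp: centralizer_def)
  qed (use sub cc finite_group_reps_axioms psupset.inclusion_order_axioms EA_finite_gcategory[OF finite_carrier \<C>] in \<open>auto simp: conj_closed_def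
      conj_set_centralizer_self centralizer_conj_set subgroup_centralizer
      conj_set_psubset_iff EA_def grothendieck_Obj ObjO grothendieck_obj_act coset_gset_def\<close>)
qed

end

theorem theorem2p33:
  fixes G :: "('g, 'b) monoid_scheme" and \<C> \<R> :: "'g set set"
  assumes "group G" and "finite (carrier G)"
    and "\<forall>H\<in>\<C>. subgroup H G" and "conj_closed G \<C>"
    and "conj_class_reps G \<R>"
  shows "(has_series_Lefschetz G (EO G \<C>)) \<and>
    (has_series_Lefschetz G (EA G \<C>)) \<and>
    (reduced_series_Lefschetz G (EO G \<C>) =
      (\<Oplus>\<^bsub>\<Omega> G\<^esub>H\<in>\<C>. (- of_int (reduced_euler_char (strictly_above \<C> H)) / of_nat (index G H))
          \<odot>\<^bsub>\<Omega> G\<^esub> gclass G (coset_gset G H))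
      \<ominus>\<^bsub>\<Omega> G\<^esub> gclass G (coset_gset G (carrier G))) \<and>
    (reduced_series_Lefschetz G (EA G \<C>) =
      (\<Oplus>\<^bsub>\<Omega> G\<^esub>H\<in>\<C>. (- of_int (reduced_euler_char (strictly_below \<C> H)) / of_nat (index G (centralizer G H)))
          \<odot>\<^bsub>\<Omega> G\<^esub> gclass G (coset_gset G (centralizer G H)))
      \<ominus>\<^bsub>\<Omega> G\<^esub> gclass G (coset_gset G (carrier G))) \<and>
    (reduced_series_Lefschetz G (EO G \<C>) =
      (\<Oplus>\<^bsub>\<Omega> G\<^esub>K\<in>{K \<in> \<R>. K \<notin> \<C>}. of_int (reduced_euler_char (strictly_above \<C> K)) \<odot>\<^bsub>\<Omega> G\<^esub> burnside_idem G K)) \<and>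
    (reduced_series_Lefschetz G (EA G \<C>) =
      (\<Oplus>\<^bsub>\<Omega> G\<^esub>K\<in>{K \<in> \<R>. centralizer G K \<notin> \<C>}.
          of_int (reduced_euler_char (strictly_below \<C> (centralizer G K))) \<odot>\<^bsub>\<Omega> G\<^esub> burnside_idem G K))"
proof -
  interpret group G by fact
  interpret finite_group_reps G \<R>
    by unfold_locales (use assms in auto)
  interpret O: conj_fibred_gcategory G \<R> "(\<subset>)" \<C> "\<lambda>H. H" "\<lambda>H. H" "EO G \<C>"
    by (rule EO_conj_fibred) (use assms in auto)
  interpret A: conj_fibred_gcategory G \<R> "\<lambda>A B. B \<subset> A" \<C> "centralizer G" "centralizer G" "EA G \<C>"
    by (rule EA_conj_fibred) (use assms in auto)
  show ?thesis
    unfolding strictly_above_def strictly_below_def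
    using O.has_series_Lefschetz A.has_series_Lefschetz
      O.reduced_series_Lefschetz_cosets A.reduced_series_Lefschetz_cosets
      O.reduced_series_Lefschetz_idempotents A.reduced_series_Lefschetz_idempotents
    by (intro conjI)
qed

end
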